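(* Let $(G,o)$ be an infinite sourced Eulerian digraph, $G=(V,E)$, and suppose that $\mu$ is a proper Gibbs measure on Eulerian paths from $o$ to $\infty$ in $G$. Then $\mu$ is the law of the random path produced by the following procedure: (1) Sample the wired uniform spanning in-arboretum $A$ of $G$ rooted at infinity, using Wilson's algorithm rooted at infinity. (This arboretum will be the last-exit arboretum of the resulting Eulerian path.) (2) For each vertex $v\in V$, pick a uniform random ordering of the edges of $E^{\rightarrow}_v$ that do not belong to $A$, these orderings being chosen conditionally independently of one another given $A$. (3) Form a stack configuration on $G$ by letting the stack at each vertex $v$ be the list consisting of the edges of $E^\rightarrow_v$ not in $A$ in the random order chosen in step (2), followed at the bottom of the stack (i.e. last in the list) by the edge of $A$ with tail $v$. (4) Let the path be the maximal path started at $o$ that follows this stack configuration.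
   Context: A digraph $G=(V,E)$ consists of a countable set of vertices $V$, a countable set of edges $E$, and a map $E\to V\times V$, $e\mapsto(e^-,e^+)$, sending each edge to its tail $e^-$ and head $e^+$ (loops and multiple edges allowed). Write $E^\rightarrow_v=\{e\in E:e^-=v\}$; its cardinality is the out-degree of $v$, and the in-degree is $\#\{e:e^+=v\}$. $G$ is locally finite if all degrees are finite, and connected if it is connected as an undirected graph. A path is a sequence of vertices $(\gamma_i)$ and edges $(\gamma_{i,i+1})$ such that $\gamma_{i,i+1}$ has tail $\gamma_i$ and head $\gamma_{i+1}$; it is transient if it visits each vertex at most finitely often. An infinite sourced digraph is a pair $(G,o)$ with $G$ an infinite, connected, locally finite digraph and $o$ a distinguished vertex; it is Eulerian if every vertex other than $o$ has in-degree equal to out-degree, while $o$ has out-degree one higher than its in-degree. (Such a digraph is always transient, i.e. its random walk almost surely visits each vertex finitely often.) An Eulerian path from $a$ to $b$ in a finite digraph is a path starting at $a$, ending at $b$ and crossing every edge exactly once. A proper Gibbs measure on Eulerian paths from $o$ to $\infty$ in $G$ is a probability measure on the space of paths in $G$ such that: (i) it is supported on half-infinite paths indexed by $\{0,1,2,\dots\}$ that start at $o$ and cross every edge of $G$ exactly once; (ii) if $X$ is a random path with this law then, for every $n\ge0$, the conditional distribution of the first $n$ steps of $X$ given the steps $X$ takes after time $n$ is that of a uniform random Eulerian path from $o$ to $X_n$ in the graph with edge set $\{X_{i,i+1}:0\le i<n\}$. Random walk: at each step the random walk on $G$ crosses a uniform random edge among those emanating from its current location. Loop-erasure: for a transient path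 $\gamma$ indexed by $\{0,1,\dots\}$ or $\{0,\dots,n\}$, let $t_0=0$ and $t_{i}=1+\max\{t\ge t_{i-1}:\gamma_t=\gamma_{t_{i-1}}\}$ (stopping once this maximum is the final time of $\gamma$); the loop-erasure of $\gamma$ has $i$th vertex $\gamma_{t_i}$ and its edge from the $i$th to the $(i+1)$th vertex is $\gamma_{t_{i+1}-1,t_{i+1}}$. Wilson's algorithm rooted at infinity on a transient digraph: enumerate $V=\{v_1,v_2,\dots\}$. Let $A_0$ be the empty digraph. Given $A_j$, $j\ge0$, run an independent random walk on $G$ from $v_{j+1}$, stopped if and when it hits the set of vertices of $A_j$ (it may run forever; the path has length zero if $v_{j+1}$ is in $A_j$), and let $A_{j+1}$ be the union of $A_j$ with the loop-erasure of this path. The output is $A=\bigcup_{j\ge0}A_j$; it is the wired uniform spanning in-arboretum of $G$ and its law does not depend on the enumeration. Every vertex has out-degree one in $A$. An in-arboretum rooted at infinity is an infinite digraph in which every vertex has out-degree $1$ and whose underlying undirected graph has no cycles; it is spanning in $G$ if it is a subdigraph of $G$ containing every vertex of $G$. The last-exit arboretum of a transient path $P$ has as vertices those visited by $P$, and its edges are the edges $e$ such that $P$ crosses $e$ when it exits $e^-$ for the last time. A stack configuration assigns to each vertex $v$ a list of edges of $E^\rightarrow_v$ (the first entry is the top). The maximal path started at $v_0$ that follows a stack configuration is built by repeatedly doing the following from the current vertex (initially $v_0$): if the current stack at the current vertex is empty, stop; otherwise cross the edge at the top of the stack at the current vertex and remove that edge from the stack. *)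

theory Defs
  imports
    "HOL-Probability.Probability"
    "HOL-Combinatorics.Multiset_Permutations"
    "Graph_Theory.Euler"
begin

text \<open>
  Digraphs are the records \<open>pre_digraph\<close> of the Graph_Theory library; loops and parallel arcs
  are allowed. The name \<open>connected\<close> is qualified because HOL-Analysis uses it as well; in
  Graph_Theory it is connectedness of the underlying undirected graph.
\<close>

locale infinite_sourced_eulerian_digraph = wf_digraph G
  for G :: "('v, 'e) pre_digraph" and source :: 'v +
  assumes countable_verts: "countable (verts G)"
    and countable_arcs: "countable (arcs G)"
    and infinite_verts: "infinite (verts G)"
    and connected_graph: "Digraph_Component.connected G"
    and finite_in: "v \<in> verts G \<Longrightarrow> finite (in_arcs G v)"
    and finite_out: "v \<in> verts G \<Longrightarrow> finite (out_arcs G v)"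
    and source_in_verts: "source \<in> verts G"
    and balanced: "v \<in> verts G \<Longrightarrow> v \<noteq> source \<Longrightarrow> in_degree G v = out_degree G v"
    and balanced_source: "out_degree G source = in_degree G source + 1"


section \<open>Paths\<close>

text \<open>
  A path, finite or half-infinite, is given by its first vertex and its edges: \<open>snd \<gamma> i\<close> is
  the edge crossed from time \<open>i\<close> to time \<open>i + 1\<close>, or \<open>None\<close> if the path has ended by time \<open>i\<close>.
  The vertex at time \<open>i\<close> is then determined; it is \<open>None\<close> beyond the final time.
\<close>

type_synonym ('v, 'e) dpath = "'v \<times> (nat \<Rightarrow> 'e option)"

primrec path_vertex :: "('v, 'e) pre_digraph \<Rightarrow> ('v, 'e) dpath \<Rightarrow> nat \<Rightarrow> 'v option" where
  "path_vertex G \<gamma> 0 = Some (fst \<gamma>)"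
| "path_vertex G \<gamma> (Suc i) = map_option (head G) (snd \<gamma> i)"

text \<open>
  The condition below also forces the edges to occupy an initial segment of times, since
  \<open>path_vertex G \<gamma> (Suc i) = None\<close> if \<open>snd \<gamma> i = None\<close>.
\<close>

definition paths :: "('v, 'e) pre_digraph \<Rightarrow> ('v, 'e) dpath set" where
  "paths G = {\<gamma>. fst \<gamma> \<in> verts G \<and>
     (\<forall>i e. snd \<gamma> i = Some e \<longrightarrow> e \<in> arcs G \<and> path_vertex G \<gamma> i = Some (tail G e))}"

definition infinite_path :: "('v, 'e) dpath \<Rightarrow> bool" where
  "infinite_path \<gamma> \<longleftrightarrow> (\<forall>i. snd \<gamma> i \<noteq> None)"

definition path_take :: "nat \<Rightarrow> ('v, 'e) dpath \<Rightarrow> ('v, 'e) dpath" where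
  "path_take n \<gamma> = (fst \<gamma>, \<lambda>i. if i < n then snd \<gamma> i else None)"

definition starts_with :: "'e list \<Rightarrow> ('v, 'e) dpath \<Rightarrow> bool" where
  "starts_with p \<gamma> \<longleftrightarrow> (\<forall>i < length p. snd \<gamma> i = Some (p ! i))"

definition steps_after :: "nat \<Rightarrow> ('v, 'e) dpath \<Rightarrow> nat \<Rightarrow> 'e option" where
  "steps_after n \<gamma> = (\<lambda>i. snd \<gamma> (n + i))"

definition path_digraph :: "('v, 'e) pre_digraph \<Rightarrow> ('v, 'e) dpath \<Rightarrow> ('v, 'e) pre_digraph" where
  "path_digraph G \<gamma> =
     \<lparr>verts = {v. \<exists>i. path_vertex G \<gamma> i = Some v}, arcs = {e. \<exists>i. snd \<gamma> i = Some e},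
      tail = tail G, head = head G\<rparr>"

definition step_space :: "('v, 'e) pre_digraph \<Rightarrow> (nat \<Rightarrow> 'e option) measure" where
  "step_space G = (\<Pi>\<^sub>M i\<in>UNIV. count_space (insert None (Some ` arcs G)))"

text \<open>Only the measurable space matters here; the measure it carries is irrelevant.\<close>

definition path_space :: "('v, 'e) pre_digraph \<Rightarrow> ('v, 'e) dpath measure" where
  "path_space G = restrict_space (count_space (verts G) \<Otimes>\<^sub>M step_space G) (paths G)"


section \<open>Proper Gibbs measures on Eulerian paths\<close>

text \<open>
  In the last clause the conditioning sigma-algebra is the one generated by the steps after
  time \<open>n\<close>, and \<open>euler_trail\<close> (from Graph_Theory) is taken in the finite digraph formed by the
  first \<open>n\<close> steps of \<open>X\<close>. The vertices of that digraph are the ones visited, so the library's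
  requirement that an Euler trail visit every vertex adds nothing to its crossing each edge
  exactly once. The set of trails is almost surely nonempty, as it contains the first \<open>n\<close> steps
  of \<open>X\<close>.
\<close>

definition proper_gibbs_measure ::
    "('v, 'e) pre_digraph \<Rightarrow> 'v \<Rightarrow> ('v, 'e) dpath measure \<Rightarrow> bool" where
  "proper_gibbs_measure G source \<mu> \<longleftrightarrow>
     prob_space \<mu> \<and> sets \<mu> = sets (path_space G) \<and>
     (AE X in \<mu>. infinite_path X \<and> fst X = source \<and> (\<forall>e\<in>arcs G. \<exists>!i. snd X i = Some e)) \<and>
     (\<forall>n p. length p = n \<longrightarrow>
        (AE X in \<mu>.
           real_cond_exp \<mu> (vimage_algebra (space \<mu>) (steps_after n) (step_space G))
             (indicator {Y \<in> space \<mu>. starts_with p Y}) X =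
           pmf (pmf_of_set {q. pre_digraph.euler_trail (path_digraph G (path_take n X))
                                 source q (the (path_vertex G X n))}) p))"


section \<open>Random walk and loop-erasure\<close>

definition random_walk ::
    "('v, 'e) pre_digraph \<Rightarrow> 'v \<Rightarrow> 'w measure \<Rightarrow> ('w \<Rightarrow> ('v, 'e) dpath) \<Rightarrow> bool" where
  "random_walk G v M W \<longleftrightarrow>
     W \<in> measurable M (path_space G) \<and> (AE \<omega> in M. fst (W \<omega>) = v) \<and>
     (\<forall>p x e. e \<in> out_arcs G x \<longrightarrow>
        \<P>(\<omega> in M. starts_with p (W \<omega>) \<and> fst (W \<omega>) = v \<and>
                    path_vertex G (W \<omega>) (length p) = Some x) \<noteq> 0 \<longrightarrow>
        \<P>(\<omega> in M. snd (W \<omega>) (length p) = Some e \<bar>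
             starts_with p (W \<omega>) \<and> fst (W \<omega>) = v \<and>
             path_vertex G (W \<omega>) (length p) = Some x) = 1 / real (out_degree G x))"

text \<open>
  The times \<open>t\<^sub>i\<close> of the chronological loop-erasure. The last visit \<open>m\<close> to the vertex at time
  \<open>s\<close> is the final time of the path iff no edge is crossed at time \<open>m\<close>. If the vertex is visited
  infinitely often, which a transient path excludes, the erasure is stopped there.
\<close>

primrec loop_erasure_time ::
    "('v, 'e) pre_digraph \<Rightarrow> ('v, 'e) dpath \<Rightarrow> nat \<Rightarrow> nat option" where
  "loop_erasure_time G \<gamma> 0 = Some 0"
| "loop_erasure_time G \<gamma> (Suc i) =
     (case loop_erasure_time G \<gamma> i of
        None \<Rightarrow> None
      | Some s \<Rightarrow>
          (let T = {t. s \<le> t \<and> path_vertex G \<gamma> t = path_vertex G \<gamma> s}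
           in if finite T \<and> snd \<gamma> (Max T) \<noteq> None then Some (1 + Max T) else None))"

definition loop_erasure ::
    "('v, 'e) pre_digraph \<Rightarrow> ('v, 'e) dpath \<Rightarrow> ('v, 'e) dpath" where
  "loop_erasure G \<gamma> =
     (fst \<gamma>, \<lambda>i. case loop_erasure_time G \<gamma> (Suc i) of None \<Rightarrow> None | Some t \<Rightarrow> snd \<gamma> (t - 1))"


section \<open>Wilson's algorithm rooted at infinity\<close>

definition stop_on_hitting ::
    "('v, 'e) pre_digraph \<Rightarrow> 'v set \<Rightarrow> ('v, 'e) dpath \<Rightarrow> ('v, 'e) dpath" where
  "stop_on_hitting G S \<gamma> =
     (if \<exists>t. path_vertex G \<gamma> t \<in> Some ` S
      then path_take (LEAST t. path_vertex G \<gamma> t \<in> Some ` S) \<gamma> else \<gamma>)"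

text \<open>
  \<open>w j\<close> is the (unstopped) walk run in step \<open>j + 1\<close>; the enumeration of the vertices enters
  through the starting points of these walks.
\<close>

primrec wilson_stage ::
    "('v, 'e) pre_digraph \<Rightarrow> (nat \<Rightarrow> ('v, 'e) dpath) \<Rightarrow> nat \<Rightarrow> ('v, 'e) pre_digraph" where
  "wilson_stage G w 0 = \<lparr>verts = {}, arcs = {}, tail = tail G, head = head G\<rparr>"
| "wilson_stage G w (Suc j) =
     Digraph_Component.union (wilson_stage G w j)
       (path_digraph G (loop_erasure G (stop_on_hitting G (verts (wilson_stage G w j)) (w j))))"

definition wilson_arboretum ::
    "('v, 'e) pre_digraph \<Rightarrow> (nat \<Rightarrow> ('v, 'e) dpath) \<Rightarrow> ('v, 'e) pre_digraph" where
  "wilson_arboretum G w = pre_digraph.Union G (range (wilson_stage G w))"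

definition last_exit_arboretum ::
    "('v, 'e) pre_digraph \<Rightarrow> ('v, 'e) dpath \<Rightarrow> ('v, 'e) pre_digraph" where
  "last_exit_arboretum G \<gamma> =
     \<lparr>verts = {v. \<exists>i. path_vertex G \<gamma> i = Some v},
      arcs = {e. \<exists>i. snd \<gamma> i = Some e \<and>
                (\<forall>j>i. \<not> (path_vertex G \<gamma> j = Some (tail G e) \<and> snd \<gamma> j \<noteq> None))},
      tail = tail G, head = head G\<rparr>"


section \<open>Random orderings and stacks\<close>

text \<open>
  \<open>A\<close> is a random subdigraph of \<open>G\<close>. Given (the sigma-algebra generated by) \<open>A\<close>, the \<open>R v\<close> are
  independent, each a uniform ordering of the edges out of \<open>v\<close> that are not in \<open>A\<close>: their
  conditional joint law on any finite set of vertices is a product of uniform laws.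
\<close>

definition uniform_orderings_given ::
    "('v, 'e) pre_digraph \<Rightarrow> 'w measure \<Rightarrow> ('w \<Rightarrow> ('v, 'e) pre_digraph) \<Rightarrow>
     ('v \<Rightarrow> 'w \<Rightarrow> 'e list) \<Rightarrow> bool" where
  "uniform_orderings_given G M A R \<longleftrightarrow>
     (\<forall>v\<in>verts G. R v \<in> measurable M (count_space (lists (out_arcs G v)))) \<and>
     (\<forall>F r. finite F \<longrightarrow> F \<subseteq> verts G \<longrightarrow>
        (AE \<omega> in M.
           real_cond_exp M
             (sigma (space M) ((\<lambda>e. {\<omega> \<in> space M. e \<in> arcs (A \<omega>)}) ` arcs G))
             (indicator {\<omega> \<in> space M. \<forall>v\<in>F. R v \<omega> = r v}) \<omega> =
           (\<Prod>v\<in>F. pmf (pmf_of_set (permutations_of_set (out_arcs G v - arcs (A \<omega>)))) (r v))))"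

text \<open>
  Lists represent stacks, the head being the top. The arboretum almost surely has exactly one edge
  out of \<open>v\<close>, so the first branch below only concerns a null event.
\<close>

definition stack_config ::
    "('v, 'e) pre_digraph \<Rightarrow> ('v \<Rightarrow> 'e list) \<Rightarrow> 'v \<Rightarrow> 'e list" where
  "stack_config A r v =
     r v @ (if out_arcs A v = {} then [] else [THE e. e \<in> out_arcs A v])"

text \<open>The current vertex and the current stacks after \<open>n\<close> steps (frozen once the path stops).\<close>

primrec stack_state ::
    "('v, 'e) pre_digraph \<Rightarrow> 'v \<Rightarrow> ('v \<Rightarrow> 'e list) \<Rightarrow> nat \<Rightarrow> 'v \<times> ('v \<Rightarrow> 'e list)" where
  "stack_state G v S 0 = (v, S)"
| "stack_state G v S (Suc n) =
     (case stack_state G v S n of (u, T) \<Rightarrow>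
        (case T u of [] \<Rightarrow> (u, T) | e # es \<Rightarrow> (head G e, T(u := es))))"

definition maximal_path ::
    "('v, 'e) pre_digraph \<Rightarrow> 'v \<Rightarrow> ('v \<Rightarrow> 'e list) \<Rightarrow> ('v, 'e) dpath" where
  "maximal_path G v S =
     (v, \<lambda>n. case stack_state G v S n of (u, T) \<Rightarrow>
               (case T u of [] \<Rightarrow> None | e # es \<Rightarrow> Some e))"

end

theory Submission
  imports Defs "HOL-Library.Sublist"
begin

text \<open>
  A path is determined by its stacks, that is, by the order in which it leaves each vertex. A ray
  from the source that crosses every arc exactly once is the maximal path that follows its own
  stacks, and the last entries of these stacks are the arcs of its last-exit arboretum
  (\<open>maximal_path_ray_exits\<close>, \<open>arcs_last_exit_arboretum\<close>). It therefore suffices to show that the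
  stacks of a \<open>\<mu>\<close>-random path and the stacks built on the wired arboretum have the same law, and it
  is enough to compare, for finite \<open>J\<close>, the probabilities that the stacks on \<open>J\<close> are given
  orderings \<open>s v\<close> of the arcs out of \<open>v\<close>. Both turn out to be
  \<open>L * (\<Prod>v\<in>J. 1 / fact (out_degree G v - 1))\<close>,
  where \<open>L\<close> is a limit along the finite sets \<open>B\<close> of vertices. Call a choice of one arc out of each
  vertex of \<open>B\<close> a forest on \<open>B\<close> if following the chosen arcs leads out of \<open>B\<close> from everywhere. Then
  \<open>L\<close> is the limit of the proportion of the forests on \<open>B\<close> that choose
  the last arc of \<open>s v\<close> at each \<open>v \<in> J\<close>.

  For the Gibbs measure, two initial segments with the same arcs and the same end are equally likely
  (\<open>prefix_exchangeable\<close>). Such segments are produced by the mechanism behind the BEST theorem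
  (\<open>reroute\<close>): if no last exit from outside \<open>B\<close> leads into \<open>B\<close>, then the stacks on \<open>B\<close> may be
  replaced by any others whose last arcs form a forest on \<open>B\<close>, and the path that follows the new
  stacks crosses the same arcs. Sets of this kind are closed under unions. Let \<open>B\<close> be the largest one
  inside a finite set \<open>V\<close>. Given \<open>B\<close>, all admissible stacks on \<open>B\<close> are equally likely
  (\<open>prob_exits_given_closed\<close>). Letting \<open>V\<close> grow gives the formula, provided that \<open>B\<close> grows to the
  whole graph, and it does (\<open>largest_closed_exhausts\<close>): the vertices that the path leaves for the
  last time before time \<open>n\<close> form a finite set of this kind.

  For Wilson's algorithm, run on a finite set \<open>B\<close> and rooted at the complement of \<open>B\<close>, write \<open>N C\<close> for
  the number of forests on \<open>C\<close>. The loop-erasure of a random walk stopped on leaving \<open>C\<close> is a given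
  simple path \<open>\<gamma>\<close> with probability \<open>N (C - \<gamma>) / N C\<close> (\<open>erasure_mass_forests\<close>). When the walks of the
  algorithm are put together these quotients telescope, so that every forest on \<open>B\<close> has probability
  \<open>1 / N B\<close> (\<open>prob_forest_event\<close>). As \<open>B\<close> grows, the algorithm on \<open>B\<close> and the one rooted at infinity,
  run with the same walks, agree after any number of walks on any given arc from some \<open>B\<close> on
  (\<open>finite_wilson_stabilises\<close>). This uses transience, which holds because a walk from the source is
  expected to visit a vertex at most as
  often as its out-degree (\<open>expected_visits_from_source\<close>). So \<open>L\<close> exists and is the probability that
  the given last arcs belong to the wired arboretum (\<open>uniform_forests_tendsto_wilson\<close>), and the
  uniform ordering of the other arcs contributes the factorials.
\<close>

section \<open>Walks and the order in which they leave the vertices\<close>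

context pre_digraph
begin

text \<open>
  For a walk \<open>p\<close> that follows a stack configuration, this is the part of the stack at \<open>v\<close> that \<open>p\<close> has
  used up.
\<close>

definition exit_list :: "'b list \<Rightarrow> 'a \<Rightarrow> 'b list" where
  "exit_list p v = filter (\<lambda>e. tail G e = v) p"

text \<open>
  Being inductive, the predicate says that the arcs chosen by \<open>f\<close> lead from \<open>v\<close> out of \<open>C\<close> in finitely
  many steps. If it holds at all vertices of \<open>C\<close>, the chosen arcs contain no cycle in \<open>C\<close>.
\<close>

inductive escapes :: "('a \<Rightarrow> 'b) \<Rightarrow> 'a set \<Rightarrow> 'a \<Rightarrow> bool" for f :: "'a \<Rightarrow> 'b" and C :: "'a set" where
  outside: "v \<notin> C \<Longrightarrow> escapes f C v"
| step: "v \<in> C \<Longrightarrow> escapes f C (head G (f v)) \<Longrightarrow> escapes f C v"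

lemma escapes_cong:
  assumes "\<And>v. v \<in> C \<Longrightarrow> f v = g v"
  shows "escapes f C v \<longleftrightarrow> escapes g C v"
proof -
  have "escapes k C v" if "escapes h C v" "\<And>v. v \<in> C \<Longrightarrow> h v = k v" for h k
    using that(1)
  proof induction
    case (step v)
    then show ?case using that(2)[of v] escapes.step[of v C k] by simp
  qed (rule escapes.outside)
  then show ?thesis using assms by metis
qed

lemma escapes_subset:
  assumes "escapes f B v" "C \<subseteq> B"
  shows "escapes f C v"
  using assms(1)
proof induction
  case (outside v) then show ?case using assms(2) by (intro escapes.outside) auto
next
  case (step v) then show ?case by (cases "v \<in> C") (auto intro: escapes.intros)
qed

lemma exit_list_simps [simp]:
  "exit_list [] v = []"
  "exit_list (e # p) v = (if tail G e = v then e # exit_list p v else exit_list p v)"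
  "exit_list (p @ q) v = exit_list p v @ exit_list q v"
  by (auto simp: exit_list_def)

lemma set_exit_list: "set (exit_list p v) = {e \<in> set p. tail G e = v}"
  by (auto simp: exit_list_def)

lemma distinct_exit_list: "distinct p \<Longrightarrow> distinct (exit_list p v)"
  by (auto simp: exit_list_def)

lemma distinct_if_exit_lists_distinct:
  "(\<And>v. distinct (exit_list p v)) \<Longrightarrow> distinct p"
proof (induction p)
  case (Cons e p)
  have "distinct (exit_list p v)" for v
    using Cons.prems[of v] by (auto split: if_splits)
  moreover have "e \<notin> set p"
    using Cons.prems[of "tail G e"] by (auto simp: set_exit_list)
  ultimately show ?case using Cons.IH by auto
qed simp

text \<open>
  The first arc of a walk is the top of the stack at its starting point, and the rest of the walk
  starts at the head of that arc and has the remaining stacks.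
\<close>

lemma walk_determined_by_exit_lists:
  "cas u p v \<Longrightarrow> cas u q w \<Longrightarrow> exit_list p = exit_list q \<Longrightarrow> p = q"
proof (induction p arbitrary: u q)
  case Nil
  have "set q = {}"
  proof (rule ccontr)
    assume "set q \<noteq> {}"
    then obtain e where "e \<in> set q" by (metis ex_in_conv)
    then have "e \<in> set (exit_list q (tail G e))" by (simp add: set_exit_list)
    with Nil.prems(3) show False by (metis exit_list_simps(1) list.set(1) empty_iff)
  qed
  then show ?case by simp
next
  case (Cons e p)
  have ex: "exit_list q x = exit_list (e # p) x" for x using Cons.prems(3) by (simp only:)
  have te: "tail G e = u" using Cons.prems(1) by simp
  have "exit_list q u = e # exit_list p u" using ex[of u] te by simp
  then obtain e' q' where q: "q = e' # q'" by (cases q) auto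
  with Cons.prems(2) have te': "tail G e' = u" by simp
  have ee: "e' = e" using ex[of u] te te' q by simp
  have "exit_list p = exit_list q'"
  proof
    fix x show "exit_list p x = exit_list q' x"
      using ex[of x] unfolding q ee by (auto split: if_splits)
  qed
  then show ?case
    using Cons.IH[of "head G e" q'] Cons.prems(1,2) q ee by auto
qed

lemma cas_balance_lists:
  "cas u p v \<Longrightarrow>
   length (filter (\<lambda>e. head G e = x) p) + of_bool (x = u) =
   length (exit_list p x) + of_bool (x = v)"
proof (induction p arbitrary: u)
  case (Cons e p)
  have "cas (head G e) p v" "u = tail G e" using Cons.prems by auto
  with Cons.IH[of "head G e"] show ?case by (cases "x = head G e"; cases "x = tail G e") auto
qed auto

lemma cas_balance:
  assumes "cas u p v" "distinct p"
  shows "card {e \<in> set p. head G e = x} + of_bool (x = u) =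
         card {e \<in> set p. tail G e = x} + of_bool (x = v)"
proof -
  have "card {e \<in> set p. head G e = x} = length (filter (\<lambda>e. head G e = x) p)"
    using assms(2) by (metis distinct_card distinct_filter set_filter)
  moreover have "card {e \<in> set p. tail G e = x} = length (exit_list p x)"
    using assms(2) by (metis distinct_card distinct_exit_list set_exit_list)
  ultimately show ?thesis using cas_balance_lists[OF assms(1)] by simp
qed

end

context infinite_sourced_eulerian_digraph
begin

text \<open>
  The new walk is a longest walk \<open>q\<close> that follows the new stacks \<open>T\<close>. Counting arrivals and departures
  shows that it can only get stuck at \<open>b\<close>. Let \<open>Z\<close> be the set of the vertices whose stack \<open>q\<close> does not
  use up. At such a vertex the last arc is left over, so its head has an unused arc coming in and, by
  balance, one going out: the last arcs lead from \<open>Z\<close> to \<open>Z\<close>, and never to \<open>b\<close>. Outside \<open>B\<close> the last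
  arcs are the last exits of \<open>p\<close>, which stay outside \<open>B\<close> and end at \<open>b\<close>, so \<open>Z\<close> lies in \<open>B\<close>. There the
  last arcs lead out of \<open>B\<close>, so \<open>Z\<close> is empty.
\<close>

lemma reroute:
  assumes p: "awalk source p b" "distinct p"
    and cov_out: "\<And>v. v \<in> B \<Longrightarrow> out_arcs G v \<subseteq> set p"
    and cov_in: "\<And>v. v \<in> B \<Longrightarrow> in_arcs G v \<subseteq> set p"
    and clo: "\<And>v. v \<notin> B \<Longrightarrow> exit_list p v \<noteq> [] \<Longrightarrow> head G (last (exit_list p v)) \<notin> B"
    and s: "\<And>v. v \<in> B \<Longrightarrow> s v \<in> permutations_of_set (out_arcs G v)"
    and esc: "\<And>v. v \<in> B \<Longrightarrow> escapes (\<lambda>v. last (s v)) B v"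
  shows "\<exists>q. awalk source q b \<and> distinct q \<and> set q = set p \<and>
             (\<forall>v. exit_list q v = (if v \<in> B then s v else exit_list p v))"
proof -
  define T where "T v = (if v \<in> B then s v else exit_list p v)" for v
  have sub: "set p \<subseteq> arcs G" using p(1) by blast
  have setT: "set (T v) = {e \<in> set p. tail G e = v}" for v
    using s[of v] cov_out[of v] sub
    by (auto simp: T_def set_exit_list permutations_of_set_def out_arcs_def)
  have distT: "distinct (T v)" for v
    using s[of v] p(2) by (auto simp: T_def distinct_exit_list permutations_of_set_def)
  define F where "F = {q. (\<exists>v. awalk source q v) \<and> (\<forall>v. prefix (exit_list q v) (T v))}"
  have F_sub: "set q \<subseteq> set p" and F_dist: "distinct q" if "q \<in> F" for q
  proof -
    have pre: "prefix (exit_list q v) (T v)" for v using that by (simp add: F_def)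
    show "set q \<subseteq> set p"
    proof
      fix e assume "e \<in> set q"
      then have "e \<in> set (exit_list q (tail G e))" by (simp add: set_exit_list)
      then have "e \<in> set (T (tail G e))" using pre set_mono_prefix by blast
      then show "e \<in> set p" by (simp add: setT)
    qed
    show "distinct q"
      by (rule distinct_if_exit_lists_distinct) (metis pre distT distinct_append prefix_def)
  qed
  have "length q \<le> card (set p)" if "q \<in> F" for q
    using F_sub[OF that] F_dist[OF that] by (metis List.finite_set card_mono distinct_card)
  moreover have "[] \<in> F" using p(1) by (auto simp: F_def awalk_Nil_iff intro!: exI[of _ source])
  ultimately obtain q where q: "q \<in> F" and qmax: "\<And>r. r \<in> F \<Longrightarrow> length r \<le> length q"
    using ex_has_greatest_nat[of "\<lambda>q. q \<in> F" "[]" length "Suc (card (set p))"] by (auto simp: less_Suc_eq_le)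
  obtain c where c: "awalk source q c" using q by (auto simp: F_def)
  have pre: "prefix (exit_list q v) (T v)" for v using q by (simp add: F_def)
  have stuck: "exit_list q c = T c"
  proof (rule ccontr)
    assume "exit_list q c \<noteq> T c"
    with pre[of c] obtain e r where e: "T c = exit_list q c @ e # r"
      by (metis append_self_conv prefix_def neq_Nil_conv)
    have "e \<in> set (T c)" using e by simp
    then have e': "e \<in> arcs G" "tail G e = c" using sub by (auto simp: setT)
    have "awalk source (q @ [e]) (head G e)"
      using c e' by (auto simp: awalk_simps)
    moreover have "prefix (exit_list (q @ [e]) v) (T v)" for v
      using pre[of v] e e' by (cases "v = c") auto
    ultimately have "q @ [e] \<in> F" by (auto simp: F_def)
    from qmax[OF this] show False by simp
  qed
  note balq = cas_balance[of source q c, OF _ F_dist[OF q]]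
  note balp = cas_balance[of source p b, OF _ p(2)]
  have casq: "cas source q c" and casp: "cas source p b" using c p(1) by (auto simp: awalk_def)
  have out_le: "card {e \<in> set q. tail G e = x} \<le> card {e \<in> set p. tail G e = x}"
   and in_le: "card {e \<in> set q. head G e = x} \<le> card {e \<in> set p. head G e = x}" for x
    using F_sub[OF q] by (auto intro!: card_mono)
  have outc: "card {e \<in> set q. tail G e = c} = card {e \<in> set p. tail G e = c}"
    using arg_cong[OF stuck, of set] by (simp add: setT set_exit_list)
  have cb: "c = b"
  proof (rule ccontr)
    assume "c \<noteq> b"
    then show False using balq[OF casq, of c] balp[OF casp, of c] outc in_le[of c] by simp
  qed
  have outq: "card {e \<in> set q. tail G e = x} < card {e \<in> set p. tail G e = x} \<longleftrightarrow> exit_list q x \<noteq> T x" for x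
  proof
    assume "exit_list q x \<noteq> T x"
    then obtain r where r: "T x = exit_list q x @ r" "r \<noteq> []" using pre[of x] by (auto simp: prefix_def)
    have "card {e \<in> set q. tail G e = x} = length (exit_list q x)"
      by (metis F_dist[OF q] distinct_card distinct_exit_list set_exit_list)
    moreover have "card {e \<in> set p. tail G e = x} = length (T x)"
      by (metis distT distinct_card setT)
    ultimately show "card {e \<in> set q. tail G e = x} < card {e \<in> set p. tail G e = x}"
      using r by (cases r) auto
  next
    assume "card {e \<in> set q. tail G e = x} < card {e \<in> set p. tail G e = x}"
    then show "exit_list q x \<noteq> T x" by (metis less_irrefl setT set_exit_list)
  qed
  define Z where "Z = {v. exit_list q v \<noteq> T v}"
  have Zstep: "T v \<noteq> []" "head G (last (T v)) \<in> Z" "head G (last (T v)) \<noteq> b" if vZ: "v \<in> Z" for v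
  proof -
    obtain r where r: "T v = exit_list q v @ r" "r \<noteq> []"
      using pre[of v] vZ by (auto simp: prefix_def Z_def)
    show Tne: "T v \<noteq> []" using r by simp
    have lr: "last (T v) \<in> set r" using r by simp
    then have nq: "last (T v) \<notin> set (exit_list q v)" using r distT[of v] by auto
    have lp: "last (T v) \<in> set p" "tail G (last (T v)) = v"
      using last_in_set[OF Tne] unfolding setT by auto
    then have nq': "last (T v) \<notin> set q" using nq by (auto simp: set_exit_list)
    let ?y = "head G (last (T v))"
    have lt: "card {e \<in> set q. head G e = ?y} < card {e \<in> set p. head G e = ?y}"
      using nq' lp F_sub[OF q] by (intro psubset_card_mono) auto
    then have lt2: "card {e \<in> set q. tail G e = ?y} < card {e \<in> set p. tail G e = ?y}"
      using balq[OF casq, of ?y] balp[OF casp, of ?y] cb by simp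
    then show "?y \<in> Z" unfolding Z_def mem_Collect_eq outq[symmetric] .
    show "?y \<noteq> b" using lt2 outc cb by auto
  qed
  \<comment> \<open>Backwards along \<open>p\<close>: the last exit of \<open>p\<close> from a vertex outside
    \<open>B\<close> leads to \<open>b\<close> or to a vertex outside \<open>B\<close> that \<open>p\<close>
    leaves again later.\<close>
  have suffix: "\<forall>z \<in> tail G ` set p2. z \<notin> B \<longrightarrow> z \<notin> Z" if "p = p1 @ p2" for p1 p2
    using that
  proof (induction p2 arbitrary: p1)
    case (Cons e p2)
    have IH: "\<forall>z \<in> tail G ` set p2. z \<notin> B \<longrightarrow> z \<notin> Z"
      using Cons.IH[of "p1 @ [e]"] Cons.prems by simp
    have "tail G e \<notin> Z" if nB: "tail G e \<notin> B"
    proof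
      assume Z: "tail G e \<in> Z"
      then have new: "tail G e \<notin> tail G ` set p2" using IH nB by blast
      then have nil: "exit_list p2 (tail G e) = []"
        unfolding exit_list_def filter_empty_conv by (metis imageI)
      have lst: "T (tail G e) = exit_list p (tail G e)" "last (exit_list p (tail G e)) = e"
                "exit_list p (tail G e) \<noteq> []"
        using nB Cons.prems nil by (auto simp: T_def)
      have y: "head G e \<in> Z" "head G e \<noteq> b" using Zstep[OF Z] lst by auto
      have yB: "head G e \<notin> B" using clo[OF nB lst(3)] lst(2) by simp
      have "cas (head G e) p2 b" using casp Cons.prems by simp
      then have "head G e \<in> tail G ` set p2" using y(2) by (cases p2) auto
      then show False using IH y yB by blast
    qed
    then show ?case using IH by auto
  qed simp
  have ZB: "Z \<subseteq> B"
  proof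
    fix z assume z: "z \<in> Z"
    have "last (T z) \<in> set p" "tail G (last (T z)) = z"
      using last_in_set[OF Zstep(1)[OF z]] unfolding setT by auto
    then show "z \<in> B" using suffix[of "[]" p] z by force
  qed
  have noesc: "v \<notin> Z" if "escapes (\<lambda>v. last (s v)) B v" for v
    using that
  proof induction
    case (outside v) then show ?case using ZB by blast
  next
    case (step v) then show ?case using Zstep(2)[of v] by (auto simp: T_def)
  qed
  have "Z = {}" using noesc esc ZB by blast
  then have exq: "exit_list q v = T v" for v by (auto simp: Z_def)
  have "set q = set p"
  proof
    show "set p \<subseteq> set q"
    proof
      fix e assume "e \<in> set p"
      then have "e \<in> set (T (tail G e))" by (simp add: setT)
      then show "e \<in> set q" by (simp add: exq[symmetric] set_exit_list)
    qed
  qed (use F_sub[OF q] in auto)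
  then show ?thesis
    using c cb F_dist[OF q] exq by (intro exI[of _ q]) (auto simp: T_def)
qed

end

section \<open>Spanning forests and loop-erased walks\<close>

lemma nn_integral_count_space_times:
  fixes f :: "'x \<Rightarrow> ennreal" and g :: "'y \<Rightarrow> ennreal"
  shows "(\<integral>\<^sup>+z. f (fst z) * g (snd z) \<partial>count_space (A \<times> B)) =
         (\<integral>\<^sup>+x. f x \<partial>count_space A) * (\<integral>\<^sup>+y. g y \<partial>count_space B)"
proof -
  have "(\<integral>\<^sup>+z. f (fst z) * g (snd z) \<partial>count_space (A \<times> B)) =
        (\<integral>\<^sup>+z. (f (fst z) * indicator A (fst z)) * (g (snd z) * indicator B (snd z)) \<partial>count_space UNIV)"
    by (subst nn_integral_count_space_indicator)
       (auto intro!: nn_integral_cong simp: indicator_def split: prod.splits)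
  also have "\<dots> = (\<integral>\<^sup>+x. \<integral>\<^sup>+y. (f x * indicator A x) * (g y * indicator B y) \<partial>count_space UNIV \<partial>count_space UNIV)"
    by (subst nn_integral_fst_count_space[symmetric]) simp
  also have "\<dots> = (\<integral>\<^sup>+x. f x * indicator A x \<partial>count_space UNIV) * (\<integral>\<^sup>+y. g y * indicator B y \<partial>count_space UNIV)"
    by (simp add: nn_integral_cmult nn_integral_multc)
  also have "\<dots> = (\<integral>\<^sup>+x. f x \<partial>count_space A) * (\<integral>\<^sup>+y. g y \<partial>count_space B)"
    by (simp add: nn_integral_count_space_indicator)
  finally show ?thesis .
qed

context pre_digraph
begin

text \<open>
  Spanning forests of \<open>C\<close> rooted at the complement of \<open>C\<close>, represented by the arc out of each vertex of
  \<open>C\<close>. Extensionality makes this representation unique, so that forests can be counted.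
\<close>

definition forests :: "'a set \<Rightarrow> ('a \<Rightarrow> 'b) set" where
  "forests C = {f \<in> PiE C (out_arcs G). \<forall>v\<in>C. escapes f C v}"

definition exit_walk :: "'a set \<Rightarrow> 'a \<Rightarrow> 'b list \<Rightarrow> bool" where
  "exit_walk C u p \<longleftrightarrow> (\<exists>v. awalk u p v \<and> v \<notin> C) \<and> (\<forall>e\<in>set p. tail G e \<in> C)"

text \<open>
  The possible values of the loop-erasure of a walk from \<open>u\<close> stopped on leaving \<open>C\<close>; only \<open>[]\<close> if \<open>u\<close> is
  outside \<open>C\<close>.
\<close>

definition simple_exits :: "'a set \<Rightarrow> 'a \<Rightarrow> 'b list set" where
  "simple_exits C u = {p. exit_walk C u p \<and> distinct (map (tail G) p)}"

text \<open>
  The arc kept is the last exit from the first vertex, and the recursion continues with the part of the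
  list after this exit, which is found by reading the list backwards.
\<close>

function list_loop_erasure :: "'b list \<Rightarrow> 'b list" where
  "list_loop_erasure [] = []"
| "list_loop_erasure (e # p) =
     last (exit_list (e # p) (tail G e)) #
     list_loop_erasure (rev (takeWhile (\<lambda>a. tail G a \<noteq> tail G e) (rev p)))"
  by pat_completeness auto
termination
  by (relation "Wellfounded.measure length") (auto simp: le_imp_less_Suc length_takeWhile_le[of _ "rev _", simplified])

definition walk_weight :: "'b list \<Rightarrow> real" where
  "walk_weight p = prod_list (map (\<lambda>e. 1 / real (out_degree G (tail G e))) p)"

lemma walk_weight_simps [simp]:
  "walk_weight [] = 1"
  "walk_weight (e # p) = 1 / real (out_degree G (tail G e)) * walk_weight p"
  "walk_weight (p @ q) = walk_weight p * walk_weight q"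
  by (auto simp: walk_weight_def)

lemma walk_weight_nonneg [simp]: "walk_weight p \<ge> 0"
  by (induction p) auto

lemma list_loop_erasure_last_exit:
  assumes "tail G (hd (l @ [e])) = tail G e" "\<forall>a\<in>set r. tail G a \<noteq> tail G e"
  shows "list_loop_erasure (l @ e # r) = e # list_loop_erasure r"
proof -
  have nil: "exit_list r (tail G e) = []"
    using assms(2) by (auto simp: exit_list_def filter_empty_conv)
  show ?thesis
  proof (cases l)
    case Nil
    have all: "takeWhile (\<lambda>a. tail G a \<noteq> tail G e) (rev r) = rev r"
      using assms(2) by (simp add: takeWhile_eq_all_conv)
    show ?thesis
      unfolding Nil append_Nil list_loop_erasure.simps all rev_rev_ident by (simp add: nil)
  next
    case (Cons x l')
    then have x: "tail G x = tail G e" using assms(1) by simp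
    have "takeWhile (\<lambda>a. tail G a \<noteq> tail G e) (rev (l' @ e # r)) = rev r"
      using assms(2) by (simp add: takeWhile_append takeWhile_eq_all_conv)
    then show ?thesis using Cons x nil by simp
  qed
qed

lemma last_exit_decomposition:
  assumes "p \<noteq> []"
  obtains l e r where "p = l @ e # r" "tail G (hd p) = tail G e"
    "\<forall>a\<in>set r. tail G a \<noteq> tail G e"
proof -
  have "\<exists>x\<in>set p. tail G x = tail G (hd p)" using assms by auto
  from split_list_last_prop[OF this] show ?thesis using that by metis
qed

end

context wf_digraph
begin

lemma exit_walk_Nil [simp]: "exit_walk C u [] \<longleftrightarrow> u \<in> verts G \<and> u \<notin> C"
  by (auto simp: exit_walk_def awalk_simps)

lemma exit_walk_Cons [simp]:
  "exit_walk C u (e # p) \<longleftrightarrow> u \<in> C \<and> e \<in> out_arcs G u \<and> exit_walk C (head G e) p"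
  by (auto simp: exit_walk_def awalk_simps)

lemma exit_walk_in_verts: "exit_walk C u p \<Longrightarrow> u \<in> verts G"
  by (auto simp: exit_walk_def)

lemma exit_walk_escapes:
  "exit_walk C u p \<Longrightarrow> \<forall>e\<in>set p. f (tail G e) = e \<Longrightarrow> escapes f C u \<and> (\<forall>e\<in>set p. escapes f C (tail G e))"
proof (induction p arbitrary: u)
  case (Cons e p)
  have "escapes f C (head G e)" "\<forall>a\<in>set p. escapes f C (tail G a)"
    using Cons.IH[of "head G e"] Cons.prems by auto
  then show ?case using Cons.prems escapes.step[of u C f] by auto
qed (auto intro: escapes.outside)

lemma exit_path_unique:
  "exit_walk C u p \<Longrightarrow> exit_walk C u q \<Longrightarrow> \<forall>e\<in>set p. f (tail G e) = e \<Longrightarrow>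
   \<forall>e\<in>set q. f (tail G e) = e \<Longrightarrow> p = q"
proof (induction p arbitrary: u q)
  case Nil then show ?case by (cases q) auto
next
  case (Cons e p)
  show ?case
  proof (cases q)
    case Nil then show ?thesis using Cons.prems by simp
  next
    case (Cons e' q')
    have "e' = f (tail G e')" "e = f (tail G e)" using Cons.prems(3,4) Cons by auto
    moreover have "tail G e' = u" "tail G e = u" using Cons.prems(1,2) Cons by auto
    ultimately have "e' = e" by simp
    then show ?thesis using Cons.IH[of "head G e" q'] Cons.prems Cons by simp
  qed
qed

text \<open>
  If the walk were in the same vertex twice, the parts from these two times on would both be the walk
  that follows \<open>f\<close> out of \<open>C\<close>, although one is shorter than the other.
\<close>

lemma exit_path_distinct:
  "exit_walk C u p \<Longrightarrow> \<forall>e\<in>set p. f (tail G e) = e \<Longrightarrow> distinct (map (tail G) p)"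
proof (induction p arbitrary: u)
  case (Cons e p)
  have "tail G e \<notin> tail G ` set p"
  proof
    assume "tail G e \<in> tail G ` set p"
    then obtain e' where e': "e' \<in> set p" "tail G e' = tail G e" by auto
    then have "e' = e" using Cons.prems(2) by (metis list.set_intros)
    then obtain p1 p2 where p: "p = p1 @ e # p2" using e' by (meson split_list)
    have suf: "exit_walk C w (e # p2)" if "exit_walk C w' (p1 @ e # p2)" "w = tail G e" for w w'
      using that by (induction p1 arbitrary: w') (auto dest: exit_walk_in_verts)
    have "exit_walk C u (e # p2)"
      using Cons.prems(1) p by (intro suf[of "head G e"]) auto
    then have "e # p = e # p2"
      using Cons.prems p by (intro exit_path_unique[of C u _ _ f]) auto
    then show False using p by simp
  qed
  then show ?case using Cons by auto
qed simp

lemma escapes_exit_path: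
  assumes "escapes f C u" "f \<in> PiE C (out_arcs G)" "u \<in> verts G"
  shows "\<exists>p\<in>simple_exits C u. \<forall>e\<in>set p. f (tail G e) = e"
proof -
  have "\<exists>p. exit_walk C u p \<and> (\<forall>e\<in>set p. f (tail G e) = e)"
    using assms
  proof induction
    case (outside v) then show ?case by (intro exI[of _ "[]"]) auto
  next
    case (step v)
    have fv: "f v \<in> out_arcs G v" using step.hyps step.prems by (auto simp: PiE_def)
    then obtain p where "exit_walk C (head G (f v)) p" "\<forall>e\<in>set p. f (tail G e) = e"
      using step.IH step.prems by auto
    then show ?case using step.hyps fv by (intro exI[of _ "f v # p"]) auto
  qed
  then show ?thesis using exit_path_distinct by (auto simp: simple_exits_def)
qed

lemma forests_restrict:
  assumes "f \<in> forests C" "D \<subseteq> C"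
  shows "restrict f D \<in> forests D"
proof -
  have "escapes (restrict f D) D v" if "escapes f C v" for v
    using escapes_subset[OF that assms(2)] escapes_cong[of D f "restrict f D"] by simp
  then show ?thesis using assms by (auto simp: forests_def)
qed

lemma hd_exit_list_simple:
  assumes "distinct (map (tail G) p)" "e \<in> set p"
  shows "hd (exit_list p (tail G e)) = e"
  using assms
proof (induction p)
  case (Cons a p)
  show ?case
  proof (cases "a = e")
    case False
    then have "e \<in> set p" using Cons.prems by simp
    moreover from this have "tail G a \<noteq> tail G e" using Cons.prems(1) by (auto simp: image_iff)
    ultimately show ?thesis using Cons by simp
  qed simp
qed simp

text \<open>
  In a forest that contains the path \<open>g\<close>, the other vertices are led out of \<open>C\<close> or into \<open>g\<close>, so that
  they carry a forest of the smaller set, in which the vertices of \<open>g\<close> count as roots. Conversely \<open>g\<close> can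
  be added to any such forest, because it leads out of \<open>C\<close>.
\<close>

lemma bij_betw_forests_along_path:
  assumes g: "g \<in> simple_exits C u"
  shows "bij_betw (\<lambda>f. restrict f (C - tail G ` set g))
           {f \<in> forests C. \<forall>e\<in>set g. f (tail G e) = e} (forests (C - tail G ` set g))"
proof -
  have gw: "exit_walk C u g" and gd: "distinct (map (tail G) g)" using g by (auto simp: simple_exits_def)
  have gC: "tail G ` set g \<subseteq> C" using gw by (auto simp: exit_walk_def)
  have garc: "e \<in> arcs G" if "e \<in> set g" for e using gw that by (auto simp: exit_walk_def)
  let ?D = "C - tail G ` set g"
  \<comment> \<open>Adds the path \<open>g\<close> to a forest of the rest; \<open>hd\<close> picks the arc of
    \<open>g\<close> out of \<open>x\<close>.\<close>
  define ext where "ext h = (\<lambda>x. if x \<in> tail G ` set g then hd (exit_list g x) else h x)" for h :: "'a \<Rightarrow> 'b"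
  have ext_g: "ext h (tail G e) = e" if "e \<in> set g" for h e
    using that hd_exit_list_simple[OF gd that] by (auto simp: ext_def)
  have ext_in: "ext h \<in> forests C" if h: "h \<in> forests ?D" for h
  proof -
    have esc: "escapes (ext h) C v" if "escapes h ?D v" for v
      using that
    proof induction
      case (outside v)
      show ?case
      proof (cases "v \<in> C")
        case True
        then obtain e where "e \<in> set g" "v = tail G e" using outside by auto
        then show ?thesis using exit_walk_escapes[OF gw, of "ext h"] ext_g by auto
      qed (rule escapes.outside)
    next
      case (step v)
      then have "ext h v = h v" by (simp add: ext_def)
      with step show ?case using escapes.step[of v C "ext h"] by simp
    qed
    have "ext h v \<in> out_arcs G v" if v: "v \<in> C" for v
    proof (cases "v \<in> tail G ` set g")
      case True
      then obtain e where "e \<in> set g" "v = tail G e" by auto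
      then show ?thesis using ext_g[of e h] garc[of e] by simp
    qed (use h v in \<open>auto simp: forests_def ext_def PiE_def Pi_def\<close>)
    moreover have "ext h v = undefined" if "v \<notin> C" for v
      using that gC h by (auto simp: ext_def forests_def PiE_def extensional_def)
    moreover have "escapes (ext h) C v" if "v \<in> C" for v
      using that h esc by (cases "v \<in> ?D") (auto simp: forests_def intro: escapes.outside)
    ultimately show ?thesis by (auto simp: forests_def)
  qed
  show ?thesis
  proof (rule bij_betw_byWitness[where f' = ext])
    show "\<forall>f\<in>{f \<in> forests C. \<forall>e\<in>set g. f (tail G e) = e}. ext (restrict f ?D) = f"
    proof safe
      fix f assume f: "f \<in> forests C" "\<forall>e\<in>set g. f (tail G e) = e"
      show "ext (restrict f ?D) = f"
      proof
        fix x
        show "ext (restrict f ?D) x = f x"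
        proof (cases "x \<in> tail G ` set g")
          case True then show ?thesis using f(2) ext_g by auto
        next
          case False
          then show ?thesis using f(1)
            by (cases "x \<in> C") (auto simp: ext_def forests_def PiE_def extensional_def)
        qed
      qed
    qed
    show "\<forall>h\<in>forests ?D. restrict (ext h) ?D = h"
    proof safe
      fix h assume h: "h \<in> forests ?D"
      show "restrict (ext h) ?D = h"
        using h by (intro ext) (auto simp: ext_def forests_def PiE_def extensional_def restrict_def)
    qed
    show "(\<lambda>f. restrict f ?D) ` {f \<in> forests C. \<forall>e\<in>set g. f (tail G e) = e} \<subseteq> forests ?D"
      using forests_restrict by auto
    show "ext ` forests ?D \<subseteq> {f \<in> forests C. \<forall>e\<in>set g. f (tail G e) = e}"
      using ext_in ext_g by auto
  qed
qed

lemma list_loop_erasure_walk: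
  "awalk u p v \<Longrightarrow> awalk u (list_loop_erasure p) v \<and> set (list_loop_erasure p) \<subseteq> set p \<and>
     distinct (map (tail G) (list_loop_erasure p))"
proof (induction "length p" arbitrary: p u rule: less_induct)
  case less
  show ?case
  proof (cases "p = []")
    case False
    then obtain l e r where p: "p = l @ e # r" "tail G (hd p) = tail G e"
      "\<forall>a\<in>set r. tail G a \<noteq> tail G e" by (rule last_exit_decomposition)
    have te: "tail G e = u" using p(2) less.prems False by (cases p) (auto simp: awalk_simps)
    have er: "list_loop_erasure p = e # list_loop_erasure r"
      unfolding p(1) using p by (intro list_loop_erasure_last_exit) (auto simp: hd_append)
    have r: "awalk (head G e) r v" "e \<in> arcs G"
      using less.prems p(1) by (auto simp: awalk_simps)
    with less.hyps[of r "head G e"] p(1) have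
      "awalk (head G e) (list_loop_erasure r) v" "set (list_loop_erasure r) \<subseteq> set r"
      "distinct (map (tail G) (list_loop_erasure r))" by auto
    then show ?thesis using er r te p(1,3) by (auto simp: awalk_simps)
  qed (use less.prems in auto)
qed

lemma list_loop_erasure_simple_exit:
  assumes "exit_walk C u p"
  shows "list_loop_erasure p \<in> simple_exits C u"
proof -
  obtain v where v: "awalk u p v" "v \<notin> C" "\<forall>e\<in>set p. tail G e \<in> C"
    using assms by (auto simp: exit_walk_def)
  from list_loop_erasure_walk[OF v(1)] v(2,3) show ?thesis
    by (auto simp: exit_walk_def simple_exits_def)
qed

end

context infinite_sourced_eulerian_digraph
begin

lemma finite_forests: "finite C \<Longrightarrow> C \<subseteq> verts G \<Longrightarrow> finite (forests C)"
proof -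
  assume "finite C" "C \<subseteq> verts G"
  then have "finite (PiE C (out_arcs G))" using finite_out by (intro finite_PiE) blast+
  then show ?thesis by (rule finite_subset[rotated]) (auto simp: forests_def)
qed

lemma finite_simple_exits:
  assumes "finite C" "C \<subseteq> verts G"
  shows "finite (simple_exits C u)"
proof (rule finite_subset)
  show "simple_exits C u \<subseteq> {p. set p \<subseteq> (\<Union>v\<in>C. out_arcs G v) \<and> distinct p}"
    by (fastforce simp: simple_exits_def exit_walk_def distinct_map awalk_def)
  show "finite {p. set p \<subseteq> (\<Union>v\<in>C. out_arcs G v) \<and> distinct p}"
    using assms finite_out by (intro finite_subset_distinct) auto
qed

text \<open>
  Each forest contains exactly one path from \<open>u\<close> out of \<open>C\<close>.
\<close>

lemma card_forests_partition:
  assumes C: "finite C" "C \<subseteq> verts G" and u: "u \<in> verts G"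
  shows "card (forests C) = (\<Sum>g\<in>simple_exits C u. card (forests (C - tail G ` set g)))"
proof -
  let ?F = "\<lambda>g. {f \<in> forests C. \<forall>e\<in>set g. f (tail G e) = e}"
  have "forests C = (\<Union>g\<in>simple_exits C u. ?F g)"
  proof (intro equalityI subsetI)
    fix f assume f: "f \<in> forests C"
    have "escapes f C u"
      using f by (cases "u \<in> C") (auto simp: forests_def intro: escapes.outside)
    from escapes_exit_path[OF this _ u] f show "f \<in> (\<Union>g\<in>simple_exits C u. ?F g)"
      by (auto simp: forests_def)
  qed auto
  then have "card (forests C) = card (\<Union>g\<in>simple_exits C u. ?F g)" by simp
  also have "\<dots> = (\<Sum>g\<in>simple_exits C u. card (?F g))"
  proof (rule card_UN_disjoint)
    show "\<forall>g\<in>simple_exits C u. \<forall>h\<in>simple_exits C u. g \<noteq> h \<longrightarrow> ?F g \<inter> ?F h = {}"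
      using exit_path_unique by (fastforce simp: simple_exits_def)
  qed (use finite_simple_exits[OF C] finite_forests[OF C] in auto)
  also have "\<dots> = (\<Sum>g\<in>simple_exits C u. card (forests (C - tail G ` set g)))"
    using bij_betw_same_card[OF bij_betw_forests_along_path] by (intro sum.cong) auto
  finally show ?thesis .
qed

text \<open>
  The probability that the random walk from \<open>u\<close>, stopped on leaving \<open>C\<close>, has loop-erasure \<open>g\<close>. Infinitely
  many walks have the same erasure, hence the integral over a counting measure.
\<close>

definition erasure_mass :: "'v set \<Rightarrow> 'v \<Rightarrow> 'e list \<Rightarrow> ennreal" where
  "erasure_mass C u g = (\<integral>\<^sup>+p. walk_weight p \<partial>count_space {p. exit_walk C u p \<and> list_loop_erasure p = g})"

text \<open>
  A walk with erasure \<open>e # g\<close> splits uniquely at its last exit from \<open>u\<close>: an arbitrary closed walk at \<open>u\<close>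
  inside \<open>C\<close>, then \<open>e\<close>, then a walk that avoids \<open>u\<close> and has erasure \<open>g\<close>.
\<close>

lemma erasure_mass_Cons:
  assumes g: "e # g \<in> simple_exits C u"
  shows "erasure_mass C u (e # g) =
    (\<integral>\<^sup>+l. walk_weight l \<partial>count_space {l. awalk u l u \<and> tail G ` set l \<subseteq> C}) *
    ennreal (1 / real (out_degree G u)) * erasure_mass (C - {u}) (head G e) g"
proof -
  have e: "u \<in> C" "e \<in> out_arcs G u" "exit_walk C (head G e) g" "distinct (map (tail G) g)" "u \<notin> tail G ` set g"
    using g by (auto simp: simple_exits_def)
  let ?L = "{l. awalk u l u \<and> tail G ` set l \<subseteq> C}"
  let ?R = "{r. exit_walk (C - {u}) (head G e) r \<and> list_loop_erasure r = g}"
  let ?P = "{p. exit_walk C u p \<and> list_loop_erasure p = e # g}"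
  have "bij_betw (\<lambda>z. fst z @ e # snd z) (?L \<times> ?R) ?P"
  proof (rule bij_betwI')
    have nu: "\<forall>a\<in>set r. tail G a \<noteq> tail G e" if "r \<in> ?R" for r
      using that e(2) by (auto simp: exit_walk_def)
    fix z z' assume z: "z \<in> ?L \<times> ?R" "z' \<in> ?L \<times> ?R"
    show "(fst z @ e # snd z = fst z' @ e # snd z') = (z = z')"
    proof
      assume eq: "fst z @ e # snd z = fst z' @ e # snd z'"
      have ne: "e \<notin> set (snd z)" "e \<notin> set (snd z')" using z nu[of "snd z"] nu[of "snd z'"] by auto
      have tw: "takeWhile (\<lambda>a. a \<noteq> e) (rev (l @ e # r)) = rev r" if "e \<notin> set r" for l r
        using that by (simp add: takeWhile_append)
      have "rev (snd z) = rev (snd z')"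
        using tw[OF ne(1), of "fst z"] tw[OF ne(2), of "fst z'"] unfolding eq by simp
      then show "z = z'" using eq by (simp add: prod_eq_iff)
    qed simp
  next
    fix z assume z: "z \<in> ?L \<times> ?R"
    obtain l r where lr: "z = (l, r)" by (cases z)
    have l: "awalk u l u" "tail G ` set l \<subseteq> C" and r: "exit_walk (C - {u}) (head G e) r" "list_loop_erasure r = g"
      using z lr by auto
    obtain w where w: "awalk (head G e) r w" using r(1) by (auto simp: exit_walk_def)
    obtain w' where w': "awalk (head G e) g w'" "w' \<notin> C" using e(3) by (auto simp: exit_walk_def)
    have "awalk (head G e) g w" using list_loop_erasure_walk[OF w] r(2) by simp
    then have "w = w'" using w'(1) awalk_ends[of "head G e" g w "head G e" w'] by auto
    then have "exit_walk C u (l @ e # r)"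
      using l r w w' e by (auto simp: exit_walk_def awalk_simps intro!: exI[of _ w])
    moreover have "tail G (hd (l @ [e])) = tail G e" using l e by (cases l) (auto simp: awalk_simps)
    moreover have "\<forall>a\<in>set r. tail G a \<noteq> tail G e" using r(1) e(2) by (auto simp: exit_walk_def)
    ultimately show "fst z @ e # snd z \<in> ?P"
      using list_loop_erasure_last_exit[of l e r] lr r(2) by simp
  next
    fix p assume p: "p \<in> ?P"
    then have "p \<noteq> []" by auto
    then obtain l a r where d: "p = l @ a # r" "tail G (hd p) = tail G a"
      "\<forall>b\<in>set r. tail G b \<noteq> tail G a" by (rule last_exit_decomposition)
    have "list_loop_erasure p = a # list_loop_erasure r"
      unfolding d(1) using d by (intro list_loop_erasure_last_exit) (auto simp: hd_append)
    then have ae: "a = e" "list_loop_erasure r = g" using p by auto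
    obtain w where w: "awalk u p w" "w \<notin> C" "\<forall>b\<in>set p. tail G b \<in> C"
      using p by (auto simp: exit_walk_def)
    have ta: "tail G a = u" using ae e by simp
    have "awalk u l u" "awalk (head G e) r w" using w(1) d(1) ae ta by (auto simp: awalk_simps)
    then have "(l, r) \<in> ?L \<times> ?R" using w d ae ta by (auto simp: exit_walk_def)
    then show "\<exists>z\<in>?L \<times> ?R. p = fst z @ e # snd z"
      using d ae by (intro bexI[of _ "(l, r)"]) auto
  qed
  then have "erasure_mass C u (e # g) =
      (\<integral>\<^sup>+z. walk_weight (fst z @ e # snd z) \<partial>count_space (?L \<times> ?R))"
    unfolding erasure_mass_def by (rule nn_integral_bij_count_space[symmetric])
  also have "\<dots> = (\<integral>\<^sup>+z. ennreal (1 / real (out_degree G u)) *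
      (ennreal (walk_weight (fst z)) * ennreal (walk_weight (snd z))) \<partial>count_space (?L \<times> ?R))"
    using e(2) by (intro nn_integral_cong) (auto simp: ennreal_mult'' mult_ac divide_inverse)
  also have "\<dots> = ennreal (1 / real (out_degree G u)) *
      (\<integral>\<^sup>+z. ennreal (walk_weight (fst z)) * ennreal (walk_weight (snd z)) \<partial>count_space (?L \<times> ?R))"
    by (rule nn_integral_cmult) simp
  also have "\<dots> = ennreal (1 / real (out_degree G u)) *
      ((\<integral>\<^sup>+l. walk_weight l \<partial>count_space ?L) * erasure_mass (C - {u}) (head G e) g)"
    unfolding erasure_mass_def by (subst nn_integral_count_space_times) (rule refl)
  finally show ?thesis by (simp add: mult_ac)
qed

text \<open>
  Induction on the size of \<open>C\<close>. The decomposition at the last exit from \<open>u\<close> and the induction hypothesis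
  show that the mass of \<open>g\<close> is \<open>card (forests (C - tail G ` set g))\<close> times a factor that does not depend
  on \<open>g\<close>. The masses add up to one, and the numbers of forests add up to \<open>card (forests C)\<close> by
  \<open>card_forests_partition\<close>, which determines the factor.
\<close>

proposition erasure_mass_forests:
  assumes fin: "finite C" "C \<subseteq> verts G"
    and exits: "\<And>C u. finite C \<Longrightarrow> C \<subseteq> verts G \<Longrightarrow> u \<in> verts G \<Longrightarrow>
       (\<integral>\<^sup>+p. walk_weight p \<partial>count_space {p. exit_walk C u p}) = 1"
    and ne: "\<And>C. finite C \<Longrightarrow> C \<subseteq> verts G \<Longrightarrow> forests C \<noteq> {}"
    and g: "g \<in> simple_exits C u"
  shows "erasure_mass C u g = ennreal (card (forests (C - tail G ` set g)) / card (forests C))"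
  using fin g
proof (induction "card C" arbitrary: C u g rule: less_induct)
  case less
  have N: "card (forests D) > 0" if "D \<subseteq> C" for D
    using finite_forests[of D] ne[of D] that less.prems
    by (meson card_gt_0_iff finite_subset subset_trans)
  have u: "u \<in> verts G" using less.prems by (auto simp: simple_exits_def dest: exit_walk_in_verts)
  show ?case
  proof (cases "u \<in> C")
    case False
    then have g: "g = []" using less.prems by (cases g) (auto simp: simple_exits_def)
    have "{p. exit_walk C u p \<and> list_loop_erasure p = []} = {[]}"
      using False u by (auto, metis exit_walk_Cons neq_Nil_conv)
    then show ?thesis using g N[of C] by (simp add: erasure_mass_def nn_integral_count_space_finite)
  next
    case True
    \<comment> \<open>The factor common to all paths; its last part comes from the induction
      hypothesis.\<close>
    define K where "K = (\<integral>\<^sup>+l. walk_weight l \<partial>count_space {l. awalk u l u \<and> tail G ` set l \<subseteq> C}) *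
       ennreal (1 / real (out_degree G u)) * ennreal (1 / card (forests (C - {u})))"
    have lt: "card (C - {u}) < card C" using less.prems True by (intro psubset_card_mono) auto
    have K: "erasure_mass C u h = K * ennreal (card (forests (C - tail G ` set h)))"
      if h: "h \<in> simple_exits C u" for h
    proof -
      obtain e h' where h': "h = e # h'" using h True by (cases h) (auto simp: simple_exits_def)
      have e: "e \<in> out_arcs G u" and ex: "exit_walk C (head G e) h'" and
        dh: "distinct (map (tail G) h')" "u \<notin> tail G ` set h'"
        using h unfolding h' by (auto simp: simple_exits_def)
      have "h' \<in> simple_exits (C - {u}) (head G e)"
        using ex dh by (auto simp: simple_exits_def exit_walk_def)
      then have "erasure_mass (C - {u}) (head G e) h' =
         ennreal (card (forests (C - {u} - tail G ` set h')) / card (forests (C - {u})))"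
        using less.prems by (intro less.hyps lt) auto
      moreover have "C - {u} - tail G ` set h' = C - tail G ` set h" using h' e by auto
      ultimately show ?thesis
        using erasure_mass_Cons[of e h' C u] h h' K_def
        by (simp add: mult.assoc ennreal_mult'[symmetric])
    qed
    have "1 = (\<integral>\<^sup>+p. walk_weight p \<partial>count_space {p. exit_walk C u p})"
      using exits[of C u] less.prems u by simp
    also have "\<dots> = (\<integral>\<^sup>+p. ennreal (walk_weight p) * indicator {p. exit_walk C u p} p \<partial>count_space UNIV)"
      by (simp add: nn_integral_count_space_indicator)
    also have "\<dots> = (\<integral>\<^sup>+p. (\<Sum>h\<in>simple_exits C u. ennreal (walk_weight p) *
          indicator {p. exit_walk C u p \<and> list_loop_erasure p = h} p) \<partial>count_space UNIV)"
    proof (intro nn_integral_cong)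
      fix p
      show "ennreal (walk_weight p) * indicator {p. exit_walk C u p} p =
         (\<Sum>h\<in>simple_exits C u. ennreal (walk_weight p) *
          indicator {p. exit_walk C u p \<and> list_loop_erasure p = h} p)"
      proof (cases "exit_walk C u p")
        case True
        then have "(\<Sum>h\<in>simple_exits C u. ennreal (walk_weight p) *
            indicator {p. exit_walk C u p \<and> list_loop_erasure p = h} p) =
           (\<Sum>h\<in>simple_exits C u. if h = list_loop_erasure p then ennreal (walk_weight p) else 0)"
          by (intro sum.cong) (auto simp: indicator_def)
        then show ?thesis
          using True finite_simple_exits[of C u] list_loop_erasure_simple_exit[OF True] less.prems
          by (simp del: sum_constant)
      qed simp
    qed
    also have "\<dots> = (\<Sum>h\<in>simple_exits C u. erasure_mass C u h)"
      by (subst nn_integral_sum) (auto simp: erasure_mass_def nn_integral_count_space_indicator)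
    also have "\<dots> = K * ennreal (card (forests C))"
      using card_forests_partition[of C u] less.prems u
      by (simp add: K sum_distrib_left[symmetric])
    finally have K1: "K * ennreal (card (forests C)) = 1" by simp
    have "K \<noteq> \<top>" using K1 N[of C] by (auto simp: ennreal_top_mult)
    then obtain k where k: "K = ennreal k" "k \<ge> 0" by (cases K) auto
    have "k * card (forests C) = 1" using K1 k by (simp add: ennreal_mult'[symmetric])
    then have "k = 1 / card (forests C)" using N[of C] by (simp add: field_simps)
    then show ?thesis using K[OF less.prems(3)] k by (simp add: ennreal_mult'[symmetric])
  qed
qed

end

section \<open>Eulerian rays and their stacks\<close>

context pre_digraph
begin

definition path_prefix :: "nat \<Rightarrow> ('a, 'b) dpath \<Rightarrow> 'b list" where
  "path_prefix n \<gamma> = map (\<lambda>i. the (snd \<gamma> i)) [0..<n]"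

lemma length_path_prefix [simp]: "length (path_prefix n \<gamma>) = n"
  by (simp add: path_prefix_def)

lemma path_prefix_Suc: "path_prefix (Suc n) \<gamma> = path_prefix n \<gamma> @ [the (snd \<gamma> n)]"
  by (simp add: path_prefix_def)

lemma nth_path_prefix [simp]: "i < n \<Longrightarrow> path_prefix n \<gamma> ! i = the (snd \<gamma> i)"
  by (simp add: path_prefix_def)

lemma path_prefix_append: "n \<le> m \<Longrightarrow> path_prefix m \<gamma> = path_prefix n \<gamma> @ map (\<lambda>i. the (snd \<gamma> i)) [n..<m]"
  unfolding path_prefix_def by (metis le_add_diff_inverse map_append upt_add_eq_append zero_le)

lemma starts_with_iff:
  "starts_with p \<gamma> \<longleftrightarrow> (\<forall>i<length p. snd \<gamma> i \<noteq> None) \<and> path_prefix (length p) \<gamma> = p"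
  by (auto simp: starts_with_def list_eq_iff_nth_eq) (metis option.sel)

lemma starts_with_same_length:
  "starts_with p \<gamma> \<Longrightarrow> starts_with q \<gamma> \<Longrightarrow> length p = length q \<Longrightarrow> p = q"
  by (auto simp: starts_with_def list_eq_iff_nth_eq)

lemma starts_with_append1:
  "starts_with (p @ [e]) \<gamma> \<longleftrightarrow> starts_with p \<gamma> \<and> snd \<gamma> (length p) = Some e"
  by (auto simp: starts_with_def nth_append less_Suc_eq)

lemma cas_snoc: "cas u (p @ [e]) v \<longleftrightarrow> cas u p (tail G e) \<and> head G e = v"
  by (induction p arbitrary: u) auto

lemma cas_end_unique: "cas u p v \<Longrightarrow> cas u p w \<Longrightarrow> v = w"
  by (induction p arbitrary: u) auto

lemma path_arc:
  assumes "\<gamma> \<in> paths G" "snd \<gamma> i = Some e"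
  shows "e \<in> arcs G" "path_vertex G \<gamma> i = Some (tail G e)"
  using assms by (auto simp: paths_def)

lemma path_prefix_walk:
  assumes "\<gamma> \<in> paths G" "\<forall>i<n. snd \<gamma> i \<noteq> None"
  shows "path_vertex G \<gamma> n \<noteq> None \<and> cas (fst \<gamma>) (path_prefix n \<gamma>) (the (path_vertex G \<gamma> n)) \<and>
         set (path_prefix n \<gamma>) \<subseteq> arcs G"
  using assms(2)
proof (induction n)
  case (Suc n)
  then obtain e where e: "snd \<gamma> n = Some e" by auto
  from Suc have "cas (fst \<gamma>) (path_prefix n \<gamma>) (the (path_vertex G \<gamma> n))"
    "set (path_prefix n \<gamma>) \<subseteq> arcs G" by auto
  with e path_arc[OF assms(1) e] show ?case
    by (auto simp: path_prefix_Suc cas_snoc simp del: cas_append_iff)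
qed (simp add: path_prefix_def)

lemma starts_with_vertex:
  assumes "\<gamma> \<in> paths G" "starts_with p \<gamma>" "cas (fst \<gamma>) p x"
  shows "path_vertex G \<gamma> (length p) = Some x"
proof -
  have "path_vertex G \<gamma> (length p) \<noteq> None" "cas (fst \<gamma>) p (the (path_vertex G \<gamma> (length p)))"
    using path_prefix_walk[OF assms(1), of "length p"] assms(2) unfolding starts_with_iff by auto
  with cas_end_unique[OF assms(3) this(2)] show ?thesis by auto
qed

end

context wf_digraph
begin

lemma starts_with_awalk:
  assumes "\<gamma> \<in> paths G" "starts_with p \<gamma>"
  shows "awalk (fst \<gamma>) p (the (path_vertex G \<gamma> (length p)))"
  using path_prefix_walk[OF assms(1), of "length p"] assms unfolding starts_with_iff
  by (auto simp: awalk_def paths_def)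

text \<open>
  The two facts need a joint induction: which arc comes after \<open>p\<close> can be read off the state that \<open>p\<close>
  leads to.
\<close>

lemma stack_state_follow:
  assumes a: "a \<in> verts G" and S: "\<And>v. v \<in> verts G \<Longrightarrow> set (S v) \<subseteq> out_arcs G v"
  shows "starts_with p (maximal_path G a S) \<longleftrightarrow> (\<exists>b. awalk a p b) \<and> (\<forall>v. prefix (exit_list p v) (S v))"
    and "awalk a p b \<Longrightarrow> \<forall>v. prefix (exit_list p v) (S v) \<Longrightarrow>
         stack_state G a S (length p) = (b, \<lambda>v. drop (length (exit_list p v)) (S v))"
proof (induction p arbitrary: b rule: rev_induct)
  case Nil
  {
    case 1 show ?case using a by (auto simp: starts_with_def awalk_simps)
  next
    case 2 then show ?case by (simp add: awalk_simps)
  }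
next
  case (snoc e p)
  have key: "starts_with (p @ [e]) (maximal_path G a S) \<longleftrightarrow>
      (\<exists>b. awalk a (p @ [e]) b) \<and> (\<forall>v. prefix (exit_list (p @ [e]) v) (S v))"
    (is "?L \<longleftrightarrow> ?R")
  proof (cases "\<exists>c. awalk a p c \<and> (\<forall>v. prefix (exit_list p v) (S v))")
    case False
    then have "\<not> starts_with p (maximal_path G a S)" using snoc(1) by simp
    moreover have "\<not> ?R" using False prefix_order.trans[OF prefixI[OF refl]]
      by (auto simp: prefix_def)
    ultimately show ?thesis by (simp add: starts_with_append1)
  next
    case True
    then obtain c where c: "awalk a p c" and pre: "\<forall>v. prefix (exit_list p v) (S v)" by blast
    have cv: "c \<in> verts G" using c by blast
    have st: "stack_state G a S (length p) = (c, \<lambda>v. drop (length (exit_list p v)) (S v))"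
      by (rule snoc(2)[OF c pre])
    have "starts_with p (maximal_path G a S)" using snoc(1) c pre by blast
    then have "?L \<longleftrightarrow> snd (maximal_path G a S) (length p) = Some e"
      by (simp add: starts_with_append1)
    also have "\<dots> \<longleftrightarrow> (\<exists>es. drop (length (exit_list p c)) (S c) = e # es)"
      by (auto simp: maximal_path_def st split: list.splits)
    also have "\<dots> \<longleftrightarrow> prefix (exit_list p c @ [e]) (S c)"
    proof -
      obtain r where "S c = exit_list p c @ r" using pre by (auto simp: prefix_def)
      then show ?thesis by (auto simp: prefix_def)
    qed
    also have "\<dots> \<longleftrightarrow> ?R"
    proof
      assume P: "prefix (exit_list p c @ [e]) (S c)"
      then have "e \<in> set (S c)" using set_mono_prefix by fastforce
      then have e: "e \<in> arcs G" "tail G e = c" using S[OF cv] by auto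
      have "awalk a (p @ [e]) (head G e)" using c e by (auto simp: awalk_simps)
      moreover have "prefix (exit_list (p @ [e]) v) (S v)" for v
        using P pre e by (cases "v = c") auto
      ultimately show ?R by blast
    next
      assume R: ?R
      then obtain d where d: "awalk a p d" "tail G e = d" by (auto simp: awalk_simps)
      have "d = c" using awalk_ends[OF c d(1)] by auto
      then show "prefix (exit_list p c @ [e]) (S c)" using R d(2) by (auto dest: spec[of _ c])
    qed
    finally show ?thesis .
  qed
  {
    case 1 show ?case by (rule key)
  next
    case 2
    then have sw: "starts_with (p @ [e]) (maximal_path G a S)" using key by blast
    obtain c where c: "awalk a p c" "e \<in> arcs G" "tail G e = c" "head G e = b"
      using 2 by (auto simp: awalk_simps)
    have pre: "\<forall>v. prefix (exit_list p v) (S v)"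
      using 2(2) by (auto simp: prefix_def)
    have st: "stack_state G a S (length p) = (c, \<lambda>v. drop (length (exit_list p v)) (S v))"
      by (rule snoc(2)[OF c(1) pre])
    have "snd (maximal_path G a S) (length p) = Some e" using sw by (simp add: starts_with_append1)
    then obtain es where es: "drop (length (exit_list p c)) (S c) = e # es"
      by (auto simp: maximal_path_def st split: list.splits)
    then have "drop (Suc (length (exit_list p c))) (S c) = es"
      by (metis drop_Suc list.sel(3) tl_drop)
    then show ?case using c es by (auto simp: st)
  }
qed

end

context infinite_sourced_eulerian_digraph
begin

text \<open>
  By balance, a vertex without arcs going out has none coming in either; but it has a neighbour, since
  the graph is connected and has other vertices.
\<close>

lemma out_arcs_nonempty:
  assumes v: "v \<in> verts G"
  shows "out_arcs G v \<noteq> {}"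
proof -
  have "\<not> verts G \<subseteq> {v}" using infinite_verts finite_subset by blast
  then obtain u where u: "u \<in> verts G" "u \<noteq> v" by blast
  have "v \<rightarrow>\<^sup>*\<^bsub>mk_symmetric G\<^esub> u"
    using connected_graph u v by (auto simp: Digraph_Component.connected_def strongly_connected_def)
  then have "(v, u) \<in> (parcs (mk_symmetric G))\<^sup>*"
    by (auto simp: reachable_def dest: rtrancl_on_rtranclI)
  then obtain w where "(v, w) \<in> parcs (mk_symmetric G)"
    using u(2) by (auto elim: converse_rtranclE)
  then obtain e where e: "e \<in> arcs G" "tail G e = v \<or> head G e = v"
    by (auto simp: parcs_mk_symmetric)
  show ?thesis
  proof (cases "v = source")
    case True
    then have "out_degree G v > 0" using balanced_source by simp
    then show ?thesis by (auto simp: out_degree_def)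
  next
    case False
    show ?thesis
    proof (rule ccontr)
      assume "\<not> out_arcs G v \<noteq> {}"
      then have emp: "out_arcs G v = {}" by simp
      then have "head G e = v" using e by (auto simp: out_arcs_def)
      then have "in_arcs G v \<noteq> {}" using e by (auto simp: in_arcs_def)
      then have "in_degree G v > 0" using finite_in[OF v] by (simp add: in_degree_def card_gt_0_iff)
      then show False using balanced[OF v False] emp by (simp add: out_degree_def)
    qed
  qed
qed

lemma out_degree_pos: "v \<in> verts G \<Longrightarrow> out_degree G v > 0"
  using out_arcs_nonempty finite_out by (simp add: out_degree_def card_gt_0_iff)

definition eulerian_ray :: "('v, 'e) dpath \<Rightarrow> bool" where
  "eulerian_ray X \<longleftrightarrow> X \<in> paths G \<and> infinite_path X \<and> fst X = source \<and>
     (\<forall>e\<in>arcs G. \<exists>!i. snd X i = Some e)"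

text \<open>
  The stack at \<open>v\<close> of the entire ray. Cutting the ray at the first time by which it has crossed every arc
  out of \<open>v\<close> makes this a measurable function of the ray.
\<close>

definition ray_exits :: "('v, 'e) dpath \<Rightarrow> 'v \<Rightarrow> 'e list" where
  "ray_exits X v = exit_list (path_prefix (LEAST n. out_arcs G v \<subseteq> set (path_prefix n X)) X) v"

end

locale digraph_eulerian_ray = infinite_sourced_eulerian_digraph G source
  for G :: "('v, 'e) pre_digraph" and source :: 'v +
  fixes X :: "('v, 'e) dpath"
  assumes ray: "eulerian_ray X"
begin

definition arc_at :: "nat \<Rightarrow> 'e" where "arc_at i = the (snd X i)"

lemma X_path: "X \<in> paths G" and X_source: "fst X = source"
  using ray by (auto simp: eulerian_ray_def)

lemma snd_X: "snd X i = Some (arc_at i)"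
  using ray by (auto simp: arc_at_def eulerian_ray_def infinite_path_def)

lemma arc_at_in: "arc_at i \<in> arcs G"
  using path_arc(1)[OF X_path snd_X] .

lemma vertex_at: "path_vertex G X i = Some (tail G (arc_at i))"
  using path_arc(2)[OF X_path snd_X] .

lemma head_arc_at: "head G (arc_at i) = tail G (arc_at (Suc i))"
  using vertex_at[of "Suc i"] snd_X[of i] by (metis option.map(2) option.inject path_vertex.simps(2))

lemma arc_at_inj: "arc_at i = arc_at j \<Longrightarrow> i = j"
  using ray arc_at_in[of i] snd_X unfolding eulerian_ray_def by metis

lemma arc_at_surj: "e \<in> arcs G \<Longrightarrow> \<exists>i. arc_at i = e"
proof -
  assume "e \<in> arcs G"
  then obtain i where "snd X i = Some e" using ray unfolding eulerian_ray_def by blast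
  then show ?thesis by (intro exI[of _ i]) (simp add: arc_at_def)
qed

lemma prefix_walk: "awalk source (path_prefix n X) (tail G (arc_at n))"
  using starts_with_awalk[OF X_path, of "path_prefix n X"] snd_X X_source vertex_at[of n]
  by (simp add: starts_with_iff)

lemma starts_with_prefix: "starts_with (path_prefix n X) X"
  by (simp add: starts_with_iff snd_X)

lemma set_prefix: "set (path_prefix n X) = arc_at ` {..<n}"
  by (auto simp: path_prefix_def atLeast0LessThan snd_X)

lemma distinct_prefix: "distinct (path_prefix n X)"
  by (auto simp: path_prefix_def distinct_map inj_on_def snd_X dest: arc_at_inj)

lemma eventually_covered:
  assumes "finite F" "F \<subseteq> arcs G"
  shows "\<forall>\<^sub>F n in sequentially. F \<subseteq> set (path_prefix n X)"
proof -
  have "\<forall>e\<in>F. \<forall>\<^sub>F n in sequentially. e \<in> set (path_prefix n X)"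
  proof
    fix e assume "e \<in> F"
    then obtain i where "arc_at i = e" using arc_at_surj assms(2) by blast
    then show "\<forall>\<^sub>F n in sequentially. e \<in> set (path_prefix n X)"
      by (auto simp: set_prefix eventually_sequentially intro!: exI[of _ "Suc i"] image_eqI[of _ _ i])
  qed
  then show ?thesis using assms(1) by (simp add: eventually_ball_finite subset_eq)
qed

lemma exit_list_prefix_covered:
  assumes "out_arcs G v \<subseteq> set (path_prefix n X)" "n \<le> m"
  shows "exit_list (path_prefix m X) v = exit_list (path_prefix n X) v"
proof -
  have split: "path_prefix m X = path_prefix n X @ map arc_at [n..<m]"
    using path_prefix_append[OF assms(2), of X] by (simp add: snd_X)
  have "exit_list (map arc_at [n..<m]) v = []"
  proof (rule ccontr)
    assume "exit_list (map arc_at [n..<m]) v \<noteq> []"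
    then have "set (exit_list (map arc_at [n..<m]) v) \<noteq> {}" by simp
    then obtain e where e: "e \<in> set (map arc_at [n..<m])" "tail G e = v"
      by (auto simp: set_exit_list)
    then have "e \<in> arcs G" using arc_at_in by auto
    then have "e \<in> set (path_prefix n X)" using assms(1) e(2) by auto
    then show False using e(1) distinct_prefix[of m] unfolding split by auto
  qed
  then show ?thesis by (simp add: split)
qed

lemma ray_exits_eq:
  assumes "out_arcs G v \<subseteq> set (path_prefix n X)"
  shows "ray_exits X v = exit_list (path_prefix n X) v"
  unfolding ray_exits_def
proof (rule exit_list_prefix_covered[symmetric])
  show "out_arcs G v \<subseteq> set (path_prefix (LEAST n. out_arcs G v \<subseteq> set (path_prefix n X)) X)"
    by (rule LeastI[where P = "\<lambda>n. out_arcs G v \<subseteq> set (path_prefix n X)"]) (rule assms)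
  show "(LEAST n. out_arcs G v \<subseteq> set (path_prefix n X)) \<le> n"
    by (rule Least_le) (rule assms)
qed

lemma eventually_ray_exits:
  assumes "v \<in> verts G"
  shows "\<forall>\<^sub>F n in sequentially. out_arcs G v \<subseteq> set (path_prefix n X)"
  by (rule eventually_covered) (use assms finite_out in auto)

lemma obtain_covering_time:
  assumes "v \<in> verts G"
  obtains n where "n \<ge> k" "out_arcs G v \<subseteq> set (path_prefix n X)"
  using eventually_conj[OF eventually_ray_exits[OF assms] eventually_ge_at_top[of k]]
  by (metis (mono_tags, lifting) eventually_sequentially order_refl)

lemma ray_exits_permutation:
  assumes v: "v \<in> verts G"
  shows "ray_exits X v \<in> permutations_of_set (out_arcs G v)"
proof -
  obtain n where n: "out_arcs G v \<subseteq> set (path_prefix n X)" using obtain_covering_time[OF v] by metis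
  have "set (path_prefix n X) \<subseteq> arcs G" using prefix_walk[of n] by blast
  then show ?thesis
    unfolding ray_exits_eq[OF n] using n distinct_prefix
    by (auto simp: permutations_of_set_def set_exit_list distinct_exit_list)
qed

lemma prefix_ray_exits: "prefix (exit_list (path_prefix n X) v) (ray_exits X v)"
proof (cases "v \<in> verts G")
  case True
  obtain m where m: "m \<ge> n" "out_arcs G v \<subseteq> set (path_prefix m X)"
    using obtain_covering_time[OF True] by metis
  show ?thesis unfolding ray_exits_eq[OF m(2)] using path_prefix_append[OF m(1), of X] by simp
next
  case False
  have "set (path_prefix n X) \<subseteq> arcs G" using prefix_walk[of n] by blast
  with False have "exit_list (path_prefix n X) v = []"
    by (auto simp: exit_list_def filter_empty_conv)
  then show ?thesis by simp
qed

lemma maximal_path_ray_exits: "maximal_path G source (ray_exits X) = X"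
proof (rule prod_eqI)
  show "fst (maximal_path G source (ray_exits X)) = fst X" by (simp add: maximal_path_def X_source)
  show "snd (maximal_path G source (ray_exits X)) = snd X"
  proof
    fix n
    have "starts_with (path_prefix (Suc n) X) (maximal_path G source (ray_exits X))"
      using prefix_walk prefix_ray_exits ray_exits_permutation
      by (subst stack_state_follow(1)) (auto simp: source_in_verts permutations_of_set_def)
    then show "snd (maximal_path G source (ray_exits X)) n = snd X n"
      by (auto simp: starts_with_def snd_X dest!: spec[of _ n])
  qed
qed

lemma last_exit:
  assumes v: "v \<in> verts G"
  shows "\<exists>i. arc_at i = last (ray_exits X v) \<and> tail G (arc_at i) = v \<and> (\<forall>j>i. tail G (arc_at j) \<noteq> v)"
proof -
  obtain n where n: "out_arcs G v \<subseteq> set (path_prefix n X)" using obtain_covering_time[OF v] by metis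
  define I where "I = {i. tail G (arc_at i) = v}"
  have sub: "I \<subseteq> {..<n}"
  proof
    fix i assume "i \<in> I"
    then have "arc_at i \<in> out_arcs G v" using arc_at_in by (auto simp: I_def)
    then obtain j where "j < n" "arc_at i = arc_at j" using n by (auto simp: set_prefix)
    then show "i \<in> {..<n}" using arc_at_inj by auto
  qed
  obtain e where "e \<in> out_arcs G v" using out_arcs_nonempty[OF v] by blast
  then have "I \<noteq> {}" using arc_at_surj[of e] by (auto simp: I_def)
  define i where "i = Max I"
  have fin: "finite I" using sub finite_subset by blast
  have i: "i \<in> I" and imax: "\<And>j. j \<in> I \<Longrightarrow> j \<le> i"
    using Max_in[OF fin \<open>I \<noteq> {}\<close>] fin by (auto simp: i_def)
  have ti: "tail G (arc_at i) = v" using i by (simp add: I_def)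
  have after: "\<forall>j>i. tail G (arc_at j) \<noteq> v" using imax by (force simp: I_def)
  have "path_prefix n X = path_prefix i X @ arc_at i # map arc_at [Suc i..<n]"
    using path_prefix_append[of i n X] sub i by (auto simp: upt_conv_Cons snd_X)
  moreover have "exit_list (map arc_at [Suc i..<n]) v = []"
    using after by (auto simp: exit_list_def filter_empty_conv)
  ultimately have "last (ray_exits X v) = arc_at i"
    using ti by (simp add: ray_exits_eq[OF n])
  then show ?thesis using ti after by metis
qed

definition last_exit_time :: "'v \<Rightarrow> nat" where
  "last_exit_time v = (SOME i. arc_at i = last (ray_exits X v) \<and> tail G (arc_at i) = v \<and>
     (\<forall>j>i. tail G (arc_at j) \<noteq> v))"

lemma last_exit_time:
  assumes "v \<in> verts G"
  shows "arc_at (last_exit_time v) = last (ray_exits X v)" "tail G (arc_at (last_exit_time v)) = v"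
    "\<And>j. j > last_exit_time v \<Longrightarrow> tail G (arc_at j) \<noteq> v"
  using someI_ex[OF last_exit[OF assms]] unfolding last_exit_time_def by blast+

text \<open>
  Right after its last exit from \<open>v\<close> the ray is at the head of the arc of this exit, and it must leave
  that vertex again.
\<close>

lemma last_exit_time_increases:
  assumes "v \<in> verts G"
  shows "last_exit_time v < last_exit_time (head G (last (ray_exits X v)))"
proof (rule ccontr)
  assume neg: "\<not> ?thesis"
  let ?w = "head G (last (ray_exits X v))"
  have w: "?w \<in> verts G" and "?w = tail G (arc_at (Suc (last_exit_time v)))"
    using last_exit_time(1)[OF assms] head_arc_at arc_at_in head_in_verts by metis+
  with last_exit_time(3)[OF w, of "Suc (last_exit_time v)"] neg show False by simp
qed

text \<open>
  Along the last exits the last exit times increase, and on the finite set \<open>B\<close> they are bounded.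
\<close>

lemma ray_exits_escape:
  assumes B: "finite B" and v: "v \<in> verts G"
  shows "escapes (\<lambda>v. last (ray_exits X v)) B v"
proof -
  obtain K where K: "\<And>v. v \<in> B \<Longrightarrow> last_exit_time v < K"
    using finite_nat_set_iff_bounded[of "last_exit_time ` B"] B by auto
  show ?thesis using v
  proof (induction "K - last_exit_time v" arbitrary: v rule: less_induct)
    case less
    show ?case
    proof (cases "v \<in> B")
      case True
      let ?w = "head G (last (ray_exits X v))"
      have "K - last_exit_time ?w < K - last_exit_time v"
        using K[OF True] last_exit_time_increases[OF less.prems] by simp
      moreover have "?w \<in> verts G"
        using last_exit_time(1)[OF less.prems] arc_at_in head_in_verts by metis
      ultimately show ?thesis using less.hyps by (intro escapes.step[OF True]) auto
    qed (rule escapes.outside)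
  qed
qed

lemma finite_last_exit_before: "finite {v \<in> verts G. last_exit_time v < n}"
proof (rule finite_subset)
  show "{v \<in> verts G. last_exit_time v < n} \<subseteq> (\<lambda>i. tail G (arc_at i)) ` {..<n}"
    using last_exit_time(2) by force
qed simp

lemma forest_ray_exits:
  assumes "finite C" "C \<subseteq> verts G"
  shows "restrict (\<lambda>v. last (ray_exits X v)) C \<in> forests C"
proof -
  let ?f = "\<lambda>v. last (ray_exits X v)"
  have "escapes (restrict ?f C) C v \<longleftrightarrow> escapes ?f C v" for v by (rule escapes_cong) simp
  moreover have "?f v \<in> out_arcs G v" if "v \<in> verts G" for v
    using last_exit_time(1,2)[OF that] arc_at_in by (metis in_out_arcs_conv)
  ultimately show ?thesis
    using ray_exits_escape[OF assms(1)] assms(2) by (auto simp: forests_def)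
qed

lemma source_reaches:
  assumes "v \<in> verts G"
  shows "\<exists>p. awalk source p v"
  using prefix_walk[of "last_exit_time v"] last_exit_time(2)[OF assms] by auto

lemma arcs_last_exit_arboretum:
  "arcs (last_exit_arboretum G X) = (\<lambda>v. last (ray_exits X v)) ` verts G"
proof (intro equalityI subsetI)
  fix e assume "e \<in> arcs (last_exit_arboretum G X)"
  then obtain i where i: "arc_at i = e" "\<And>j. j > i \<Longrightarrow> tail G (arc_at j) \<noteq> tail G e"
    by (auto simp: last_exit_arboretum_def vertex_at snd_X)
  have v: "tail G e \<in> verts G" using i(1) arc_at_in by auto
  have "\<not> last_exit_time (tail G e) > i" using i(2) last_exit_time(2)[OF v] by blast
  moreover have "\<not> last_exit_time (tail G e) < i" using last_exit_time(3)[OF v, of i] i(1) by auto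
  ultimately have "last_exit_time (tail G e) = i" by simp
  then show "e \<in> (\<lambda>v. last (ray_exits X v)) ` verts G"
    using last_exit_time(1)[OF v] i(1) v by auto
next
  fix e assume "e \<in> (\<lambda>v. last (ray_exits X v)) ` verts G"
  then obtain v where v: "v \<in> verts G" "e = last (ray_exits X v)" by blast
  show "e \<in> arcs (last_exit_arboretum G X)"
    using last_exit_time[OF v(1)] v(2)
    by (auto simp: last_exit_arboretum_def vertex_at snd_X intro!: exI[of _ "last_exit_time v"])
qed

lemma verts_last_exit_arboretum: "verts (last_exit_arboretum G X) = verts G"
  using last_exit_time(2) arc_at_in
  by (auto simp: last_exit_arboretum_def vertex_at)

end

lemma (in infinite_sourced_eulerian_digraph) forests_nonempty:
  assumes "\<exists>X. eulerian_ray X" "finite C" "C \<subseteq> verts G"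
  shows "forests C \<noteq> {}"
proof -
  obtain X where "eulerian_ray X" using assms(1) by blast
  then interpret digraph_eulerian_ray G source X by unfold_locales
  show ?thesis using forest_ray_exits[OF assms(2,3)] by blast
qed

section \<open>Exchangeability of the initial segments\<close>

text \<open>
  Bounded convergence for indicator functions, in the form in which both passages to the limit below use it.
\<close>

lemma (in prob_space) measure_tendsto_of_eventually_iff:
  assumes A: "\<And>n. A n \<in> events" and B: "B \<in> events"
    and ev: "AE x in M. \<forall>\<^sub>F n in sequentially. x \<in> A n \<longleftrightarrow> x \<in> B"
  shows "(\<lambda>n. prob (A n)) \<longlonglongrightarrow> prob B"
proof -
  have "(\<lambda>n. \<integral>x. indicator (A n) x \<partial>M) \<longlonglongrightarrow> (\<integral>x. indicator B x \<partial>M :: real)"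
  proof (rule integral_dominated_convergence[where w = "\<lambda>_. 1"])
    show "AE x in M. (\<lambda>n. indicator (A n) x :: real) \<longlonglongrightarrow> indicator B x"
      using ev
    proof eventually_elim
      case (elim x)
      then show ?case by (intro tendsto_eventually) (auto elim!: eventually_mono simp: indicator_def)
    qed
  qed (use A B in \<open>auto simp: indicator_def\<close>)
  then show ?thesis using A B by (simp add: sets.sets_into_space[THEN Int_absorb2])
qed

lemma measurable_count_space_fibres:
  fixes f :: "'a \<Rightarrow> 'b"
  assumes "countable C" "\<And>x. x \<in> space M \<Longrightarrow> f x \<in> C"
    and "\<And>a. a \<in> C \<Longrightarrow> {x \<in> space M. f x = a} \<in> sets M"
  shows "f \<in> measurable M (count_space UNIV)"
proof (rule measurableI)
  fix A
  have "f -` A \<inter> space M = (\<Union>a\<in>C \<inter> A. {x \<in> space M. f x = a})" using assms(2) by auto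
  also have "\<dots> \<in> sets M" using assms(1,3) by (intro sets.countable_UN') auto
  finally show "f -` A \<inter> space M \<in> sets M" .
qed simp

lemma measurable_count_space_restrict:
  assumes "g \<in> measurable M (count_space UNIV)" "\<And>x. x \<in> space M \<Longrightarrow> g x \<in> A"
  shows "g \<in> measurable M (count_space A)"
proof (rule measurableI)
  fix S assume "S \<in> sets (count_space A)"
  show "g -` S \<inter> space M \<in> sets M" by (rule measurable_sets[OF assms(1)]) simp
qed (use assms(2) in simp)

lemma pred_ball_countable:
  assumes "countable I" "\<And>i. i \<in> I \<Longrightarrow> Measurable.pred M (P i)"
  shows "Measurable.pred M (\<lambda>x. \<forall>i\<in>I. P i x)" "Measurable.pred M (\<lambda>x. \<exists>i\<in>I. P i x)"
  using assms unfolding pred_def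
  by (auto intro!: sets.sets_Collect_countable_Ball sets.sets_Collect_countable_Bex)

context pre_digraph
begin

lemma cas_cong:
  "tail H = tail G \<Longrightarrow> head H = head G \<Longrightarrow> pre_digraph.cas H u p v = cas u p v"
proof (induction p arbitrary: u)
  case Nil then show ?case by (simp add: pre_digraph.cas.simps)
next
  case (Cons e p) then show ?case by (simp add: pre_digraph.cas.simps)
qed

lemma set_awalk_verts_of_cas:
  "tail H = tail G \<Longrightarrow> head H = head G \<Longrightarrow> cas u p v \<Longrightarrow>
   set (pre_digraph.awalk_verts H u p) = insert u (head G ` set p)"
proof (induction p arbitrary: u)
  case Nil then show ?case by (simp add: pre_digraph.awalk_verts.simps)
next
  case (Cons e p) then show ?case by (auto simp: pre_digraph.awalk_verts.simps)
qed

lemma verts_path_digraph: "verts (path_digraph G Y) = insert (fst Y) (head G ` arcs (path_digraph G Y))"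
proof (intro equalityI subsetI)
  fix v assume "v \<in> verts (path_digraph G Y)"
  then obtain i where "path_vertex G Y i = Some v" by (auto simp: path_digraph_def)
  then show "v \<in> insert (fst Y) (head G ` arcs (path_digraph G Y))"
    by (cases i) (auto simp: path_digraph_def)
next
  fix v assume v: "v \<in> insert (fst Y) (head G ` arcs (path_digraph G Y))"
  show "v \<in> verts (path_digraph G Y)"
  proof (cases "v = fst Y")
    case True then show ?thesis by (auto simp: path_digraph_def intro!: exI[of _ 0])
  next
    case False
    then obtain i e where "snd Y i = Some e" "v = head G e" using v by (auto simp: path_digraph_def)
    then show ?thesis by (auto simp: path_digraph_def intro!: exI[of _ "Suc i"])
  qed
qed

text \<open>
  Makes visible that whether \<open>r\<close> is an Euler trail depends on \<open>r\<close> only through its ends and its set of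
  arcs.
\<close>

lemma euler_trail_path_digraph:
  "pre_digraph.euler_trail (path_digraph G Y) u r c \<longleftrightarrow>
     cas u r c \<and> distinct r \<and> set r = arcs (path_digraph G Y) \<and>
     insert u (head G ` set r) = verts (path_digraph G Y)"
proof -
  have eq: "tail (path_digraph G Y) = tail G" "head (path_digraph G Y) = head G"
    by (auto simp: path_digraph_def)
  show ?thesis
    unfolding pre_digraph.euler_trail_def pre_digraph.trail_def pre_digraph.awalk_def cas_cong[OF eq]
    using set_awalk_verts_of_cas[OF eq, of u r c] by auto
qed

end

context infinite_sourced_eulerian_digraph
begin

lemma space_path_space: "space (path_space G) = paths G"
proof -
  have step: "snd \<gamma> i \<in> insert None (Some ` arcs G)" if "\<gamma> \<in> paths G" for \<gamma> i
    using path_arc(1)[OF that] by (cases "snd \<gamma> i") auto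
  have "paths G \<subseteq> verts G \<times> PiE UNIV (\<lambda>_. insert None (Some ` arcs G))"
  proof
    fix \<gamma> assume g: "\<gamma> \<in> paths G"
    then have "fst \<gamma> \<in> verts G" by (simp add: paths_def)
    moreover have "snd \<gamma> \<in> PiE UNIV (\<lambda>_. insert None (Some ` arcs G))"
      using step[OF g] by (simp add: PiE_UNIV_domain)
    ultimately show "\<gamma> \<in> verts G \<times> PiE UNIV (\<lambda>_. insert None (Some ` arcs G))"
      by (simp add: mem_Times_iff)
  qed
  then show ?thesis
    by (auto simp: path_space_def space_restrict_space space_pair_measure step_space_def space_PiM)
qed

lemma measurable_path_fst: "fst \<in> measurable (path_space G) (count_space (verts G))"
  unfolding path_space_def by (intro measurable_restrict_space1) measurable

lemma measurable_path_snd: "(\<lambda>\<gamma>. snd \<gamma>) \<in> measurable (path_space G) (step_space G)"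
  unfolding path_space_def by (intro measurable_restrict_space1) measurable

lemma measurable_path_step:
  "(\<lambda>\<gamma>. snd \<gamma> i) \<in> measurable (path_space G) (count_space (insert None (Some ` arcs G)))"
  by (rule measurable_compose[OF measurable_path_snd])
     (simp add: step_space_def measurable_component_singleton)

lemma measurable_path_step_UNIV [measurable]:
  "(\<lambda>\<gamma>. snd \<gamma> i) \<in> measurable (path_space G) (count_space UNIV)"
  by (rule measurable_compose[OF measurable_path_step]) simp

lemma measurable_path_fst_UNIV [measurable]:
  "fst \<in> measurable (path_space G) (count_space UNIV)"
  by (rule measurable_compose[OF measurable_path_fst]) simp

lemma measurable_starts_with [measurable]: "Measurable.pred (path_space G) (starts_with p)"
  unfolding starts_with_def[abs_def] by measurable

lemma countable_arc_lists: "countable (lists (arcs G))"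
  using countable_arcs by (rule countable_lists)

lemma measurable_path_prefix [measurable]:
  "path_prefix n \<in> measurable (path_space G) (count_space UNIV)"
proof (rule measurable_count_space_fibres)
  \<comment> \<open>\<open>the None\<close> stands for the steps after the end of a finite path.\<close>
  show "countable (lists (insert (the None) (arcs G)))" using countable_arcs by (intro countable_lists) auto
  fix \<gamma> assume "\<gamma> \<in> space (path_space G)"
  then have arc: "the (snd \<gamma> i) \<in> insert (the None) (arcs G)" for i
    using path_arc(1)[of \<gamma> i] by (cases "snd \<gamma> i") (auto simp: space_path_space)
  have "e \<in> insert (the None) (arcs G)" if "e \<in> set (path_prefix n \<gamma>)" for e
  proof -
    obtain i where "e = the (snd \<gamma> i)" using \<open>e \<in> set (path_prefix n \<gamma>)\<close> by (auto simp: path_prefix_def)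
    then show ?thesis using arc[of i] by simp
  qed
  then show "path_prefix n \<gamma> \<in> lists (insert (the None) (arcs G))" by blast
next
  fix p :: "'e list"
  have eq: "path_prefix n \<gamma> = p \<longleftrightarrow> length p = n \<and> (\<forall>i\<in>{..<n}. the (snd \<gamma> i) = p ! i)" for \<gamma> :: "('v, 'e) dpath"
    by (auto simp: path_prefix_def list_eq_iff_nth_eq)
  have "Measurable.pred (path_space G) (\<lambda>\<gamma>. the (snd \<gamma> i) = p ! i)" for i
    by (rule measurable_compose[OF measurable_path_step_UNIV[of i]]) simp
  then have "Measurable.pred (path_space G) (\<lambda>\<gamma>. path_prefix n \<gamma> = p)"
    unfolding eq by (intro pred_intros_logic pred_ball_countable) auto
  then show "{\<gamma> \<in> space (path_space G). path_prefix n \<gamma> = p} \<in> sets (path_space G)"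
    by (simp add: pred_def)
qed

lemma measurable_ray_exits [measurable]:
  "(\<lambda>X. ray_exits X v) \<in> measurable (path_space G) (count_space UNIV)"
  unfolding ray_exits_def
proof (rule measurable_compose_countable[where g = "\<lambda>X. LEAST n. out_arcs G v \<subseteq> set (path_prefix n X)"])
  show "(\<lambda>X. LEAST n. out_arcs G v \<subseteq> set (path_prefix n X)) \<in> measurable (path_space G) (count_space UNIV)"
  proof (rule measurable_Least)
    fix n
    show "Measurable.pred (path_space G) (\<lambda>X. out_arcs G v \<subseteq> set (path_prefix n X))"
      by (rule measurable_compose[OF measurable_path_prefix]) simp
  qed
  show "(\<lambda>X. exit_list (path_prefix n X) v) \<in> measurable (path_space G) (count_space UNIV)" for n
    by (rule measurable_compose[OF measurable_path_prefix]) simp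
qed

lemma measurable_pathI:
  assumes "\<And>x. x \<in> space M \<Longrightarrow> f x \<in> paths G"
    and "(\<lambda>x. fst (f x)) \<in> measurable M (count_space UNIV)"
    and "\<And>i. (\<lambda>x. snd (f x) i) \<in> measurable M (count_space UNIV)"
  shows "f \<in> measurable M (path_space G)"
proof -
  have fst': "(\<lambda>x. fst (f x)) \<in> measurable M (count_space (verts G))"
  proof (rule measurable_count_space_restrict[OF assms(2)])
    fix x assume "x \<in> space M"
    then show "fst (f x) \<in> verts G" using assms(1)[of x] by (auto simp: paths_def)
  qed
  have snd': "(\<lambda>x. snd (f x) i) \<in> measurable M (count_space (insert None (Some ` arcs G)))" for i
  proof (rule measurable_count_space_restrict[OF assms(3)])
    fix x assume "x \<in> space M"
    then show "snd (f x) i \<in> insert None (Some ` arcs G)"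
      using path_arc(1)[OF assms(1)] by (cases "snd (f x) i") auto
  qed
  have "(\<lambda>x. snd (f x)) \<in> measurable M (step_space G)"
    unfolding step_space_def
  proof (rule measurable_PiM_single')
    show "(\<lambda>x. snd (f x)) \<in> space M \<rightarrow> (\<Pi>\<^sub>E i\<in>UNIV. space (count_space (insert None (Some ` arcs G))))"
      using measurable_space[OF snd'] by (simp add: PiE_UNIV_domain Pi_iff)
  qed (rule snd')
  with fst' have "(\<lambda>x. (fst (f x), snd (f x))) \<in> measurable M (count_space (verts G) \<Otimes>\<^sub>M step_space G)"
    by (rule measurable_Pair)
  then show ?thesis
    unfolding path_space_def using assms(1) by (intro measurable_restrict_space2) auto
qed

end

locale proper_gibbs = infinite_sourced_eulerian_digraph G source + prob_space \<mu>
  for G :: "('v, 'e) pre_digraph" and source :: 'v and \<mu> :: "('v, 'e) dpath measure" +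
  assumes gibbs: "proper_gibbs_measure G source \<mu>"
begin

lemma sets_mu: "sets \<mu> = sets (path_space G)"
  using gibbs by (simp add: proper_gibbs_measure_def)

lemma space_mu: "space \<mu> = paths G"
  using sets_eq_imp_space_eq[OF sets_mu] by (simp add: space_path_space)

lemma measurable_mu: "measurable \<mu> N = measurable (path_space G) N"
  using sets_mu by (rule measurable_cong_sets) simp

lemma AE_eulerian_ray: "AE X in \<mu>. eulerian_ray X"
proof -
  have "AE X in \<mu>. infinite_path X \<and> fst X = source \<and> (\<forall>e\<in>arcs G. \<exists>!i. snd X i = Some e)"
    using gibbs by (simp add: proper_gibbs_measure_def)
  with AE_space show ?thesis
    by eventually_elim (auto simp: eulerian_ray_def space_mu)
qed

lemma eulerian_ray_exists: "\<exists>X. eulerian_ray X"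
proof (rule ccontr)
  assume "\<not> ?thesis"
  then have never: "\<not> eulerian_ray X" for X by blast
  have "AE X in \<mu>. False" using AE_eulerian_ray by (simp add: never)
  then show False by simp
qed

lemma starts_with_event: "{X \<in> space \<mu>. starts_with p X} \<in> events"
  using measurable_starts_with[of p] sets_mu space_mu by (simp add: pred_def space_path_space)

text \<open>
  Finite and nonempty is what makes \<open>pmf_of_set\<close> the uniform law.
\<close>

lemma euler_trails_of_prefix:
  fixes n :: nat
  assumes "eulerian_ray X"
  defines "E \<equiv> {r. pre_digraph.euler_trail (path_digraph G (path_take n X)) source r (the (path_vertex G X n))}"
  shows "finite E" "E \<noteq> {}"
proof -
  interpret digraph_eulerian_ray G source X by unfold_locales (rule assms(1))
  have arcs: "arcs (path_digraph G (path_take n X)) = set (path_prefix n X)"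
    by (auto simp: path_digraph_def path_take_def set_prefix snd_X image_iff)
  have "E \<subseteq> {r. set r \<subseteq> set (path_prefix n X) \<and> distinct r}"
    unfolding E_def euler_trail_path_digraph arcs by auto
  then show "finite E" by (rule finite_subset) (simp add: finite_subset_distinct)
  have "path_prefix n X \<in> E"
    unfolding E_def mem_Collect_eq euler_trail_path_digraph arcs verts_path_digraph
    using prefix_walk[of n] distinct_prefix[of n]
    by (auto simp: vertex_at awalk_def path_take_def X_source)
  then show "E \<noteq> {}" by blast
qed

text \<open>
  The conditional law in the Gibbs property is uniform on a set to which either both or none of \<open>p\<close> and
  \<open>q\<close> belong, so almost surely the two trails have the same conditional probability.
\<close>

lemma prefix_exchangeable:
  assumes p: "awalk source p b" "distinct p" and q: "awalk source q b" "distinct q"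
    and pq: "set p = set q"
  shows "emeasure \<mu> {X \<in> space \<mu>. starts_with p X} = emeasure \<mu> {X \<in> space \<mu>. starts_with q X}"
proof -
  define n where "n = length p"
  have n: "length p = n" "length q = n"
    using distinct_card[OF p(2)] distinct_card[OF q(2)] pq by (simp_all add: n_def)
  define F where "F = vimage_algebra (space \<mu>) (steps_after n) (step_space G)"
  have "steps_after n \<in> measurable \<mu> (step_space G)"
    unfolding measurable_mu step_space_def steps_after_def
  proof (rule measurable_PiM_single')
    show "(\<lambda>\<gamma>. snd \<gamma> (n + i)) \<in> measurable (path_space G) (count_space (insert None (Some ` arcs G)))" for i
      by (rule measurable_path_step)
    show "(\<lambda>\<gamma> i. snd \<gamma> (n + i)) \<in> space (path_space G) \<rightarrow>
        (\<Pi>\<^sub>E i\<in>UNIV. space (count_space (insert None (Some ` arcs G))))"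
      using measurable_space[OF measurable_path_step] by (simp add: PiE_UNIV_domain Pi_iff)
  qed
  then have "sets F \<subseteq> sets \<mu>" by (simp add: F_def sets_image_in_sets)
  then have sub: "subalgebra \<mu> F" by (simp add: subalgebra_def F_def)
  interpret finite_measure_subalgebra \<mu> F
    using sub by (simp add: finite_measure_subalgebra_def finite_measure_subalgebra_axioms_def finite_measure_axioms)
  let ?E = "\<lambda>X. {r. pre_digraph.euler_trail (path_digraph G (path_take n X)) source r (the (path_vertex G X n))}"
  let ?I = "\<lambda>r. indicator {Y \<in> space \<mu>. starts_with r Y} :: _ \<Rightarrow> real"
  have g: "AE X in \<mu>. real_cond_exp \<mu> F (?I r) X = pmf (pmf_of_set (?E X)) r" if "length r = n" for r
    using gibbs that unfolding proper_gibbs_measure_def F_def by blast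
  have "AE X in \<mu>. real_cond_exp \<mu> F (?I p) X = real_cond_exp \<mu> F (?I q) X"
    using g[OF n(1)] g[OF n(2)] AE_eulerian_ray
  proof eventually_elim
    case (elim X)
    have "p \<in> ?E X \<longleftrightarrow> q \<in> ?E X"
      unfolding mem_Collect_eq euler_trail_path_digraph
      using p q pq cas_end_unique unfolding awalk_def by blast
    then show ?case
      using elim euler_trails_of_prefix[OF elim(3), of n] by (simp add: indicator_def)
  qed
  then have "(\<integral>X. real_cond_exp \<mu> F (?I p) X \<partial>\<mu>) = (\<integral>X. real_cond_exp \<mu> F (?I q) X \<partial>\<mu>)"
    by (intro integral_cong_AE) (auto intro: measurable_from_subalg[OF sub])
  moreover have "integrable \<mu> (?I r)" for r
    using starts_with_event by (intro integrable_real_indicator) (auto simp: emeasure_eq_measure)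
  ultimately have "(\<integral>X. ?I p X \<partial>\<mu>) = (\<integral>X. ?I q X \<partial>\<mu>)"
    by (simp add: real_cond_exp_int(2))
  then show ?thesis
    using starts_with_event by (simp add: emeasure_eq_measure sets.sets_into_space[THEN Int_absorb2])
qed

end

section \<open>The stacks under a proper Gibbs measure\<close>

context pre_digraph
begin

text \<open>
  If \<open>T\<close> is the stack configuration of a path, \<open>last (T v)\<close> is its last exit from \<open>v\<close>, and the condition
  is that no last exit from outside \<open>B\<close> leads into \<open>B\<close>.
\<close>

definition descendant_closed :: "('a \<Rightarrow> 'b list) \<Rightarrow> 'a set \<Rightarrow> bool" where
  "descendant_closed T B \<longleftrightarrow> (\<forall>v. v \<notin> B \<longrightarrow> T v \<noteq> [] \<longrightarrow> head G (last (T v)) \<notin> B)"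

definition largest_closed :: "'a set \<Rightarrow> ('a \<Rightarrow> 'b list) \<Rightarrow> 'a set" where
  "largest_closed V T = \<Union>{B. B \<subseteq> V \<and> descendant_closed T B}"

lemma largest_closed_subset: "largest_closed V T \<subseteq> V"
  by (auto simp: largest_closed_def)

lemma descendant_closed_largest: "descendant_closed T (largest_closed V T)"
  unfolding largest_closed_def descendant_closed_def by blast

text \<open>
  Replaces the union by a condition on \<open>B\<close> and on the subsets of \<open>V\<close> that contain \<open>B\<close>; there are
  only finitely many of them if \<open>V\<close> is finite.
\<close>

lemma largest_closed_eq_iff:
  "largest_closed V T = B \<longleftrightarrow>
     B \<subseteq> V \<and> descendant_closed T B \<and> (\<forall>B'\<in>Pow V. B \<subseteq> B' \<longrightarrow> descendant_closed T B' \<longrightarrow> B' = B)"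
proof
  assume "largest_closed V T = B"
  then show "B \<subseteq> V \<and> descendant_closed T B \<and> (\<forall>B'\<in>Pow V. B \<subseteq> B' \<longrightarrow> descendant_closed T B' \<longrightarrow> B' = B)"
    using largest_closed_subset[of V T] descendant_closed_largest[of T V]
    by (auto simp: largest_closed_def)
next
  assume B: "B \<subseteq> V \<and> descendant_closed T B \<and> (\<forall>B'\<in>Pow V. B \<subseteq> B' \<longrightarrow> descendant_closed T B' \<longrightarrow> B' = B)"
  then have "B \<subseteq> largest_closed V T" by (auto simp: largest_closed_def)
  with B show "largest_closed V T = B"
    using largest_closed_subset[of V T] descendant_closed_largest[of T V] by blast
qed

text \<open>
  Whether \<open>B\<close> or a larger set is closed depends on the stacks outside \<open>B\<close> only. Hence rerouting a path
  inside \<open>B\<close> does not change the value of \<open>B\<close>, which makes conditioning on this value compatible with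
  rerouting.
\<close>

lemma largest_closed_cong_outside:
  assumes "\<And>v. v \<notin> B \<Longrightarrow> T v = T' v" "largest_closed V T = B"
  shows "largest_closed V T' = B"
proof -
  have "descendant_closed T B' \<longleftrightarrow> descendant_closed T' B'" if "B \<subseteq> B'" for B'
    unfolding descendant_closed_def using assms(1) that by (metis subsetD)
  then show ?thesis using assms(2) unfolding largest_closed_eq_iff by blast
qed

definition closed_in_neighbourhood :: "'a set \<Rightarrow> 'a set" where
  "closed_in_neighbourhood V = V \<union> tail G ` (\<Union>v\<in>V. in_arcs G v)"

text \<open>
  A last exit into a subset of \<open>V\<close> starts in \<open>V\<close> or at a vertex with an arc into \<open>V\<close>, so the largest
  closed subset of \<open>V\<close> can be read off a sufficiently long initial segment of a ray.
\<close>

lemma largest_closed_cong_neighbourhood: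
  assumes "\<And>v. v \<in> closed_in_neighbourhood V \<Longrightarrow> T v = T' v"
    and "\<And>v. T v \<noteq> [] \<Longrightarrow> last (T v) \<in> out_arcs G v" "\<And>v. T' v \<noteq> [] \<Longrightarrow> last (T' v) \<in> out_arcs G v"
  shows "largest_closed V T = largest_closed V T'"
proof -
  have near: "v \<in> closed_in_neighbourhood V"
    if "e \<in> out_arcs G v" "head G e \<in> B" "B \<subseteq> V" for v e B
  proof -
    have "e \<in> (\<Union>v\<in>V. in_arcs G v)" "tail G e = v" using that by auto
    then show ?thesis by (auto simp: closed_in_neighbourhood_def)
  qed
  have "descendant_closed T B \<longleftrightarrow> descendant_closed T' B" if B: "B \<subseteq> V" for B
    unfolding descendant_closed_def
  proof (intro iff_allI)
    fix v
    show "(v \<notin> B \<longrightarrow> T v \<noteq> [] \<longrightarrow> head G (last (T v)) \<notin> B) \<longleftrightarrow>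
          (v \<notin> B \<longrightarrow> T' v \<noteq> [] \<longrightarrow> head G (last (T' v)) \<notin> B)"
    proof (cases "v \<in> closed_in_neighbourhood V")
      case True then show ?thesis by (simp add: assms(1))
    next
      case False
      have "T v \<noteq> [] \<Longrightarrow> head G (last (T v)) \<notin> B" "T' v \<noteq> [] \<Longrightarrow> head G (last (T' v)) \<notin> B"
        using assms(2,3)[of v] near[OF _ _ B] False by blast+
      then show ?thesis by blast
    qed
  qed
  then have "{B. B \<subseteq> V \<and> descendant_closed T B} = {B. B \<subseteq> V \<and> descendant_closed T' B}" by blast
  then show ?thesis unfolding largest_closed_def by simp
qed

definition stack_choices :: "'a set \<Rightarrow> ('a \<Rightarrow> 'b list) set" where
  "stack_choices B = {s \<in> PiE B (\<lambda>v. permutations_of_set (out_arcs G v)).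
     \<forall>v\<in>B. escapes (\<lambda>v. last (s v)) B v}"

end

lemma card_permutations_with_last:
  assumes "finite A" "a \<in> A"
  shows "card {l \<in> permutations_of_set A. last l = a} = fact (card A - 1)"
proof -
  have "bij_betw (\<lambda>l. l @ [a]) (permutations_of_set (A - {a})) {l \<in> permutations_of_set A. last l = a}"
  proof (rule bij_betwI[where g = butlast])
    show "(\<lambda>l. l @ [a]) \<in> permutations_of_set (A - {a}) \<rightarrow> {l \<in> permutations_of_set A. last l = a}"
    proof
      fix l assume "l \<in> permutations_of_set (A - {a})"
      then have "set l = A - {a}" "distinct l" by (auto dest: permutations_of_setD)
      then show "l @ [a] \<in> {l \<in> permutations_of_set A. last l = a}"
        using assms(2) by (simp add: permutations_of_set_def insert_absorb)
    qed
    show "butlast \<in> {l \<in> permutations_of_set A. last l = a} \<rightarrow> permutations_of_set (A - {a})"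
    proof
      fix l assume l: "l \<in> {l \<in> permutations_of_set A. last l = a}"
      then have "l \<noteq> []" "last l = a" using assms(2) by (auto simp: permutations_of_set_def)
      then obtain m where m: "l = m @ [a]" by (metis append_butlast_last_id)
      have "set l = A" "distinct l" using l by (auto simp: permutations_of_set_def)
      then have "insert a (set m) = A" "distinct m" "a \<notin> set m" by (auto simp: m)
      then show "butlast l \<in> permutations_of_set (A - {a})" by (auto simp: permutations_of_set_def m)
    qed
    fix l assume l: "l \<in> {l \<in> permutations_of_set A. last l = a}"
    then have "l \<noteq> []" using assms(2) by (auto simp: permutations_of_set_def)
    moreover have "last l = a" using l by simp
    ultimately show "butlast l @ [a] = l" by (metis append_butlast_last_id)
  qed simp
  from bij_betw_same_card[OF this] show ?thesis using assms by simp
qed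

context infinite_sourced_eulerian_digraph
begin

lemma finite_stack_choices:
  assumes "finite B" "B \<subseteq> verts G"
  shows "finite (stack_choices B)"
proof (rule finite_subset)
  show "stack_choices B \<subseteq> PiE B (\<lambda>v. permutations_of_set (out_arcs G v))"
    by (auto simp: stack_choices_def)
  show "finite (PiE B (\<lambda>v. permutations_of_set (out_arcs G v)))"
    using assms finite_out by (intro finite_PiE) auto
qed

text \<open>
  The last entries form a forest, and the entries above the last one at \<open>v\<close> are in any of \<open>(d - 1)!\<close>
  orders, where \<open>d\<close> is the out-degree of \<open>v\<close>; the orders at the vertices in \<open>J\<close> are prescribed.
\<close>

lemma card_stack_choices:
  assumes B: "finite B" "B \<subseteq> verts G" and J: "J \<subseteq> B"
    and t: "\<And>v. v \<in> J \<Longrightarrow> t v \<in> permutations_of_set (out_arcs G v)"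
  shows "card {s \<in> stack_choices B. \<forall>v\<in>J. s v = t v} =
         card {f \<in> forests B. \<forall>v\<in>J. f v = last (t v)} * (\<Prod>v\<in>B - J. fact (out_degree G v - 1))"
proof -
  let ?F = "{f \<in> forests B. \<forall>v\<in>J. f v = last (t v)}"
  let ?S = "\<lambda>f. PiE B (\<lambda>v. if v \<in> J then {t v} else {l \<in> permutations_of_set (out_arcs G v). last l = f v})"
  have f_in: "f v \<in> out_arcs G v" if "f \<in> forests B" "v \<in> B" for f v
    using that by (auto simp: forests_def)
  have last_S: "last (s v) = f v" if "f \<in> ?F" "s \<in> ?S f" "v \<in> B" for f s v
    using that(1,3) PiE_mem[OF that(2,3)] by (auto split: if_splits)
  have "{s \<in> stack_choices B. \<forall>v\<in>J. s v = t v} = (\<Union>f\<in>?F. ?S f)"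
  proof (intro equalityI subsetI)
    fix s assume "s \<in> {s \<in> stack_choices B. \<forall>v\<in>J. s v = t v}"
    then have s: "s \<in> PiE B (\<lambda>v. permutations_of_set (out_arcs G v))"
      "\<And>v. v \<in> B \<Longrightarrow> escapes (\<lambda>v. last (s v)) B v" "\<And>v. v \<in> J \<Longrightarrow> s v = t v"
      by (auto simp: stack_choices_def)
    let ?f = "restrict (\<lambda>v. last (s v)) B"
    have "last (s v) \<in> out_arcs G v" if v: "v \<in> B" for v
    proof -
      have "set (s v) = out_arcs G v" using PiE_mem[OF s(1) v] by (simp add: permutations_of_set_def)
      moreover have "out_arcs G v \<noteq> {}" using out_arcs_nonempty B(2) v by blast
      ultimately show ?thesis by (metis last_in_set list.set(1))
    qed
    moreover have "escapes ?f B v" if "v \<in> B" for v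
      using s(2)[OF that] escapes_cong[of B ?f "\<lambda>v. last (s v)"] by simp
    ultimately have "?f \<in> ?F" using s(3) J by (auto simp: forests_def)
    moreover have "s \<in> ?S ?f" using s J by (auto simp: PiE_iff)
    ultimately show "s \<in> (\<Union>f\<in>?F. ?S f)" by blast
  next
    fix s assume "s \<in> (\<Union>f\<in>?F. ?S f)"
    then obtain f where f: "f \<in> ?F" "s \<in> ?S f" by blast
    have sv: "s v \<in> permutations_of_set (out_arcs G v)" if "v \<in> B" for v
      using PiE_mem[OF f(2) that] t by (auto split: if_splits)
    have sJ: "s v = t v" if "v \<in> J" for v
      using PiE_mem[OF f(2), of v] that J by auto
    have "escapes (\<lambda>v. last (s v)) B v" if "v \<in> B" for v
      using escapes_cong[of B f "\<lambda>v. last (s v)"] last_S[OF f] f(1) that by (auto simp: forests_def)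
    moreover have "s \<in> extensional B" using f(2) by (auto simp: PiE_iff)
    ultimately show "s \<in> {s \<in> stack_choices B. \<forall>v\<in>J. s v = t v}"
      using sv sJ by (auto simp: stack_choices_def PiE_iff)
  qed
  also have "card (\<Union>f\<in>?F. ?S f) = (\<Sum>f\<in>?F. card (?S f))"
  proof (rule card_UN_disjoint)
    show "finite ?F" using finite_forests[OF B] by simp
    show "\<forall>f\<in>?F. finite (?S f)" using B finite_out by (auto intro!: finite_PiE)
    show "\<forall>f\<in>?F. \<forall>g\<in>?F. f \<noteq> g \<longrightarrow> ?S f \<inter> ?S g = {}"
    proof (intro ballI impI equals0I)
      fix f g s assume fg: "f \<in> ?F" "g \<in> ?F" "f \<noteq> g" "s \<in> ?S f \<inter> ?S g"
      have "f = g"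
      proof (rule PiE_ext)
        show "f \<in> PiE B (out_arcs G)" "g \<in> PiE B (out_arcs G)" using fg by (auto simp: forests_def)
        fix v assume "v \<in> B"
        then show "f v = g v" using last_S[OF fg(1), of s v] last_S[OF fg(2), of s v] fg(4) by auto
      qed
      then show False using fg(3) by simp
    qed
  qed
  also have "\<dots> = (\<Sum>f\<in>?F. \<Prod>v\<in>B - J. fact (out_degree G v - 1))"
  proof (rule sum.cong[OF refl])
    fix f assume f: "f \<in> ?F"
    have "card (?S f) = (\<Prod>v\<in>B. if v \<in> J then 1 else fact (out_degree G v - 1))"
      unfolding card_PiE[OF B(1)]
    proof (rule prod.cong[OF refl])
      fix v assume v: "v \<in> B"
      then have "f v \<in> out_arcs G v" "finite (out_arcs G v)" using f f_in B(2) finite_out by auto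
      then show "card (if v \<in> J then {t v} else {l \<in> permutations_of_set (out_arcs G v). last l = f v}) =
         (if v \<in> J then 1 else fact (out_degree G v - 1))"
        by (simp add: card_permutations_with_last out_degree_def)
    qed
    also have "\<dots> = (\<Prod>v\<in>B - J. fact (out_degree G v - 1))"
      using B(1) by (intro prod.mono_neutral_cong_right) auto
    finally show "card (?S f) = (\<Prod>v\<in>B - J. fact (out_degree G v - 1))" .
  qed
  finally show ?thesis by simp
qed

lemma card_stack_choices_ratio:
  assumes B: "finite B" "B \<subseteq> verts G" and J: "J \<subseteq> B" and ne: "forests B \<noteq> {}"
    and t: "\<And>v. v \<in> J \<Longrightarrow> t v \<in> permutations_of_set (out_arcs G v)"
  shows "real (card {s \<in> stack_choices B. \<forall>v\<in>J. s v = t v}) / real (card (stack_choices B)) =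
         real (card {f \<in> forests B. \<forall>v\<in>J. f v = last (t v)}) / real (card (forests B)) *
         (\<Prod>v\<in>J. 1 / fact (out_degree G v - 1))"
proof -
  let ?w = "\<lambda>A. \<Prod>v\<in>A. fact (out_degree G v - 1) :: real"
  have all: "real (card (stack_choices B)) = card (forests B) * ?w B"
    using card_stack_choices[OF B, of "{}" t] by simp
  have sub: "real (card {s \<in> stack_choices B. \<forall>v\<in>J. s v = t v}) =
      card {f \<in> forests B. \<forall>v\<in>J. f v = last (t v)} * ?w (B - J)"
    using card_stack_choices[OF B J t] by simp
  have "?w B = ?w (B - J) * ?w J"
    using prod.subset_diff[OF J B(1)] by simp
  moreover have "?w (B - J) \<noteq> 0" "?w J \<noteq> 0"
    using B(1) finite_subset[OF J B(1)] by (simp_all add: prod_zero_iff)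
  moreover have "(\<Prod>v\<in>J. 1 / fact (out_degree G v - 1)) = 1 / ?w J"
    by (simp add: prod_dividef)
  moreover have "card (forests B) \<noteq> 0" using ne finite_forests[OF B] by simp
  ultimately show ?thesis unfolding all sub by (simp add: field_simps)
qed

lemma finite_closed_in_neighbourhood:
  "finite V \<Longrightarrow> V \<subseteq> verts G \<Longrightarrow> finite (closed_in_neighbourhood V)"
  and closed_in_neighbourhood_in_verts: "V \<subseteq> verts G \<Longrightarrow> closed_in_neighbourhood V \<subseteq> verts G"
  using finite_in by (auto simp: closed_in_neighbourhood_def)

text \<open>
  The initial segments of length \<open>n\<close> that have used up the stacks on \<open>V\<close> and its in-neighbours, and so
  decide both the largest closed subset of \<open>V\<close> and the stacks on it.
\<close>

definition covering_trails :: "nat \<Rightarrow> 'v set \<Rightarrow> 'v set \<Rightarrow> ('v \<Rightarrow> 'e list) \<Rightarrow> 'e list set" where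
  "covering_trails n V B s = {p. length p = n \<and> (\<exists>b. awalk source p b) \<and> distinct p \<and>
     (\<forall>v\<in>closed_in_neighbourhood V. out_arcs G v \<subseteq> set p) \<and>
     largest_closed V (exit_list p) = B \<and> (\<forall>v\<in>B. exit_list p v = s v)}"

lemma covering_trails_reroute:
  assumes V: "V \<subseteq> verts G" and s': "s' \<in> stack_choices B" and p: "p \<in> covering_trails n V B s"
  shows "\<exists>q\<in>covering_trails n V B s'. (\<exists>b. awalk source p b \<and> awalk source q b) \<and>
           set q = set p \<and> (\<forall>v. v \<notin> B \<longrightarrow> exit_list q v = exit_list p v)"
proof -
  obtain b where b: "awalk source p b" using p by (auto simp: covering_trails_def)
  have dp: "distinct p" and lc: "largest_closed V (exit_list p) = B"
    and cov: "\<And>v. v \<in> closed_in_neighbourhood V \<Longrightarrow> out_arcs G v \<subseteq> set p"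
    using p by (auto simp: covering_trails_def)
  have BV: "B \<subseteq> V" using lc largest_closed_subset by blast
  have clo: "descendant_closed (exit_list p) B" using lc descendant_closed_largest by blast
  have "\<exists>q. awalk source q b \<and> distinct q \<and> set q = set p \<and>
             (\<forall>v. exit_list q v = (if v \<in> B then s' v else exit_list p v))"
  proof (rule reroute[OF b dp])
    fix v assume v: "v \<in> B"
    show "out_arcs G v \<subseteq> set p" using v BV by (intro cov) (auto simp: closed_in_neighbourhood_def)
    show "in_arcs G v \<subseteq> set p"
    proof
      fix e assume e: "e \<in> in_arcs G v"
      then have "tail G e \<in> closed_in_neighbourhood V"
        using v BV by (auto simp: closed_in_neighbourhood_def)
      from cov[OF this] e show "e \<in> set p" by auto
    qed
    show "s' v \<in> permutations_of_set (out_arcs G v)" "escapes (\<lambda>v. last (s' v)) B v"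
      using s' v by (auto simp: stack_choices_def)
  next
    fix v assume "v \<notin> B" "exit_list p v \<noteq> []"
    then show "head G (last (exit_list p v)) \<notin> B" using clo by (auto simp: descendant_closed_def)
  qed
  then obtain q where q: "awalk source q b" "distinct q" "set q = set p"
    "\<And>v. exit_list q v = (if v \<in> B then s' v else exit_list p v)" by blast
  have "largest_closed V (exit_list q) = B"
    using lc by (rule largest_closed_cong_outside[rotated]) (simp add: q(4))
  moreover have "length q = n" using p distinct_card[OF dp] distinct_card[OF q(2)] q(3)
    by (simp add: covering_trails_def)
  ultimately have "q \<in> covering_trails n V B s'"
    using q cov by (auto simp: covering_trails_def)
  then show ?thesis using b q by (intro bexI[of _ q]) auto
qed

end

context proper_gibbs
begin

definition trail_event :: "nat \<Rightarrow> 'v set \<Rightarrow> 'v set \<Rightarrow> ('v \<Rightarrow> 'e list) \<Rightarrow> ('v, 'e) dpath set" where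
  "trail_event n V B s = (\<Union>p\<in>covering_trails n V B s. {X \<in> space \<mu>. starts_with p X})"

definition stack_event :: "'v set \<Rightarrow> 'v set \<Rightarrow> ('v \<Rightarrow> 'e list) \<Rightarrow> ('v, 'e) dpath set" where
  "stack_event V B s = {X \<in> space \<mu>. largest_closed V (ray_exits X) = B \<and> (\<forall>v\<in>B. ray_exits X v = s v)}"

lemma countable_covering_trails: "countable (covering_trails n V B s)"
  by (rule countable_subset[OF _ countable_arc_lists]) (auto simp: covering_trails_def)

lemma trail_event_measurable: "trail_event n V B s \<in> events"
  unfolding trail_event_def
  using starts_with_event countable_covering_trails by (intro sets.countable_UN') auto

lemma emeasure_trail_event:
  "emeasure \<mu> (trail_event n V B s) =
     (\<integral>\<^sup>+p. emeasure \<mu> {X \<in> space \<mu>. starts_with p X} \<partial>count_space (covering_trails n V B s))"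
  unfolding trail_event_def
proof (rule emeasure_UN_countable)
  show "disjoint_family_on (\<lambda>p. {X \<in> space \<mu>. starts_with p X}) (covering_trails n V B s)"
    by (auto simp: disjoint_family_on_def covering_trails_def starts_with_iff)
qed (use starts_with_event countable_covering_trails in auto)

text \<open>
  Rerouting maps the trails with stacks \<open>s\<close> on \<open>B\<close> to trails with stacks \<open>s'\<close> on \<open>B\<close>. It preserves their
  probabilities by exchangeability, and it is injective because it leaves the stacks outside \<open>B\<close> alone and
  a walk is determined by its stacks.
\<close>

lemma trail_event_le:
  assumes V: "V \<subseteq> verts G" and s': "s' \<in> stack_choices B"
  shows "emeasure \<mu> (trail_event n V B s) \<le> emeasure \<mu> (trail_event n V B s')"
proof -
  let ?P = "covering_trails n V B s" and ?P' = "covering_trails n V B s'"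
  let ?m = "\<lambda>p. emeasure \<mu> {X \<in> space \<mu>. starts_with p X}"
  have "\<forall>p\<in>?P. \<exists>q. q \<in> ?P' \<and> (\<exists>b. awalk source p b \<and> awalk source q b) \<and>
           set q = set p \<and> (\<forall>v. v \<notin> B \<longrightarrow> exit_list q v = exit_list p v)"
    using covering_trails_reroute[OF V s', of _ n s] by blast
  from bchoice[OF this] obtain h where
    h: "\<And>p. p \<in> ?P \<Longrightarrow> h p \<in> ?P' \<and> (\<exists>b. awalk source p b \<and> awalk source (h p) b) \<and>
           set (h p) = set p \<and> (\<forall>v. v \<notin> B \<longrightarrow> exit_list (h p) v = exit_list p v)"
    by blast
  have inj: "inj_on h ?P"
  proof (rule inj_onI)
    fix p q assume pq: "p \<in> ?P" "q \<in> ?P" "h p = h q"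
    have "exit_list p = exit_list q"
    proof
      fix v show "exit_list p v = exit_list q v"
      proof (cases "v \<in> B")
        case True then show ?thesis using pq by (simp add: covering_trails_def)
      next
        case False then show ?thesis using h[OF pq(1)] h[OF pq(2)] pq(3) by metis
      qed
    qed
    moreover obtain b c where "cas source p b" "cas source q c"
      using pq by (auto simp: covering_trails_def awalk_def)
    ultimately show "p = q" using walk_determined_by_exit_lists by blast
  qed
  have "emeasure \<mu> (trail_event n V B s) = (\<integral>\<^sup>+p. ?m (h p) \<partial>count_space ?P)"
    unfolding emeasure_trail_event
  proof (rule nn_integral_cong)
    fix p assume "p \<in> space (count_space ?P)"
    then have p: "p \<in> ?P" by simp
    from h[OF p] obtain b where b: "awalk source p b" "awalk source (h p) b" "set p = set (h p)" "h p \<in> ?P'"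
      by auto
    show "?m p = ?m (h p)"
      using b(4) p by (intro prefix_exchangeable[OF b(1) _ b(2) _ b(3)]) (auto simp: covering_trails_def)
  qed
  also have "\<dots> = (\<integral>\<^sup>+q. ?m q \<partial>count_space (h ` ?P))"
    by (rule nn_integral_bij_count_space) (rule inj_on_imp_bij_betw[OF inj])
  also have "\<dots> = (\<integral>\<^sup>+q. ?m q * indicator (h ` ?P) q \<partial>count_space UNIV)"
    by (simp add: nn_integral_count_space_indicator)
  also have "\<dots> \<le> (\<integral>\<^sup>+q. ?m q * indicator ?P' q \<partial>count_space UNIV)"
    using h by (intro nn_integral_mono) (auto simp: indicator_def)
  also have "\<dots> = emeasure \<mu> (trail_event n V B s')"
    by (simp add: nn_integral_count_space_indicator emeasure_trail_event)
  finally show ?thesis .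
qed

lemma prob_trail_event_eq:
  assumes "V \<subseteq> verts G" "s \<in> stack_choices B" "s' \<in> stack_choices B"
  shows "prob (trail_event n V B s) = prob (trail_event n V B s')"
  using trail_event_le[OF assms(1,2), of n s'] trail_event_le[OF assms(1,3), of n s]
  by (simp add: emeasure_eq_measure)

lemma ray_exits_outside: "v \<notin> verts G \<Longrightarrow> ray_exits X v = []"
proof -
  assume "v \<notin> verts G"
  then have "out_arcs G v = {}" by auto
  then show ?thesis by (simp add: ray_exits_def path_prefix_def)
qed

lemma measurable_ray_exits_mu [measurable]: "(\<lambda>X. ray_exits X v) \<in> measurable \<mu> (count_space UNIV)"
  unfolding measurable_mu by (rule measurable_ray_exits)

lemma pred_ray_exits_eq: "Measurable.pred \<mu> (\<lambda>X. ray_exits X v = l)"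
  by (rule measurable_compose[OF measurable_ray_exits_mu[of v]]) simp

lemma measurable_largest_closed:
  assumes "finite V"
  shows "Measurable.pred \<mu> (\<lambda>X. largest_closed V (ray_exits X) = B)"
proof -
  have closed: "descendant_closed (ray_exits X) B' \<longleftrightarrow>
      (\<forall>v\<in>verts G. v \<notin> B' \<longrightarrow> ray_exits X v \<noteq> [] \<longrightarrow> head G (last (ray_exits X v)) \<notin> B')" for X B'
    unfolding descendant_closed_def using ray_exits_outside by blast
  have pred: "Measurable.pred \<mu> (\<lambda>X. descendant_closed (ray_exits X) B')" for B'
    unfolding closed
  proof (rule pred_ball_countable(1)[OF countable_verts])
    fix v
    show "Measurable.pred \<mu> (\<lambda>X. v \<notin> B' \<longrightarrow> ray_exits X v \<noteq> [] \<longrightarrow> head G (last (ray_exits X v)) \<notin> B')"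
      by (rule measurable_compose[OF measurable_ray_exits_mu[of v]]) simp
  qed
  show ?thesis
    unfolding largest_closed_eq_iff using assms pred
    by (intro pred_intros_logic pred_ball_countable) (auto simp: countable_finite)
qed

lemma stack_event_measurable:
  assumes V: "finite V" "V \<subseteq> verts G"
  shows "stack_event V B s \<in> events"
proof (cases "B \<subseteq> V")
  case True
  then have fin: "finite B" using V finite_subset by blast
  have "Measurable.pred \<mu> (\<lambda>X. largest_closed V (ray_exits X) = B \<and> (\<forall>v\<in>B. ray_exits X v = s v))"
    using fin by (intro pred_intros_logic pred_ball_countable measurable_largest_closed[OF V(1)] pred_ray_exits_eq)
      (auto simp: countable_finite)
  then show ?thesis by (simp add: stack_event_def pred_def)
next
  case False
  then have "stack_event V B s = {}" using largest_closed_subset by (auto simp: stack_event_def)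
  then show ?thesis by simp
qed

text \<open>
  Almost every path has crossed all arcs near \<open>V\<close> by some time, and from then on its initial segments
  decide the event. So the equality for initial segments passes to the limit.
\<close>

lemma prob_stack_event_eq:
  assumes V: "finite V" "V \<subseteq> verts G" and B: "B \<subseteq> V"
    and s: "s \<in> stack_choices B" and s': "s' \<in> stack_choices B"
  shows "prob (stack_event V B s) = prob (stack_event V B s')"
proof -
  have lim: "(\<lambda>n. prob (trail_event n V B r)) \<longlonglongrightarrow> prob (stack_event V B r)" for r
  proof (rule measure_tendsto_of_eventually_iff[OF trail_event_measurable stack_event_measurable[OF V]])
    show "AE X in \<mu>. \<forall>\<^sub>F n in sequentially. X \<in> trail_event n V B r \<longleftrightarrow> X \<in> stack_event V B r"
      using AE_eulerian_ray AE_space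
    proof eventually_elim
      case (elim X)
      interpret digraph_eulerian_ray G source X by unfold_locales (rule elim(1))
      have "finite (\<Union>v\<in>closed_in_neighbourhood V. out_arcs G v)"
        using finite_closed_in_neighbourhood[OF V] closed_in_neighbourhood_in_verts[OF V(2)] finite_out by auto
      then have "\<forall>\<^sub>F n in sequentially. (\<Union>v\<in>closed_in_neighbourhood V. out_arcs G v) \<subseteq> set (path_prefix n X)"
        by (rule eventually_covered) auto
      then show ?case
      proof eventually_elim
        case (elim n)
        then have cov: "out_arcs G v \<subseteq> set (path_prefix n X)" if "v \<in> closed_in_neighbourhood V" for v
          using that by blast
        have eq: "exit_list (path_prefix n X) v = ray_exits X v" if "v \<in> closed_in_neighbourhood V" for v
          using ray_exits_eq[OF cov[OF that]] by simp
        have sub: "set (path_prefix n X) \<subseteq> arcs G" using prefix_walk[of n] by blast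
        have "largest_closed V (exit_list (path_prefix n X)) = largest_closed V (ray_exits X)"
        proof (rule largest_closed_cong_neighbourhood[OF eq])
          fix v assume "exit_list (path_prefix n X) v \<noteq> []"
          from last_in_set[OF this] show "last (exit_list (path_prefix n X) v) \<in> out_arcs G v"
            using sub by (auto simp: set_exit_list)
        next
          fix v assume ne: "ray_exits X v \<noteq> []"
          then have "v \<in> verts G" using ray_exits_outside by blast
          then have "set (ray_exits X v) = out_arcs G v"
            using ray_exits_permutation by (auto simp: permutations_of_set_def)
          with last_in_set[OF ne] show "last (ray_exits X v) \<in> out_arcs G v" by simp
        qed simp
        moreover have "v \<in> closed_in_neighbourhood V" if "v \<in> B" for v
          using that B by (auto simp: closed_in_neighbourhood_def)
        ultimately have "path_prefix n X \<in> covering_trails n V B r \<longleftrightarrow> X \<in> stack_event V B r"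
          using prefix_walk[of n] distinct_prefix[of n] cov eq \<open>X \<in> space \<mu>\<close>
          by (auto simp: covering_trails_def stack_event_def)
        moreover have "X \<in> trail_event n V B r \<longleftrightarrow> path_prefix n X \<in> covering_trails n V B r"
          using \<open>X \<in> space \<mu>\<close> starts_with_prefix[of n]
          by (auto simp: trail_event_def starts_with_iff covering_trails_def)
        ultimately show ?case by simp
      qed
    qed
  qed
  have "(\<lambda>n. prob (trail_event n V B s)) = (\<lambda>n. prob (trail_event n V B s'))"
    using prob_trail_event_eq[OF V(2) s s'] by blast
  then show ?thesis using lim[of s] lim[of s'] by (metis LIMSEQ_unique)
qed

text \<open>
  The stacks on \<open>B\<close> almost surely belong to \<open>stack_choices B\<close>, because their last arcs lead out of the
  finite set \<open>B\<close>. All elements of \<open>stack_choices B\<close> are equally likely, so the conditional probability is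
  the proportion of those that agree with \<open>t\<close> on \<open>J\<close>.
\<close>

lemma prob_exits_given_closed:
  assumes V: "finite V" "V \<subseteq> verts G" and B: "B \<subseteq> V" and J: "J \<subseteq> B"
    and t: "\<And>v. v \<in> J \<Longrightarrow> t v \<in> permutations_of_set (out_arcs G v)"
  shows "prob {X \<in> space \<mu>. largest_closed V (ray_exits X) = B \<and> (\<forall>v\<in>J. ray_exits X v = t v)} =
         prob {X \<in> space \<mu>. largest_closed V (ray_exits X) = B} *
         (real (card {f \<in> forests B. \<forall>v\<in>J. f v = last (t v)}) / real (card (forests B)) *
         (\<Prod>v\<in>J. 1 / fact (out_degree G v - 1)))"
proof -
  have fB: "finite B" "B \<subseteq> verts G" using B V finite_subset by auto
  have "card (stack_choices B) = card (forests B) * (\<Prod>v\<in>B. fact (out_degree G v - 1))"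
    using card_stack_choices[OF fB, of "{}" t] by simp
  moreover have "(\<Prod>v\<in>B. fact (out_degree G v - 1) :: nat) > 0" by (intro prod_pos) simp
  ultimately have ne: "stack_choices B \<noteq> {}"
    using forests_nonempty[OF eulerian_ray_exists fB] finite_forests[OF fB] by (auto simp: card_gt_0_iff)
  then obtain s0 where s0: "s0 \<in> stack_choices B" by blast
  have sum: "prob {X \<in> space \<mu>. largest_closed V (ray_exits X) = B \<and> (\<forall>v\<in>I. ray_exits X v = t v)} =
      card {s \<in> stack_choices B. \<forall>v\<in>I. s v = t v} * prob (stack_event V B s0)" if I: "I \<subseteq> B" for I
  proof -
    let ?S = "{s \<in> stack_choices B. \<forall>v\<in>I. s v = t v}"
    have fI: "finite I" using I fB finite_subset by blast
    have "Measurable.pred \<mu> (\<lambda>X. largest_closed V (ray_exits X) = B \<and> (\<forall>v\<in>I. ray_exits X v = t v))"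
      using fI by (intro pred_intros_logic pred_ball_countable measurable_largest_closed[OF V(1)] pred_ray_exits_eq)
        (auto simp: countable_finite)
    then have ev: "{X \<in> space \<mu>. largest_closed V (ray_exits X) = B \<and> (\<forall>v\<in>I. ray_exits X v = t v)} \<in> events"
      by (simp add: pred_def)
    have "prob {X \<in> space \<mu>. largest_closed V (ray_exits X) = B \<and> (\<forall>v\<in>I. ray_exits X v = t v)} =
        prob (\<Union>s\<in>?S. stack_event V B s)"
    proof (rule finite_measure_eq_AE[OF _ ev])
      show "(\<Union>s\<in>?S. stack_event V B s) \<in> events"
        using finite_stack_choices[OF fB] stack_event_measurable[OF V] by (intro sets.finite_UN) auto
      show "AE X in \<mu>. X \<in> {X \<in> space \<mu>. largest_closed V (ray_exits X) = B \<and> (\<forall>v\<in>I. ray_exits X v = t v)} \<longleftrightarrow>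
          X \<in> (\<Union>s\<in>?S. stack_event V B s)"
        using AE_eulerian_ray
      proof eventually_elim
        case (elim X)
        interpret digraph_eulerian_ray G source X by unfold_locales (rule elim)
        let ?s = "restrict (ray_exits X) B"
        have "escapes (\<lambda>v. last (?s v)) B v" if "v \<in> B" for v
          using escapes_cong[of B "\<lambda>v. last (?s v)" "\<lambda>v. last (ray_exits X v)"]
            ray_exits_escape[OF fB(1)] that fB(2) by auto
        then have "?s \<in> stack_choices B"
          using fB(2) ray_exits_permutation by (auto simp: stack_choices_def)
        then show ?case
          using I by (fastforce simp: stack_event_def intro: bexI[of _ ?s])
      qed
    qed
    also have "\<dots> = (\<Sum>s\<in>?S. prob (stack_event V B s))"
    proof (rule finite_measure_finite_Union)
      show "disjoint_family_on (stack_event V B) ?S"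
        unfolding disjoint_family_on_def
      proof (intro ballI impI equals0I)
        fix s s' X assume s: "s \<in> ?S" "s' \<in> ?S" "s \<noteq> s'" "X \<in> stack_event V B s \<inter> stack_event V B s'"
        have "s = s'"
          by (rule PiE_ext[of s B "\<lambda>v. permutations_of_set (out_arcs G v)"])
             (use s in \<open>auto simp: stack_choices_def stack_event_def\<close>)
        then show False using s by simp
      qed
    qed (use finite_stack_choices[OF fB] stack_event_measurable[OF V] in auto)
    also have "\<dots> = (\<Sum>s\<in>?S. prob (stack_event V B s0))"
      using prob_stack_event_eq[OF V B _ s0] by (intro sum.cong) auto
    finally show ?thesis by simp
  qed
  have c: "card (stack_choices B) > 0" using ne finite_stack_choices[OF fB] by (simp add: card_gt_0_iff)
  have "prob {X \<in> space \<mu>. largest_closed V (ray_exits X) = B \<and> (\<forall>v\<in>J. ray_exits X v = t v)} =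
      prob {X \<in> space \<mu>. largest_closed V (ray_exits X) = B} *
      (real (card {s \<in> stack_choices B. \<forall>v\<in>J. s v = t v}) / real (card (stack_choices B)))"
    using sum[OF J] sum[of "{}"] c by (simp add: field_simps)
  then show ?thesis
    using card_stack_choices_ratio[OF fB J forests_nonempty[OF eulerian_ray_exists fB], of t] t by simp
qed

text \<open>
  The vertices that a ray leaves for the last time before time \<open>n\<close> are finite in number, and they form a
  closed set because last exit times increase along last exits. For large \<open>n\<close> this set contains \<open>K\<close>, and
  for large \<open>R\<close> it is contained in \<open>vs ` {..<R}\<close>.
\<close>

lemma largest_closed_exhausts:
  fixes vs :: "nat \<Rightarrow> 'v"
  assumes vs: "range vs = verts G" and K: "finite K" "K \<subseteq> verts G"
  shows "(\<lambda>R. prob {X \<in> space \<mu>. K \<subseteq> largest_closed (vs ` {..<R}) (ray_exits X)}) \<longlonglongrightarrow> 1"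
proof -
  have V: "finite (vs ` {..<R})" for R by simp
  have ev: "{X \<in> space \<mu>. K \<subseteq> largest_closed (vs ` {..<R}) (ray_exits X)} \<in> events" for R
  proof -
    have eq: "K \<subseteq> largest_closed (vs ` {..<R}) T \<longleftrightarrow>
        (\<exists>B\<in>{B. B \<subseteq> vs ` {..<R} \<and> K \<subseteq> B}. largest_closed (vs ` {..<R}) T = B)" for T
      using largest_closed_subset by auto
    have "countable {B. B \<subseteq> vs ` {..<R} \<and> K \<subseteq> B}"
      by (rule countable_finite, rule finite_subset[of _ "Pow (vs ` {..<R})"]) auto
    then have "Measurable.pred \<mu> (\<lambda>X. K \<subseteq> largest_closed (vs ` {..<R}) (ray_exits X))"
      unfolding eq using measurable_largest_closed[OF V] by (intro pred_ball_countable) auto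
    then show ?thesis by (simp add: pred_def)
  qed
  have "(\<lambda>R. prob {X \<in> space \<mu>. K \<subseteq> largest_closed (vs ` {..<R}) (ray_exits X)}) \<longlonglongrightarrow> prob (space \<mu>)"
  proof (rule measure_tendsto_of_eventually_iff[OF ev])
    show "AE X in \<mu>. \<forall>\<^sub>F R in sequentially.
        X \<in> {X \<in> space \<mu>. K \<subseteq> largest_closed (vs ` {..<R}) (ray_exits X)} \<longleftrightarrow> X \<in> space \<mu>"
      using AE_eulerian_ray
    proof eventually_elim
      case (elim X)
      interpret digraph_eulerian_ray G source X by unfold_locales (rule elim)
      obtain n where n: "\<And>v. v \<in> K \<Longrightarrow> last_exit_time v < n"
        using finite_nat_set_iff_bounded[of "last_exit_time ` K"] K(1) by auto
      define D where "D = {v \<in> verts G. last_exit_time v < n}"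
      have "descendant_closed (ray_exits X) D"
        unfolding descendant_closed_def
      proof (intro allI impI notI)
        fix v assume v: "v \<notin> D" "ray_exits X v \<noteq> []" "head G (last (ray_exits X v)) \<in> D"
        have "v \<in> verts G" using v(2) ray_exits_outside by blast
        from last_exit_time_increases[OF this] v(1,3) this show False by (auto simp: D_def)
      qed
      moreover have "K \<subseteq> D" using n K(2) by (auto simp: D_def)
      moreover have "\<forall>\<^sub>F R in sequentially. D \<subseteq> vs ` {..<R}"
      proof -
        have "\<forall>v\<in>D. \<forall>\<^sub>F R in sequentially. v \<in> vs ` {..<R}"
        proof
          fix v assume "v \<in> D"
          then obtain i where "v = vs i" using vs by (auto simp: D_def)
          then show "\<forall>\<^sub>F R in sequentially. v \<in> vs ` {..<R}"
            by (auto simp: eventually_sequentially intro!: exI[of _ "Suc i"])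
        qed
        moreover have "finite D" unfolding D_def by (rule finite_last_exit_before)
        ultimately have "\<forall>\<^sub>F R in sequentially. \<forall>v\<in>D. v \<in> vs ` {..<R}"
          by (intro eventually_ball_finite) auto
        then show ?thesis by (simp add: subset_eq)
      qed
      ultimately show ?case
        by (auto simp: largest_closed_def elim!: eventually_mono)
    qed
  qed simp
  then show ?thesis by (simp add: prob_space)
qed

text \<open>
  Average \<open>prob_exits_given_closed\<close> over the largest closed subset \<open>B\<close> of a large finite set. For all
  but a small probability \<open>B\<close> is so large that the proportion of forests is close to \<open>L\<close>.
\<close>

proposition prob_ray_exits:
  fixes vs :: "nat \<Rightarrow> 'v"
  assumes J: "finite J" "J \<subseteq> verts G"
    and t: "\<And>v. v \<in> J \<Longrightarrow> t v \<in> permutations_of_set (out_arcs G v)"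
    and vs: "range vs = verts G"
    and lim: "((\<lambda>B. real (card {f \<in> forests B. \<forall>v\<in>J. f v = last (t v)}) / real (card (forests B))) \<longlongrightarrow> L)
                (finite_subsets_at_top (verts G))"
  shows "prob {X \<in> space \<mu>. \<forall>v\<in>J. ray_exits X v = t v} = L * (\<Prod>v\<in>J. 1 / fact (out_degree G v - 1))"
proof -
  define U where "U B = real (card {f \<in> forests B. \<forall>v\<in>J. f v = last (t v)}) / real (card (forests B))" for B
  define c where "c = (\<Prod>v\<in>J. 1 / fact (out_degree G v - 1) :: real)"
  have c: "0 \<le> c" "c \<le> 1"
    unfolding c_def by (intro prod_nonneg prod_le_1; simp add: fact_ge_1)+
  have U01: "0 \<le> U B \<and> U B \<le> 1" if "finite B" "B \<subseteq> verts G" for B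
    using card_mono[OF finite_forests[OF that], of "{f \<in> forests B. \<forall>v\<in>J. f v = last (t v)}"]
    by (auto simp: U_def divide_le_eq_1)
  have ev01: "\<forall>\<^sub>F B in finite_subsets_at_top (verts G). 0 \<le> U B \<and> U B \<le> 1"
    unfolding eventually_finite_subsets_at_top using U01 by (intro exI[of _ "{}"]) auto
  have "(U \<longlongrightarrow> L) (finite_subsets_at_top (verts G))" unfolding U_def using lim .
  then have L: "0 \<le> L" "L \<le> 1"
    using ev01 by (auto intro: tendsto_lowerbound tendsto_upperbound elim: eventually_mono)
  let ?E = "{X \<in> space \<mu>. \<forall>v\<in>J. ray_exits X v = t v}"
  \<comment> \<open>One \<open>e\<close> is for the closed sets that contain \<open>K \<union> J\<close>,
    where the proportion is \<open>e\<close>-close to \<open>L\<close>, and one for the event that the closed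
    set is not that large.\<close>
  have bound: "\<bar>prob ?E - L * c\<bar> \<le> 2 * e" if e: "e > 0" for e
  proof -
    obtain K where K: "finite K" "K \<subseteq> verts G"
      and KU: "\<And>B. finite B \<Longrightarrow> K \<subseteq> B \<Longrightarrow> B \<subseteq> verts G \<Longrightarrow> \<bar>U B - L\<bar> < e"
      using tendstoD[OF \<open>(U \<longlongrightarrow> L) (finite_subsets_at_top (verts G))\<close> e]
      unfolding eventually_finite_subsets_at_top by (auto simp: dist_real_def)
    have KJ: "finite (K \<union> J)" "K \<union> J \<subseteq> verts G" using K J by auto
    from tendstoD[OF largest_closed_exhausts[OF vs KJ] e]
    obtain R where "dist (prob {X \<in> space \<mu>. K \<union> J \<subseteq> largest_closed (vs ` {..<R}) (ray_exits X)}) 1 < e"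
      unfolding eventually_sequentially by blast
    then have R: "1 - prob {X \<in> space \<mu>. K \<union> J \<subseteq> largest_closed (vs ` {..<R}) (ray_exits X)} < e"
      by (simp add: dist_real_def)
    define V where "V = vs ` {..<R}"
    have V: "finite V" "V \<subseteq> verts G" using vs by (auto simp: V_def)
    let ?L = "\<lambda>B. {X \<in> space \<mu>. largest_closed V (ray_exits X) = B}"
    let ?EL = "\<lambda>B. {X \<in> space \<mu>. largest_closed V (ray_exits X) = B \<and> (\<forall>v\<in>J. ray_exits X v = t v)}"
    have L_ev: "?L B \<in> events" for B
      using measurable_largest_closed[OF V(1), of B] by (simp add: pred_def)
    have EL_ev: "?EL B \<in> events" for B
    proof -
      have "Measurable.pred \<mu> (\<lambda>X. largest_closed V (ray_exits X) = B \<and> (\<forall>v\<in>J. ray_exits X v = t v))"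
        using J by (intro pred_intros_logic pred_ball_countable measurable_largest_closed[OF V(1)] pred_ray_exits_eq)
          (auto simp: countable_finite)
      then show ?thesis by (simp add: pred_def)
    qed
    have part: "prob (\<Union>B\<in>\<B>. S B) = (\<Sum>B\<in>\<B>. prob (S B))"
      if "\<B> \<subseteq> Pow V" "\<And>B. S B \<subseteq> ?L B" "\<And>B. S B \<in> events" for S \<B>
    proof (rule finite_measure_finite_Union)
      show "finite \<B>" using that(1) V(1) by (meson finite_Pow_iff finite_subset)
      show "disjoint_family_on S \<B>" using that(2) unfolding disjoint_family_on_def by blast
    qed (use that(3) in auto)
    have "?E = (\<Union>B\<in>Pow V. ?EL B)" using largest_closed_subset by auto
    then have E: "prob ?E = (\<Sum>B\<in>Pow V. prob (?EL B))" using part[of "Pow V" ?EL] EL_ev by auto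
    have "space \<mu> = (\<Union>B\<in>Pow V. ?L B)" using largest_closed_subset by auto
    then have one: "1 = (\<Sum>B\<in>Pow V. prob (?L B))" using part[of "Pow V" ?L] L_ev prob_space by auto
    have "{X \<in> space \<mu>. K \<union> J \<subseteq> largest_closed V (ray_exits X)} = (\<Union>B\<in>{B\<in>Pow V. K \<union> J \<subseteq> B}. ?L B)"
      using largest_closed_subset by auto
    then have big: "prob {X \<in> space \<mu>. K \<union> J \<subseteq> largest_closed V (ray_exits X)} =
        (\<Sum>B\<in>{B\<in>Pow V. K \<union> J \<subseteq> B}. prob (?L B))"
      using part[of "{B\<in>Pow V. K \<union> J \<subseteq> B}" ?L] L_ev by auto
    have split: "(\<Sum>B\<in>Pow V. g B) = (\<Sum>B\<in>{B\<in>Pow V. K \<union> J \<subseteq> B}. g B) +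
        (\<Sum>B\<in>{B\<in>Pow V. \<not> K \<union> J \<subseteq> B}. g B)" for g :: "'v set \<Rightarrow> real"
    proof -
      have "(\<Sum>B\<in>Pow V. g B) = (\<Sum>B\<in>{B\<in>Pow V. K \<union> J \<subseteq> B} \<union> {B\<in>Pow V. \<not> K \<union> J \<subseteq> B}. g B)"
        by (rule sum.cong) auto
      also have "\<dots> = (\<Sum>B\<in>{B\<in>Pow V. K \<union> J \<subseteq> B}. g B) + (\<Sum>B\<in>{B\<in>Pow V. \<not> K \<union> J \<subseteq> B}. g B)"
        using V(1) by (intro sum.union_disjoint) auto
      finally show ?thesis .
    qed
    have dev: "\<bar>prob (?EL B) - L * c * prob (?L B)\<bar> \<le> (if K \<union> J \<subseteq> B then e * prob (?L B) else prob (?L B))"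
      if B: "B \<in> Pow V" for B
    proof (cases "K \<union> J \<subseteq> B")
      case True
      have fB: "finite B" "B \<subseteq> verts G" using B V finite_subset by auto
      have "prob (?EL B) = prob (?L B) * (U B * c)"
        using prob_exits_given_closed[OF V _ _ t, of B J] B True by (simp add: U_def c_def)
      then have "prob (?EL B) - L * c * prob (?L B) = (U B - L) * (c * prob (?L B))"
        by (simp add: algebra_simps)
      also have "\<bar>\<dots>\<bar> = \<bar>U B - L\<bar> * (c * prob (?L B))"
        using c by (simp add: abs_mult)
      also have "\<dots> \<le> e * (1 * prob (?L B))"
        using KU[OF fB(1) _ fB(2)] True c e by (intro mult_mono) auto
      finally show ?thesis using True by simp
    next
      case False
      have "prob (?EL B) \<le> prob (?L B)" using L_ev by (intro finite_measure_mono) auto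
      moreover have "L * c \<le> 1" using L c by (simp add: mult_le_one)
      then have "L * c * prob (?L B) \<le> prob (?L B)" "0 \<le> L * c * prob (?L B)"
        using L c by (auto simp: mult_left_le_one_le)
      ultimately show ?thesis
        unfolding if_not_P[OF False] abs_le_iff using measure_nonneg[of \<mu> "?EL B"] by linarith
    qed
    have "\<bar>prob ?E - L * c\<bar> = \<bar>\<Sum>B\<in>Pow V. prob (?EL B) - L * c * prob (?L B)\<bar>"
      using E one by (simp add: sum_subtractf sum_distrib_left[symmetric])
    also have "\<dots> \<le> (\<Sum>B\<in>Pow V. if K \<union> J \<subseteq> B then e * prob (?L B) else prob (?L B))"
      by (rule order_trans[OF sum_abs]) (rule sum_mono[OF dev])
    also have "\<dots> = e * (\<Sum>B\<in>{B\<in>Pow V. K \<union> J \<subseteq> B}. prob (?L B)) +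
        (\<Sum>B\<in>{B\<in>Pow V. \<not> K \<union> J \<subseteq> B}. prob (?L B))"
      unfolding split sum_distrib_left by (intro arg_cong2[where f = "(+)"] sum.cong) auto
    also have "(\<Sum>B\<in>{B\<in>Pow V. \<not> K \<union> J \<subseteq> B}. prob (?L B)) =
        1 - prob {X \<in> space \<mu>. K \<union> J \<subseteq> largest_closed V (ray_exits X)}"
      using one split[of "\<lambda>B. prob (?L B)"] big by simp
    also have "e * (\<Sum>B\<in>{B\<in>Pow V. K \<union> J \<subseteq> B}. prob (?L B)) +
        (1 - prob {X \<in> space \<mu>. K \<union> J \<subseteq> largest_closed V (ray_exits X)}) \<le> e * 1 + e"
      unfolding big[symmetric] using R[folded V_def] e by (intro add_mono mult_left_mono) auto
    finally show ?thesis by simp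
  qed
  have small: "\<bar>prob ?E - L * c\<bar> \<le> 0 + e" if "e > 0" for e
    using bound[of "e / 2"] that by simp
  have "\<bar>prob ?E - L * c\<bar> \<le> 0" by (rule field_le_epsilon[OF small])
  then show ?thesis by (simp add: c_def)
qed

end

section \<open>Transience of the random walk\<close>

context infinite_sourced_eulerian_digraph
begin

lemma walk_weight_pos: "awalk u p v \<Longrightarrow> walk_weight p > 0"
proof (induction p arbitrary: u)
  case (Cons e p)
  then have "awalk (head G e) p v" "tail G e \<in> verts G" by (auto simp: awalk_simps)
  then show ?case using Cons.IH out_degree_pos[of "tail G e"] by simp
qed simp

definition walks_to :: "'v \<Rightarrow> nat \<Rightarrow> 'v \<Rightarrow> 'e list set" where
  "walks_to u n w = {p. length p = n \<and> awalk u p w}"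

text \<open>
  The probability that the random walk from \<open>u\<close> is at \<open>w\<close> at time \<open>n\<close>.
\<close>

definition step_mass :: "'v \<Rightarrow> nat \<Rightarrow> 'v \<Rightarrow> real" where
  "step_mass u n w = (\<Sum>p\<in>walks_to u n w. walk_weight p)"

lemma walks_to_Suc:
  assumes "w \<in> verts G"
  shows "bij_betw (\<lambda>(e, p). p @ [e]) (SIGMA e:in_arcs G w. walks_to u n (tail G e)) (walks_to u (Suc n) w)"
proof (rule bij_betwI')
  fix x y
  show "(case x of (e, p) \<Rightarrow> p @ [e]) = (case y of (e, p) \<Rightarrow> p @ [e]) \<longleftrightarrow> x = y"
    by (cases x; cases y) auto
next
  fix x assume "x \<in> (SIGMA e:in_arcs G w. walks_to u n (tail G e))"
  then show "(case x of (e, p) \<Rightarrow> p @ [e]) \<in> walks_to u (Suc n) w"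
    by (auto simp: walks_to_def awalk_simps)
next
  fix q assume q: "q \<in> walks_to u (Suc n) w"
  then obtain p e where pe: "q = p @ [e]" by (cases q rule: rev_cases) (auto simp: walks_to_def)
  have e: "e \<in> in_arcs G w" and p: "p \<in> walks_to u n (tail G e)"
    using q unfolding pe walks_to_def by (auto simp: awalk_simps)
  then show "\<exists>x\<in>(SIGMA e:in_arcs G w. walks_to u n (tail G e)). q = (case x of (e, p) \<Rightarrow> p @ [e])"
    unfolding pe by (intro bexI[of _ "(e, p)"]) auto
qed

lemma finite_walks_to: "w \<in> verts G \<Longrightarrow> finite (walks_to u n w)"
proof (induction n arbitrary: w)
  case 0
  have "walks_to u 0 w \<subseteq> {[]}" by (auto simp: walks_to_def)
  then show ?case by (rule finite_subset) simp
next
  case (Suc n)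
  have "finite (SIGMA e:in_arcs G w. walks_to u n (tail G e))"
    using Suc finite_in by (intro finite_SigmaI) auto
  then show ?case using bij_betw_finite[OF walks_to_Suc[OF Suc.prems]] by blast
qed

lemma step_mass_nonneg: "step_mass u n w \<ge> 0"
  by (auto simp: step_mass_def intro: sum_nonneg)

lemma step_mass_0: "step_mass u 0 w = (if u = w \<and> w \<in> verts G then 1 else 0)"
proof -
  have "walks_to u 0 w = (if u = w \<and> w \<in> verts G then {[]} else {})"
    by (auto simp: walks_to_def awalk_simps)
  then show ?thesis by (simp add: step_mass_def)
qed

lemma step_mass_Suc:
  assumes "w \<in> verts G"
  shows "step_mass u (Suc n) w = (\<Sum>e\<in>in_arcs G w. step_mass u n (tail G e) / out_degree G (tail G e))"
proof -
  have "step_mass u (Suc n) w = (\<Sum>(e, p)\<in>(SIGMA e:in_arcs G w. walks_to u n (tail G e)). walk_weight (p @ [e]))"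
    unfolding step_mass_def
    by (subst sum.reindex_bij_betw[OF walks_to_Suc[OF assms], symmetric]) (simp add: case_prod_unfold)
  also have "\<dots> = (\<Sum>e\<in>in_arcs G w. \<Sum>p\<in>walks_to u n (tail G e). walk_weight (p @ [e]))"
    using finite_in[OF assms] finite_walks_to by (subst sum.Sigma) auto
  also have "\<dots> = (\<Sum>e\<in>in_arcs G w. step_mass u n (tail G e) / out_degree G (tail G e))"
    by (simp add: step_mass_def sum_divide_distrib)
  finally show ?thesis .
qed

text \<open>
  Induction on the time horizon. By the induction hypothesis every arc is expected to be crossed at most
  once, so a vertex is expected to be entered at most as often as its in-degree. At the source the visit
  at time zero has to be added, and it is made up for by the additional arc going out.
\<close>

lemma expected_visits_from_source:
  "w \<in> verts G \<Longrightarrow> (\<Sum>i\<le>n. step_mass source i w) \<le> out_degree G w"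
proof (induction n arbitrary: w)
  case 0
  then show ?case using out_degree_pos[of w] by (simp add: step_mass_0)
next
  case (Suc n)
  have "(\<Sum>i\<le>Suc n. step_mass source i w) =
      step_mass source 0 w + (\<Sum>i\<le>n. step_mass source (Suc i) w)"
    by (rule sum.atMost_Suc_shift)
  also have "(\<Sum>i\<le>n. step_mass source (Suc i) w) =
      (\<Sum>e\<in>in_arcs G w. (\<Sum>i\<le>n. step_mass source i (tail G e)) / out_degree G (tail G e))"
    unfolding step_mass_Suc[OF Suc.prems] by (subst sum.swap) (simp add: sum_divide_distrib)
  also have "\<dots> \<le> (\<Sum>e\<in>in_arcs G w. 1)"
    using Suc.IH out_degree_pos by (intro sum_mono) (auto simp: divide_le_eq_1)
  finally have "(\<Sum>i\<le>Suc n. step_mass source i w) \<le> step_mass source 0 w + in_degree G w"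
    by (simp add: in_degree_def)
  also have "\<dots> \<le> out_degree G w"
    using balanced[OF Suc.prems] balanced_source Suc.prems by (auto simp: step_mass_0)
  finally show ?case .
qed

text \<open>
  With positive probability the walk from the source starts with \<open>p\<close>, and then continues as a walk from
  \<open>u\<close>.
\<close>

lemma summable_step_mass:
  assumes p: "awalk source p u" and w: "w \<in> verts G"
  shows "summable (\<lambda>n. step_mass u n w)"
proof (rule bounded_imp_summable)
  fix n
  have ge: "walk_weight p * step_mass u i w \<le> step_mass source (length p + i) w" for i
  proof -
    have "walk_weight p * step_mass u i w = (\<Sum>q\<in>walks_to u i w. walk_weight (p @ q))"
      by (simp add: step_mass_def sum_distrib_left)
    also have "\<dots> = (\<Sum>r\<in>(@) p ` walks_to u i w. walk_weight r)"
      by (subst sum.reindex) (auto simp: inj_on_def)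
    also have "\<dots> \<le> step_mass source (length p + i) w"
      unfolding step_mass_def using p
      by (intro sum_mono2 finite_walks_to[OF w]) (auto simp: walks_to_def)
    finally show ?thesis .
  qed
  have "walk_weight p * (\<Sum>i\<le>n. step_mass u i w) \<le> (\<Sum>i\<le>n. step_mass source (length p + i) w)"
    unfolding sum_distrib_left by (intro sum_mono ge)
  also have "\<dots> = (\<Sum>i\<in>(+) (length p) ` {..n}. step_mass source i w)"
    by (subst sum.reindex) auto
  also have "\<dots> \<le> (\<Sum>i\<le>length p + n. step_mass source i w)"
    by (intro sum_mono2) (auto simp: step_mass_nonneg)
  also have "\<dots> \<le> out_degree G w" by (rule expected_visits_from_source[OF w])
  finally show "(\<Sum>i\<le>n. step_mass u i w) \<le> out_degree G w / walk_weight p"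
    using walk_weight_pos[OF p] by (simp add: pos_le_divide_eq mult.commute)
qed (rule step_mass_nonneg)

definition walks_from :: "'v \<Rightarrow> nat \<Rightarrow> 'e list set" where
  "walks_from u n = {p. length p = n \<and> (\<exists>w. awalk u p w)}"

lemma walks_from_Suc:
  "bij_betw (\<lambda>(e, p). e # p) (SIGMA e:out_arcs G u. walks_from (head G e) n) (walks_from u (Suc n))"
proof (rule bij_betwI')
  fix x y
  show "(case x of (e, p) \<Rightarrow> e # p) = (case y of (e, p) \<Rightarrow> e # p) \<longleftrightarrow> x = y"
    by (cases x; cases y) auto
next
  fix x assume "x \<in> (SIGMA e:out_arcs G u. walks_from (head G e) n)"
  then show "(case x of (e, p) \<Rightarrow> e # p) \<in> walks_from u (Suc n)"
    by (auto simp: walks_from_def awalk_simps)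
next
  fix q assume q: "q \<in> walks_from u (Suc n)"
  then obtain e p where ep: "q = e # p" by (cases q) (auto simp: walks_from_def)
  have e: "e \<in> out_arcs G u" and p: "p \<in> walks_from (head G e) n"
    using q unfolding ep walks_from_def by (auto simp: awalk_simps)
  then show "\<exists>x\<in>(SIGMA e:out_arcs G u. walks_from (head G e) n). q = (case x of (e, p) \<Rightarrow> e # p)"
    unfolding ep by (intro bexI[of _ "(e, p)"]) auto
qed

lemma finite_walks_from: "u \<in> verts G \<Longrightarrow> finite (walks_from u n)"
proof (induction n arbitrary: u)
  case 0
  have "walks_from u 0 \<subseteq> {[]}" by (auto simp: walks_from_def)
  then show ?case by (rule finite_subset) simp
next
  case (Suc n)
  have "finite (SIGMA e:out_arcs G u. walks_from (head G e) n)"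
    using Suc finite_out by (intro finite_SigmaI) auto
  then show ?case using bij_betw_finite[OF walks_from_Suc] by blast
qed

lemma sum_walk_weight: "u \<in> verts G \<Longrightarrow> (\<Sum>p\<in>walks_from u n. walk_weight p) = 1"
proof (induction n arbitrary: u)
  case 0
  have "walks_from u 0 = {[]}" using 0 by (auto simp: walks_from_def awalk_simps)
  then show ?case by simp
next
  case (Suc n)
  have "(\<Sum>p\<in>walks_from u (Suc n). walk_weight p) =
      (\<Sum>(e, p)\<in>(SIGMA e:out_arcs G u. walks_from (head G e) n). walk_weight (e # p))"
    by (subst sum.reindex_bij_betw[OF walks_from_Suc, symmetric]) (simp add: case_prod_unfold)
  also have "\<dots> = (\<Sum>e\<in>out_arcs G u. \<Sum>p\<in>walks_from (head G e) n. walk_weight (e # p))"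
    using finite_out[OF Suc.prems] finite_walks_from by (subst sum.Sigma) auto
  also have "\<dots> = (\<Sum>e\<in>out_arcs G u. 1 / out_degree G u)"
  proof (rule sum.cong[OF refl])
    fix e assume e: "e \<in> out_arcs G u"
    then have "(\<Sum>p\<in>walks_from (head G e) n. walk_weight (e # p)) =
        1 / out_degree G u * (\<Sum>p\<in>walks_from (head G e) n. walk_weight p)"
      by (simp add: sum_distrib_left)
    then show "(\<Sum>p\<in>walks_from (head G e) n. walk_weight (e # p)) = 1 / out_degree G u"
      using Suc.IH[of "head G e"] e by simp
  qed
  also have "\<dots> = 1" using out_degree_pos[OF Suc.prems] by (simp add: out_degree_def)
  finally show ?case .
qed

definition transient_from :: "'v \<Rightarrow> ('v, 'e) dpath \<Rightarrow> bool" where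
  "transient_from u \<gamma> \<longleftrightarrow> \<gamma> \<in> paths G \<and> fst \<gamma> = u \<and> infinite_path \<gamma> \<and>
     (\<forall>w\<in>verts G. finite {n. path_vertex G \<gamma> n = Some w})"

text \<open>
  The walk stopped on leaving \<open>C\<close>. On a path that never leaves \<open>C\<close> the value is arbitrary; transient paths
  leave every finite set.
\<close>

definition exit_prefix :: "'v set \<Rightarrow> ('v, 'e) dpath \<Rightarrow> 'e list" where
  "exit_prefix C \<gamma> = path_prefix (LEAST n. path_vertex G \<gamma> n \<notin> Some ` C) \<gamma>"

lemma path_vertex_in_verts:
  assumes "\<gamma> \<in> paths G" "path_vertex G \<gamma> n = Some w"
  shows "w \<in> verts G"
proof (cases n)
  case 0 then show ?thesis using assms by (auto simp: paths_def)
next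
  case (Suc m)
  then obtain e where "snd \<gamma> m = Some e" "w = head G e" using assms(2) by auto
  then show ?thesis using path_arc(1)[OF assms(1)] by auto
qed

lemma path_vertex_infinite:
  assumes "\<gamma> \<in> paths G" "infinite_path \<gamma>"
  shows "\<exists>w\<in>verts G. path_vertex G \<gamma> n = Some w"
proof -
  obtain e where "snd \<gamma> n = Some e" using assms(2) by (auto simp: infinite_path_def)
  from path_arc[OF assms(1) this] show ?thesis by auto
qed

lemma transient_exits:
  assumes g: "transient_from u \<gamma>" and C: "finite C"
  shows "\<exists>n. path_vertex G \<gamma> n \<notin> Some ` C"
proof (rule ccontr)
  assume "\<not> ?thesis"
  then have "UNIV = (\<Union>w\<in>C. {n. path_vertex G \<gamma> n = Some w})" by auto
  moreover have "(\<Union>w\<in>C. {n. path_vertex G \<gamma> n = Some w}) \<subseteq>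
      (\<Union>w\<in>C \<inter> verts G. {n. path_vertex G \<gamma> n = Some w})"
    using path_vertex_in_verts[of \<gamma>] g unfolding transient_from_def by blast
  moreover have "finite (\<Union>w\<in>C \<inter> verts G. {n. path_vertex G \<gamma> n = Some w})"
    using C g by (auto simp: transient_from_def)
  ultimately have "finite (UNIV :: nat set)" by (metis finite_subset)
  then show False by simp
qed

lemma exit_prefix_walk:
  assumes g: "transient_from u \<gamma>" and C: "finite C"
  shows "exit_walk C u (exit_prefix C \<gamma>)" "starts_with (exit_prefix C \<gamma>) \<gamma>"
proof -
  let ?n = "LEAST n. path_vertex G \<gamma> n \<notin> Some ` C"
  have gp: "\<gamma> \<in> paths G" "fst \<gamma> = u" "\<And>i. snd \<gamma> i \<noteq> None"
    using g by (auto simp: transient_from_def infinite_path_def)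
  show sw: "starts_with (exit_prefix C \<gamma>) \<gamma>" by (auto simp: exit_prefix_def starts_with_iff gp)
  have aw: "awalk u (exit_prefix C \<gamma>) (the (path_vertex G \<gamma> ?n))"
    using starts_with_awalk[OF gp(1) sw] gp(2) by (simp add: exit_prefix_def)
  have out: "path_vertex G \<gamma> ?n \<notin> Some ` C"
    by (rule LeastI_ex) (rule transient_exits[OF g C])
  obtain w where "path_vertex G \<gamma> ?n = Some w"
    using path_vertex_infinite[OF gp(1)] g by (auto simp: transient_from_def)
  moreover have "tail G e \<in> C" if "e \<in> set (exit_prefix C \<gamma>)" for e
  proof -
    obtain i where i: "i < ?n" "e = the (snd \<gamma> i)"
      using \<open>e \<in> set (exit_prefix C \<gamma>)\<close> by (auto simp: exit_prefix_def path_prefix_def)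
    then have "snd \<gamma> i = Some e" using gp(3)[of i] by auto
    then have "path_vertex G \<gamma> i = Some (tail G e)" by (rule path_arc(2)[OF gp(1)])
    moreover have "path_vertex G \<gamma> i \<in> Some ` C" using not_less_Least[OF i(1)] by blast
    ultimately show ?thesis by auto
  qed
  ultimately show "exit_walk C u (exit_prefix C \<gamma>)"
    using aw out by (auto simp: exit_walk_def)
qed

lemma exit_walk_prefix_unique:
  "exit_walk C u p \<Longrightarrow> exit_walk C u q \<Longrightarrow> starts_with p \<gamma> \<Longrightarrow> starts_with q \<gamma> \<Longrightarrow> p = q"
proof -
  have aux: "p = q" if p: "exit_walk C u p" and q: "exit_walk C u q" and
    sw: "starts_with p \<gamma>" "starts_with q \<gamma>" and len: "length p \<le> length q" for p q
  proof -
    have "p = take (length p) q"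
      using sw len by (auto simp: starts_with_def list_eq_iff_nth_eq)
    then obtain r where r: "q = p @ r" by (metis append_take_drop_id)
    obtain v where v: "awalk u p v" "v \<notin> C" using p by (auto simp: exit_walk_def)
    have "r = []"
    proof (cases r)
      case (Cons e r')
      obtain w where w: "awalk u (p @ e # r') w" "tail G e \<in> C"
        using q by (auto simp: exit_walk_def r Cons)
      then have "awalk u p (tail G e)" by (auto simp: awalk_simps)
      then have "tail G e = v" using v(1) cas_end_unique by (auto simp: awalk_def)
      then show ?thesis using v(2) w(2) by simp
    qed
    then show ?thesis using r by simp
  qed
  assume "exit_walk C u p" "exit_walk C u q" "starts_with p \<gamma>" "starts_with q \<gamma>"
  then show "p = q" using aux[of p q] aux[of q p] by (cases "length p \<le> length q") auto
qed

text \<open>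
  The event that the walk stopped on leaving \<open>C\<close> has loop-erasure \<open>g\<close>, as a countable union of cylinders.
\<close>

definition erasure_set :: "'v set \<Rightarrow> 'v \<Rightarrow> 'e list \<Rightarrow> ('v, 'e) dpath set" where
  "erasure_set C u g = (\<Union>p\<in>{p. exit_walk C u p \<and> list_loop_erasure p = g}.
     {\<gamma> \<in> space (path_space G). starts_with p \<gamma> \<and> fst \<gamma> = u})"

lemma countable_exit_walks: "countable {p. exit_walk C u p \<and> P p}"
  by (rule countable_subset[OF _ countable_arc_lists]) (auto simp: exit_walk_def)

lemma path_cylinder_measurable: "{\<gamma> \<in> space (path_space G). starts_with p \<gamma> \<and> fst \<gamma> = u} \<in> sets (path_space G)"
proof -
  have "Measurable.pred (path_space G) (\<lambda>\<gamma>. fst \<gamma> = u)"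
    by (rule measurable_compose[OF measurable_path_fst_UNIV]) simp
  with measurable_starts_with[of p] have "Measurable.pred (path_space G) (\<lambda>\<gamma>. starts_with p \<gamma> \<and> fst \<gamma> = u)"
    by (intro pred_intros_logic)
  then show ?thesis by (simp add: pred_def)
qed

lemma erasure_set_measurable: "erasure_set C u g \<in> sets (path_space G)"
  unfolding erasure_set_def using path_cylinder_measurable countable_exit_walks
  by (intro sets.countable_UN') auto

lemma erasure_set_exit_prefix:
  assumes "transient_from u \<gamma>" "finite C" "\<gamma> \<in> erasure_set C u g"
  shows "list_loop_erasure (exit_prefix C \<gamma>) = g"
proof -
  obtain p where p: "exit_walk C u p" "list_loop_erasure p = g" "starts_with p \<gamma>"
    using assms(3) by (auto simp: erasure_set_def)
  have "exit_prefix C \<gamma> = p"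
    using exit_walk_prefix_unique[OF exit_prefix_walk(1)[OF assms(1,2)] p(1) exit_prefix_walk(2)[OF assms(1,2)] p(3)] .
  then show ?thesis using p(2) by simp
qed

end

locale digraph_random_walk = infinite_sourced_eulerian_digraph G source + prob_space M
  for G :: "('v, 'e) pre_digraph" and source :: 'v and M :: "'w measure" +
  fixes u :: 'v and W :: "'w \<Rightarrow> ('v, 'e) dpath"
  assumes walk: "random_walk G u M W" and u: "u \<in> verts G"
    and reachable: "\<exists>p. awalk source p u"
begin

lemma W_measurable: "W \<in> measurable M (path_space G)"
  using walk by (simp add: random_walk_def)

lemma W_path: "\<omega> \<in> space M \<Longrightarrow> W \<omega> \<in> paths G"
  using measurable_space[OF W_measurable] by (simp add: space_path_space)

lemma AE_start: "AE \<omega> in M. fst (W \<omega>) = u"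
  using walk by (simp add: random_walk_def)

abbreviation start_event :: "'e list \<Rightarrow> 'w set" where
  "start_event p \<equiv> {\<omega> \<in> space M. starts_with p (W \<omega>) \<and> fst (W \<omega>) = u}"

lemma start_event_vimage:
  "start_event p = W -` {\<gamma> \<in> space (path_space G). starts_with p \<gamma> \<and> fst \<gamma> = u} \<inter> space M"
  using W_path by (auto simp: space_path_space)

lemma start_event_measurable: "start_event p \<in> events"
  unfolding start_event_vimage by (rule measurable_sets[OF W_measurable path_cylinder_measurable])

lemma prob_start_event: "awalk u p x \<Longrightarrow> prob (start_event p) = walk_weight p"
proof (induction p arbitrary: x rule: rev_induct)
  case Nil
  have "prob (start_event []) = prob (space M)"
    using AE_start start_event_measurable[of "[]"]
    by (intro finite_measure_eq_AE) (auto simp: starts_with_def)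
  then show ?case by (simp add: prob_space)
next
  case (snoc e p)
  have p: "awalk u p (tail G e)" and e: "e \<in> out_arcs G (tail G e)"
    using snoc.prems by (auto simp: awalk_simps)
  have IH: "prob (start_event p) = walk_weight p" by (rule snoc.IH[OF p])
  have vertex: "path_vertex G (W \<omega>) (length p) = Some (tail G e)"
    if "\<omega> \<in> start_event p" for \<omega>
    using that W_path p by (intro starts_with_vertex) (auto simp: awalk_def)
  have ev: "{\<omega> \<in> space M. starts_with p (W \<omega>) \<and> fst (W \<omega>) = u \<and>
      path_vertex G (W \<omega>) (length p) = Some (tail G e)} = start_event p"
    using vertex by auto
  have ev2: "{\<omega> \<in> space M. snd (W \<omega>) (length p) = Some e \<and> starts_with p (W \<omega>) \<and> fst (W \<omega>) = u \<and>
      path_vertex G (W \<omega>) (length p) = Some (tail G e)} = start_event (p @ [e])"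
    using vertex by (auto simp: starts_with_append1)
  have "prob (start_event (p @ [e])) / prob (start_event p) = 1 / real (out_degree G (tail G e))"
  proof -
    have "\<forall>p x e. e \<in> out_arcs G x \<longrightarrow>
        prob {\<omega> \<in> space M. starts_with p (W \<omega>) \<and> fst (W \<omega>) = u \<and>
          path_vertex G (W \<omega>) (length p) = Some x} \<noteq> 0 \<longrightarrow>
        cond_prob M (\<lambda>\<omega>. snd (W \<omega>) (length p) = Some e)
          (\<lambda>\<omega>. starts_with p (W \<omega>) \<and> fst (W \<omega>) = u \<and> path_vertex G (W \<omega>) (length p) = Some x) =
        1 / real (out_degree G x)"
      using walk unfolding random_walk_def by blast
    from this[THEN spec[of _ p], THEN spec[of _ "tail G e"], THEN spec[of _ e]] e
    have "prob (start_event p) \<noteq> 0 \<longrightarrow>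
        cond_prob M (\<lambda>\<omega>. snd (W \<omega>) (length p) = Some e)
          (\<lambda>\<omega>. starts_with p (W \<omega>) \<and> fst (W \<omega>) = u \<and> path_vertex G (W \<omega>) (length p) = Some (tail G e)) =
        1 / real (out_degree G (tail G e))"
      unfolding ev by blast
    then show ?thesis
      using IH walk_weight_pos[OF p] unfolding cond_prob_def ev ev2 by simp
  qed
  then show ?case using IH walk_weight_pos[OF p] by (simp add: field_simps)
qed

lemma prob_UN_start_events:
  assumes "finite P" "\<And>p. p \<in> P \<Longrightarrow> \<exists>x. awalk u p x" "\<And>p q \<omega>. p \<in> P \<Longrightarrow> q \<in> P \<Longrightarrow>
    starts_with p (W \<omega>) \<Longrightarrow> starts_with q (W \<omega>) \<Longrightarrow> p = q"
  shows "prob (\<Union>p\<in>P. start_event p) = (\<Sum>p\<in>P. walk_weight p)"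
proof -
  have "prob (\<Union>p\<in>P. start_event p) = (\<Sum>p\<in>P. prob (start_event p))"
  proof (rule finite_measure_finite_Union[OF assms(1)])
    show "disjoint_family_on start_event P"
      using assms(3) unfolding disjoint_family_on_def by blast
  qed (use start_event_measurable in blast)
  also have "\<dots> = (\<Sum>p\<in>P. walk_weight p)"
    using assms(2) prob_start_event by (intro sum.cong) blast+
  finally show ?thesis .
qed

lemma AE_starts_with_walk: "AE \<omega> in M. \<exists>p\<in>walks_from u n. \<omega> \<in> start_event p"
proof -
  have "prob (\<Union>p\<in>walks_from u n. start_event p) = 1"
  proof (subst prob_UN_start_events)
    show "(\<Sum>p\<in>walks_from u n. walk_weight p) = 1" by (rule sum_walk_weight[OF u])
  qed (auto simp: walks_from_def intro: starts_with_same_length finite_walks_from[OF u, unfolded walks_from_def])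
  moreover have "(\<Union>p\<in>walks_from u n. start_event p) \<in> events"
    using start_event_measurable finite_walks_from[OF u] by (intro sets.finite_UN) auto
  ultimately have "AE \<omega> in M. \<omega> \<in> (\<Union>p\<in>walks_from u n. start_event p)"
    by (simp add: prob_eq_1)
  then show ?thesis by eventually_elim blast
qed

lemma AE_infinite: "AE \<omega> in M. infinite_path (W \<omega>)"
proof -
  have "AE \<omega> in M. \<forall>n. \<exists>p\<in>walks_from u n. \<omega> \<in> start_event p"
    by (subst AE_all_countable) (use AE_starts_with_walk in blast)
  then show ?thesis
  proof eventually_elim
    case (elim \<omega>)
    have "snd (W \<omega>) n \<noteq> None" for n
    proof -
      obtain p where "p \<in> walks_from u (Suc n)" "starts_with p (W \<omega>)" using elim by blast
      then show ?thesis by (auto simp: walks_from_def starts_with_def)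
    qed
    then show ?case by (simp add: infinite_path_def)
  qed
qed

text \<open>
  Borel--Cantelli: the expected number of visits is finite.
\<close>

lemma AE_finitely_many_visits:
  assumes w: "w \<in> verts G"
  shows "AE \<omega> in M. finite {n. path_vertex G (W \<omega>) n = Some w}"
proof -
  obtain p0 where p0: "awalk source p0 u" using reachable by blast
  define A where "A n = (\<Union>p\<in>walks_to u n w. start_event p)" for n
  have A_ev: "A n \<in> events" for n
    unfolding A_def using start_event_measurable finite_walks_to[OF w] by (intro sets.finite_UN) auto
  have "prob (A n) = step_mass u n w" for n
    unfolding A_def step_mass_def
    by (intro prob_UN_start_events finite_walks_to[OF w]) (auto simp: walks_to_def intro: starts_with_same_length)
  then have "summable (\<lambda>n. prob (A n))" using summable_step_mass[OF p0 w] by simp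
  then have "AE \<omega> in M. \<forall>\<^sub>F n in sequentially. \<omega> \<in> space M - A n"
    using A_ev by (intro borel_cantelli_AE1) (auto simp: emeasure_eq_measure)
  moreover have "AE \<omega> in M. \<forall>n. \<exists>p\<in>walks_from u n. \<omega> \<in> start_event p"
    by (subst AE_all_countable) (use AE_starts_with_walk in blast)
  ultimately show ?thesis
  proof eventually_elim
    case (elim \<omega>)
    have "\<omega> \<in> A n" if n: "path_vertex G (W \<omega>) n = Some w" for n
    proof -
      obtain p where p: "p \<in> walks_from u n" "\<omega> \<in> start_event p" using elim(2) by blast
      then obtain x where x: "awalk u p x" by (auto simp: walks_from_def)
      have "path_vertex G (W \<omega>) (length p) = Some x"
        using p x W_path by (intro starts_with_vertex) (auto simp: awalk_def)
      then have "x = w" using n p(1) by (auto simp: walks_from_def)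
      then show ?thesis using p x by (auto simp: A_def walks_to_def walks_from_def)
    qed
    then have sub: "{n. path_vertex G (W \<omega>) n = Some w} \<subseteq> {n. \<not> (\<omega> \<in> space M - A n)}" by blast
    obtain N where N: "\<And>n. n \<ge> N \<Longrightarrow> \<omega> \<in> space M - A n"
      using elim(1) unfolding eventually_sequentially by blast
    then have "{n. \<not> (\<omega> \<in> space M - A n)} \<subseteq> {..<N}"
      using N by (intro subsetI) (auto simp: not_le[symmetric])
    with sub show ?case by (meson finite_lessThan finite_subset)
  qed
qed

lemma AE_transient: "AE \<omega> in M. transient_from u (W \<omega>)"
proof -
  have "AE \<omega> in M. \<forall>w\<in>verts G. finite {n. path_vertex G (W \<omega>) n = Some w}"
    by (subst AE_ball_countable[OF countable_verts]) (use AE_finitely_many_visits in blast)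
  with AE_infinite AE_start AE_space show ?thesis
    by eventually_elim (auto simp: transient_from_def W_path)
qed

lemma emeasure_exit_walks:
  "emeasure M (\<Union>p\<in>{p. exit_walk C u p \<and> P p}. start_event p) =
     (\<integral>\<^sup>+p. walk_weight p \<partial>count_space {p. exit_walk C u p \<and> P p})"
proof -
  have "emeasure M (\<Union>p\<in>{p. exit_walk C u p \<and> P p}. start_event p) =
     (\<integral>\<^sup>+p. emeasure M (start_event p) \<partial>count_space {p. exit_walk C u p \<and> P p})"
  proof (rule emeasure_UN_countable)
    show "disjoint_family_on start_event {p. exit_walk C u p \<and> P p}"
      using exit_walk_prefix_unique unfolding disjoint_family_on_def by blast
  qed (use start_event_measurable countable_exit_walks in auto)
  also have "\<dots> = (\<integral>\<^sup>+p. walk_weight p \<partial>count_space {p. exit_walk C u p \<and> P p})"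
    using prob_start_event by (intro nn_integral_cong) (auto simp: emeasure_eq_measure exit_walk_def)
  finally show ?thesis .
qed

text \<open>
  A transient walk leaves every finite set.
\<close>

lemma exit_weights_sum:
  assumes "finite C"
  shows "(\<integral>\<^sup>+p. walk_weight p \<partial>count_space {p. exit_walk C u p}) = 1"
proof -
  let ?E = "\<Union>p\<in>{p. exit_walk C u p \<and> True}. start_event p"
  have ev: "?E \<in> events"
    by (intro sets.countable_UN' countable_exit_walks) (use start_event_measurable in auto)
  have "AE \<omega> in M. \<omega> \<in> ?E"
    using AE_transient AE_space
  proof eventually_elim
    case (elim \<omega>)
    then show ?case
      using exit_prefix_walk[OF elim(1) assms] by (auto simp: transient_from_def)
  qed
  then have "emeasure M ?E = 1" using ev by (simp add: emeasure_eq_1_AE)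
  then show ?thesis unfolding emeasure_exit_walks by simp
qed

lemma emeasure_erasure_set:
  "emeasure M (W -` erasure_set C u g \<inter> space M) = erasure_mass C u g"
proof -
  have "W -` erasure_set C u g \<inter> space M =
      (\<Union>p\<in>{p. exit_walk C u p \<and> list_loop_erasure p = g}. start_event p)"
    using W_path by (auto simp: erasure_set_def space_path_space)
  then show ?thesis unfolding erasure_mass_def emeasure_exit_walks[symmetric] by simp
qed

end

section \<open>Wilson's algorithm on a finite set of vertices\<close>

context pre_digraph
begin

text \<open>
  The path in the forest \<open>f\<close> from \<open>v\<close> out of \<open>C\<close>.
\<close>

definition forest_path :: "('a \<Rightarrow> 'b) \<Rightarrow> 'a set \<Rightarrow> 'a \<Rightarrow> 'b list" where
  "forest_path f C v = (SOME g. g \<in> simple_exits C v \<and> (\<forall>e\<in>set g. f (tail G e) = e))"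

text \<open>
  The arcs that Wilson's algorithm on \<open>B\<close> has found after \<open>j\<close> walks if its final output is \<open>f\<close>. This does
  not depend on chance.
\<close>

primrec forest_stage :: "('a \<Rightarrow> 'b) \<Rightarrow> (nat \<Rightarrow> 'a) \<Rightarrow> 'a set \<Rightarrow> nat \<Rightarrow> 'b set" where
  "forest_stage f vs B 0 = {}"
| "forest_stage f vs B (Suc j) =
     forest_stage f vs B j \<union> set (forest_path f (B - tail G ` forest_stage f vs B j) (vs j))"

end

context infinite_sourced_eulerian_digraph
begin

text \<open>
  Wilson's algorithm on \<open>B\<close> rooted at the complement of \<open>B\<close>. The vertices reached so far are the tails of
  the arcs found so far, and the next walk is stopped on leaving the rest of \<open>B\<close>.
\<close>

primrec finite_wilson :: "(nat \<Rightarrow> ('v, 'e) dpath) \<Rightarrow> 'v set \<Rightarrow> nat \<Rightarrow> 'e set" where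
  "finite_wilson w B 0 = {}"
| "finite_wilson w B (Suc j) = finite_wilson w B j \<union>
     set (list_loop_erasure (exit_prefix (B - tail G ` finite_wilson w B j) (w j)))"

lemma forest_path:
  assumes "f \<in> forests B" "C \<subseteq> B" "v \<in> verts G"
  shows "forest_path f C v \<in> simple_exits C v" "\<And>e. e \<in> set (forest_path f C v) \<Longrightarrow> f (tail G e) = e"
proof -
  have "escapes f B v" using assms(1) by (cases "v \<in> B") (auto simp: forests_def intro: escapes.outside)
  from escapes_subset[OF this assms(2)] have "escapes (restrict f C) C v"
    using escapes_cong[of C f "restrict f C"] by simp
  moreover have "restrict f C \<in> PiE C (out_arcs G)" using forests_restrict[OF assms(1,2)] by (simp add: forests_def)
  ultimately obtain g where g: "g \<in> simple_exits C v" "\<forall>e\<in>set g. restrict f C (tail G e) = e"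
    using escapes_exit_path assms(3) by blast
  have "tail G e \<in> C" if "e \<in> set g" for e using g(1) that by (auto simp: simple_exits_def exit_walk_def)
  then have "\<exists>g. g \<in> simple_exits C v \<and> (\<forall>e\<in>set g. f (tail G e) = e)" using g by force
  from someI_ex[OF this] show "forest_path f C v \<in> simple_exits C v"
    "\<And>e. e \<in> set (forest_path f C v) \<Longrightarrow> f (tail G e) = e"
    by (auto simp: forest_path_def)
qed

lemma tail_in_simple_exits: "g \<in> simple_exits C v \<Longrightarrow> e \<in> set g \<Longrightarrow> tail G e \<in> C"
  by (auto simp: simple_exits_def exit_walk_def)

lemma start_in_simple_exits: "g \<in> simple_exits C v \<Longrightarrow> v \<in> C \<Longrightarrow> v \<in> tail G ` set g"
  by (cases g) (auto simp: simple_exits_def)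

lemma forest_stage_arcs:
  assumes f: "f \<in> forests B" and vs: "range vs \<subseteq> verts G"
  shows "e \<in> forest_stage f vs B j \<Longrightarrow> tail G e \<in> B \<and> f (tail G e) = e"
proof (induction j)
  case (Suc j)
  let ?C = "B - tail G ` forest_stage f vs B j"
  have "?C \<subseteq> B" "vs j \<in> verts G" using vs by auto
  note fp = forest_path[OF f this]
  show ?case using Suc fp(2) tail_in_simple_exits[OF fp(1)] by auto
qed simp

lemma forest_stage_complete:
  assumes f: "f \<in> forests B" and vs: "range vs \<subseteq> verts G" and B: "B \<subseteq> vs ` {..<m}"
  shows "forest_stage f vs B m = f ` B"
proof
  show "forest_stage f vs B m \<subseteq> f ` B"
    using forest_stage_arcs[OF f vs] by force
  have mono: "forest_stage f vs B i \<subseteq> forest_stage f vs B j" if "i \<le> j" for i j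
    using that by (induction rule: dec_induct) auto
  show "f ` B \<subseteq> forest_stage f vs B m"
  proof
    fix e assume "e \<in> f ` B"
    then obtain v where v: "v \<in> B" "e = f v" by blast
    then obtain j where j: "j < m" "v = vs j" using B by blast
    have "v \<in> tail G ` forest_stage f vs B (Suc j)"
    proof (cases "v \<in> tail G ` forest_stage f vs B j")
      case False
      let ?C = "B - tail G ` forest_stage f vs B j"
      have "?C \<subseteq> B" "vs j \<in> verts G" using vs by auto
      from start_in_simple_exits[OF forest_path(1)[OF f this]] False v(1) j(2)
      show ?thesis by auto
    qed auto
    then obtain e' where "e' \<in> forest_stage f vs B (Suc j)" "tail G e' = v" by auto
    then have "e' \<in> forest_stage f vs B m" "f v = e'"
      using mono[of "Suc j" m] j(1) forest_stage_arcs[OF f vs] by auto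
    then show "e \<in> forest_stage f vs B m" using v(2) by simp
  qed
qed

lemma finite_wilson_new_tail:
  assumes w: "\<And>j. transient_from (vs j) (w j)" and B: "finite B" and le: "i \<le> j"
    and e: "e \<in> finite_wilson w B j" "tail G e \<in> tail G ` finite_wilson w B i"
  shows "e \<in> finite_wilson w B i"
  using le e(1)
proof (induction rule: dec_induct)
  case (step n)
  let ?C = "B - tail G ` finite_wilson w B n"
  have mono: "finite_wilson w B i \<subseteq> finite_wilson w B n"
    using step.hyps(1) by (induction rule: dec_induct) auto
  have "finite ?C" using B by simp
  from list_loop_erasure_simple_exit[OF exit_prefix_walk(1)[OF w this, of n]]
  have "tail G e \<notin> tail G ` finite_wilson w B n"
    if "e \<in> set (list_loop_erasure (exit_prefix ?C (w n)))"
    using tail_in_simple_exits that by blast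
  then show ?case using step e(2) mono by auto
qed

lemma finite_wilson_start:
  assumes w: "\<And>j. transient_from (vs j) (w j)" and B: "finite B" "vs j \<in> B" and "j < m"
  shows "vs j \<in> tail G ` finite_wilson w B m"
proof -
  have mono: "finite_wilson w B (Suc j) \<subseteq> finite_wilson w B m"
    using Suc_leI[OF \<open>j < m\<close>] by (induction rule: dec_induct) auto
  let ?C = "B - tail G ` finite_wilson w B j"
  have "vs j \<in> tail G ` finite_wilson w B (Suc j)"
  proof (cases "vs j \<in> tail G ` finite_wilson w B j")
    case False
    have "finite ?C" using B by simp
    from start_in_simple_exits[OF list_loop_erasure_simple_exit[OF exit_prefix_walk(1)[OF w this, of j]]]
    show ?thesis using False B(2) by auto
  qed auto
  then show ?thesis using mono by blast
qed

end

text \<open>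
  The ray ensures that every vertex can be reached from the source, which makes the walks transient, and
  that there are forests on every finite set of vertices.
\<close>

locale wilson_walks = infinite_sourced_eulerian_digraph G source + prob_space M
  for G :: "('v, 'e) pre_digraph" and source :: 'v and M :: "'w measure" +
  fixes vs :: "nat \<Rightarrow> 'v" and W :: "nat \<Rightarrow> 'w \<Rightarrow> ('v, 'e) dpath"
  assumes vs: "bij_betw vs UNIV (verts G)"
    and walks: "\<And>j. random_walk G (vs j) M (W j)"
    and indep: "indep_vars (\<lambda>_. path_space G) W UNIV"
    and ray_exists: "\<exists>X. eulerian_ray X"
begin

lemma range_vs: "range vs = verts G"
  using vs by (simp add: bij_betw_def)

sublocale walk: digraph_random_walk G source M "vs j" "W j" for j
proof unfold_locales
  show v: "vs j \<in> verts G" using range_vs by auto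
  obtain X where "eulerian_ray X" using ray_exists by blast
  then interpret digraph_eulerian_ray G source X by unfold_locales
  show "\<exists>p. awalk source p (vs j)" by (rule source_reaches[OF v])
qed (rule walks)

lemma card_forests_pos: "finite C \<Longrightarrow> C \<subseteq> verts G \<Longrightarrow> card (forests C) > 0"
  using forests_nonempty[OF ray_exists] finite_forests by (simp add: card_gt_0_iff)

lemma prob_erasure:
  assumes "finite C" "C \<subseteq> verts G" "g \<in> simple_exits C (vs j)"
  shows "prob (W j -` erasure_set C (vs j) g \<inter> space M) =
         card (forests (C - tail G ` set g)) / card (forests C)"
proof -
  have "emeasure M (W j -` erasure_set C (vs j) g \<inter> space M) =
      ennreal (card (forests (C - tail G ` set g)) / card (forests C))"
    unfolding walk.emeasure_erasure_set
  proof (rule erasure_mass_forests[OF assms(1,2) _ _ assms(3)])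
    fix C :: "'v set" and u assume "finite C" "u \<in> verts G"
    then show "(\<integral>\<^sup>+p. walk_weight p \<partial>count_space {p. exit_walk C u p}) = 1"
      using walk.exit_weights_sum range_vs by (metis rangeE)
  qed (rule forests_nonempty[OF ray_exists])
  then show ?thesis by (simp add: emeasure_eq_measure)
qed

text \<open>
  The event that the algorithm on \<open>B\<close> produces \<open>f\<close>, in a form to which independence applies: the region
  in which the \<open>j\<close>-th walk is run and its required erasure are fixed by \<open>f\<close>.
\<close>

definition forest_event :: "('v \<Rightarrow> 'e) \<Rightarrow> 'v set \<Rightarrow> nat \<Rightarrow> 'w set" where
  "forest_event f B m = {\<omega> \<in> space M. \<forall>j<m. W j \<omega> \<in>
     erasure_set (B - tail G ` forest_stage f vs B j) (vs j)
       (forest_path f (B - tail G ` forest_stage f vs B j) (vs j))}"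

lemma erasure_vimage_measurable: "W j -` erasure_set C u g \<inter> space M \<in> events"
  by (rule measurable_sets[OF walk.W_measurable erasure_set_measurable])

lemma forest_event_measurable: "forest_event f B m \<in> events"
proof (induction m)
  case 0 then show ?case by (simp add: forest_event_def)
next
  case (Suc m)
  have "forest_event f B (Suc m) = forest_event f B m \<inter>
     (W m -` erasure_set (B - tail G ` forest_stage f vs B m) (vs m)
       (forest_path f (B - tail G ` forest_stage f vs B m) (vs m)) \<inter> space M)"
    by (auto simp: forest_event_def less_Suc_eq)
  then show ?case using Suc erasure_vimage_measurable by (metis sets.Int)
qed

text \<open>
  By independence this is the product over the walks of the quotients \<open>N (C (Suc j)) / N (C j)\<close>, where
  \<open>C j\<close> is the part of \<open>B\<close> that \<open>forest_stage\<close> has left after \<open>j\<close> walks and \<open>N\<close> counts forests. The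
  product telescopes, from \<open>C 0 = B\<close> to \<open>C m = {}\<close>.
\<close>

lemma prob_forest_event:
  assumes B: "finite B" "B \<subseteq> verts G" "B \<subseteq> vs ` {..<m}" and f: "f \<in> forests B"
  shows "prob (forest_event f B m) = 1 / card (forests B)"
proof -
  define C where "C j = B - tail G ` forest_stage f vs B j" for j
  define g where "g j = forest_path f (C j) (vs j)" for j
  have C: "finite (C j)" "C j \<subseteq> verts G" "C j \<subseteq> B" for j using B by (auto simp: C_def)
  have vj: "vs j \<in> verts G" for j using range_vs by auto
  have g: "g j \<in> simple_exits (C j) (vs j)" for j
    unfolding g_def by (rule forest_path(1)[OF f C(3) vj])
  have CSuc: "C j - tail G ` set (g j) = C (Suc j)" for j by (auto simp: C_def g_def)
  have tele: "(\<Prod>j<m. real (card (forests (C (Suc j)))) / card (forests (C j))) =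
      card (forests (C m)) / card (forests (C 0))"
  proof (induction m)
    case 0 show ?case using card_forests_pos[OF C(1,2), of 0] by simp
  next
    case (Suc m) then show ?case using card_forests_pos[OF C(1,2), of m] by simp
  qed
  have prod: "prob (forest_event f B m) = (\<Prod>j<m. prob (W j -` erasure_set (C j) (vs j) (g j) \<inter> space M))"
  proof (cases "m = 0")
    case True then show ?thesis by (simp add: forest_event_def prob_space)
  next
    case False
    have "forest_event f B m = (\<Inter>j\<in>{..<m}. W j -` erasure_set (C j) (vs j) (g j) \<inter> space M)"
      using False by (auto simp: forest_event_def C_def g_def)
    moreover have "{..<m} \<noteq> {}" using False by (auto simp: lessThan_empty_iff bot_nat_def)
    ultimately show ?thesis
      using indep_varsD[OF indep, of "{..<m}" "\<lambda>j. erasure_set (C j) (vs j) (g j)"] erasure_set_measurable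
      by simp
  qed
  also have "\<dots> = (\<Prod>j<m. real (card (forests (C (Suc j)))) / card (forests (C j)))"
  proof (rule prod.cong[OF refl])
    fix j
    show "prob (W j -` erasure_set (C j) (vs j) (g j) \<inter> space M) =
        real (card (forests (C (Suc j)))) / card (forests (C j))"
      using prob_erasure[OF C(1)[of j] C(2)[of j] g[of j]] unfolding CSuc .
  qed
  also have "\<dots> = card (forests (C m)) / card (forests B)"
  proof -
    have "C 0 = B" by (simp add: C_def)
    then show ?thesis using tele by simp
  qed
  also have "C m = {}"
  proof -
    have "tail G (f v) = v" if "v \<in> B" for v using f that by (auto simp: forests_def PiE_iff)
    then have "B = tail G ` (f ` B)" by (simp add: image_image)
    then show ?thesis
      using forest_stage_complete[OF f _ B(3)] range_vs by (simp add: C_def)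
  qed
  also have "card (forests {}) = 1"
  proof -
    have "forests {} = {\<lambda>_. undefined}" by (auto simp: forests_def)
    then show ?thesis by simp
  qed
  finally show ?thesis by simp
qed

lemma forest_event_disjoint:
  assumes f: "f \<in> forests B" "f' \<in> forests B" and B: "B \<subseteq> vs ` {..<m}"
    and om: "\<omega> \<in> forest_event f B m" "\<omega> \<in> forest_event f' B m"
  shows "f = f'"
proof -
  have "forest_stage f vs B j = forest_stage f' vs B j" if "j \<le> m" for j
    using that
  proof (induction j)
    case (Suc j)
    then have eq: "forest_stage f vs B j = forest_stage f' vs B j" by simp
    let ?C = "B - tail G ` forest_stage f vs B j"
    have "W j \<omega> \<in> erasure_set ?C (vs j) (forest_path f ?C (vs j))"
      using om(1) Suc.prems by (auto simp: forest_event_def)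
    moreover have "W j \<omega> \<in> erasure_set ?C (vs j) (forest_path f' ?C (vs j))"
      using om(2) Suc.prems by (auto simp: forest_event_def eq)
    ultimately obtain p p' where "exit_walk ?C (vs j) p" "list_loop_erasure p = forest_path f ?C (vs j)"
      "starts_with p (W j \<omega>)" "exit_walk ?C (vs j) p'" "list_loop_erasure p' = forest_path f' ?C (vs j)"
      "starts_with p' (W j \<omega>)"
      unfolding erasure_set_def by blast
    then have "forest_path f ?C (vs j) = forest_path f' ?C (vs j)"
      using exit_walk_prefix_unique by metis
    then show ?case using eq by simp
  qed simp
  then have im: "f ` B = f' ` B"
    using forest_stage_complete[OF f(1) _ B] forest_stage_complete[OF f(2) _ B] range_vs by simp
  show ?thesis
  proof (rule PiE_ext)
    show "f \<in> PiE B (out_arcs G)" "f' \<in> PiE B (out_arcs G)" using f by (auto simp: forests_def)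
    fix v assume v: "v \<in> B"
    have t: "tail G (h x) = x" if "h \<in> forests B" "x \<in> B" for h x
      using that by (auto simp: forests_def)
    obtain x where x: "x \<in> B" "f v = f' x" using im v by blast
    then have "x = v" using t[OF f(1) v] t[OF f(2) x(1)] by simp
    then show "f v = f' v" using x by simp
  qed
qed

lemma prob_UN_forest_event:
  assumes B: "finite B" "B \<subseteq> verts G" "B \<subseteq> vs ` {..<m}" and F: "F \<subseteq> forests B"
  shows "prob (\<Union>f\<in>F. forest_event f B m) = card F / card (forests B)"
proof -
  have fin: "finite F" using F finite_forests[OF B(1,2)] finite_subset by blast
  have "prob (\<Union>f\<in>F. forest_event f B m) = (\<Sum>f\<in>F. prob (forest_event f B m))"
  proof (rule finite_measure_finite_Union[OF fin])
    show "disjoint_family_on (\<lambda>f. forest_event f B m) F"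
      using forest_event_disjoint[OF _ _ B(3)] F unfolding disjoint_family_on_def by blast
  qed (use forest_event_measurable in blast)
  also have "\<dots> = (\<Sum>f\<in>F. 1 / card (forests B))"
    using F by (intro sum.cong) (auto simp: prob_forest_event[OF B])
  finally show ?thesis by simp
qed

lemma UN_forest_event_measurable:
  assumes "finite B" "B \<subseteq> verts G" "F \<subseteq> forests B"
  shows "(\<Union>f\<in>F. forest_event f B m) \<in> events"
  using forest_event_measurable finite_subset[OF assms(3) finite_forests[OF assms(1,2)]]
  by (intro sets.finite_UN) auto

text \<open>
  There are \<open>card (forests B)\<close> such events; they are disjoint and each has probability
  \<open>1 / card (forests B)\<close>.
\<close>

lemma AE_forest_event:
  assumes B: "finite B" "B \<subseteq> verts G" "B \<subseteq> vs ` {..<m}"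
  shows "AE \<omega> in M. \<exists>f\<in>forests B. \<omega> \<in> forest_event f B m"
proof -
  have "prob (\<Union>f\<in>forests B. forest_event f B m) = 1"
    using prob_UN_forest_event[OF B order_refl] card_forests_pos[OF B(1,2)] by simp
  then have "AE \<omega> in M. \<omega> \<in> (\<Union>f\<in>forests B. forest_event f B m)"
    using UN_forest_event_measurable[OF B(1,2) order_refl] by (simp add: prob_eq_1)
  then show ?thesis by eventually_elim blast
qed

lemma AE_all_transient: "AE \<omega> in M. \<forall>j. transient_from (vs j) (W j \<omega>)"
  by (subst AE_all_countable) (use walk.AE_transient in blast)

lemma finite_wilson_on_forest_event:
  assumes B: "finite B" "B \<subseteq> vs ` {..<m}" and f: "f \<in> forests B"
    and om: "\<omega> \<in> forest_event f B m" and tr: "\<And>j. transient_from (vs j) (W j \<omega>)"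
  shows "finite_wilson (\<lambda>j. W j \<omega>) B m = f ` B"
proof -
  have "finite_wilson (\<lambda>j. W j \<omega>) B j = forest_stage f vs B j" if "j \<le> m" for j
    using that
  proof (induction j)
    case (Suc j)
    then have eq: "finite_wilson (\<lambda>j. W j \<omega>) B j = forest_stage f vs B j" by simp
    let ?C = "B - tail G ` forest_stage f vs B j"
    have "W j \<omega> \<in> erasure_set ?C (vs j) (forest_path f ?C (vs j))"
      using om Suc.prems by (auto simp: forest_event_def)
    then have "list_loop_erasure (exit_prefix ?C (W j \<omega>)) = forest_path f ?C (vs j)"
      using B(1) by (intro erasure_set_exit_prefix[OF tr]) auto
    then show ?case by (simp add: eq)
  qed simp
  then show ?thesis using forest_stage_complete[OF f _ B(2)] range_vs by simp
qed

text \<open>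
  After enough walks to treat all of \<open>B\<close> the output is a uniform forest. The arcs out of \<open>J\<close> are already
  decided after \<open>k\<close> walks, because an arc found later starts at a vertex not reached before. That \<open>k\<close>
  does not depend on \<open>B\<close> matters when \<open>B\<close> grows.
\<close>

lemma finite_wilson_law:
  assumes B: "finite B" "B \<subseteq> verts G" and J: "J \<subseteq> B" "J \<subseteq> vs ` {..<k}"
    and t: "\<And>v. v \<in> J \<Longrightarrow> t v \<in> out_arcs G v"
  obtains E where "E \<in> events"
    "prob E = real (card {f \<in> forests B. \<forall>v\<in>J. f v = t v}) / card (forests B)"
    "AE \<omega> in M. \<omega> \<in> E \<longleftrightarrow> t ` J \<subseteq> finite_wilson (\<lambda>j. W j \<omega>) B k"
proof -
  have "B \<subseteq> range vs" using B(2) range_vs by simp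
  then obtain I where I: "finite I" "B = vs ` I" using finite_subset_image[OF B(1)] by blast
  obtain m0 where "\<And>i. i \<in> I \<Longrightarrow> i < m0" using finite_nat_set_iff_bounded I(1) by auto
  then have m: "B \<subseteq> vs ` {..<max m0 k}" "k \<le> max m0 k" unfolding I(2) by (auto simp: less_max_iff_disj)
  \<comment> \<open>A number of walks that treats all of \<open>B\<close>.\<close>
  define m where "m = max m0 k"
  let ?F = "{f \<in> forests B. \<forall>v\<in>J. f v = t v}"
  let ?E = "\<Union>f\<in>?F. forest_event f B m"
  have "AE \<omega> in M. \<omega> \<in> ?E \<longleftrightarrow> t ` J \<subseteq> finite_wilson (\<lambda>j. W j \<omega>) B k"
    using AE_forest_event[OF B m(1)] AE_all_transient
  proof eventually_elim
    case (elim \<omega>)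
    then obtain f where f: "f \<in> forests B" "\<omega> \<in> forest_event f B m" by (auto simp: m_def)
    have tr: "\<And>j. transient_from (vs j) (W j \<omega>)" using elim(2) by blast
    let ?w = "\<lambda>j. W j \<omega>"
    have fw: "finite_wilson ?w B m = f ` B"
      using finite_wilson_on_forest_event[OF B(1) m(1) f(1) _ tr] f(2) by (simp add: m_def)
    have ft: "f v \<in> out_arcs G v" if "v \<in> B" for v using f(1) that by (auto simp: forests_def)
    have "\<omega> \<in> ?E \<longleftrightarrow> f \<in> ?F"
      using forest_event_disjoint[OF f(1) _ m(1)[folded m_def] f(2)] f by blast
    also have "\<dots> \<longleftrightarrow> t ` J \<subseteq> finite_wilson ?w B m"
    proof -
      have tf: "t v \<in> f ` B \<longleftrightarrow> f v = t v" if v: "v \<in> J" for v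
      proof
        assume "t v \<in> f ` B"
        then obtain x where x: "x \<in> B" "t v = f x" by blast
        then have "x = v" using ft[OF x(1)] t[OF v] by simp
        then show "f v = t v" using x by simp
      qed (use v J(1) in force)
      show ?thesis using f(1) unfolding fw image_subset_iff by (simp add: tf)
    qed
    also have "\<dots> \<longleftrightarrow> t ` J \<subseteq> finite_wilson ?w B k"
    proof -
      have "t v \<in> finite_wilson ?w B m \<longleftrightarrow> t v \<in> finite_wilson ?w B k" if v: "v \<in> J" for v
      proof
        obtain j where j: "j < k" "v = vs j" using J(2) v by auto
        have "vs j \<in> B" using j v J(1) by auto
        then have "v \<in> tail G ` finite_wilson ?w B k"
          using finite_wilson_start[of vs ?w B j k, OF tr B(1)] j by simp
        moreover assume "t v \<in> finite_wilson ?w B m"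
        ultimately show "t v \<in> finite_wilson ?w B k"
          using finite_wilson_new_tail[of vs ?w B k m "t v", OF tr B(1)] m(2) t[OF v] by (simp add: m_def)
      next
        have "finite_wilson ?w B k \<subseteq> finite_wilson ?w B m"
          using m(2)[folded m_def] by (induction rule: dec_induct) auto
        then show "t v \<in> finite_wilson ?w B k \<Longrightarrow> t v \<in> finite_wilson ?w B m" by blast
      qed
      then show ?thesis by auto
    qed
    finally show ?case .
  qed
  then show thesis
    using UN_forest_event_measurable[OF B, of ?F m] prob_UN_forest_event[OF B m(1), of ?F]
    by (intro that[of ?E]) (auto simp: m_def)
qed

end

section \<open>Exhausting the graph in Wilson's algorithm\<close>

context pre_digraph
begin

lemma set_list_loop_erasure: "set (list_loop_erasure p) \<subseteq> set p"
proof (induction p rule: list_loop_erasure.induct)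
  case (2 e p)
  have "exit_list (e # p) (tail G e) \<noteq> []" by simp
  from last_in_set[OF this] have "last (exit_list (e # p) (tail G e)) \<in> set (e # p)"
    by (simp only: set_exit_list mem_Collect_eq)
  moreover have "set (rev (takeWhile (\<lambda>a. tail G a \<noteq> tail G e) (rev p))) \<subseteq> set p"
    by (auto dest: set_takeWhileD)
  ultimately show ?case using 2 by auto
qed simp

lemma cas_vertex_sets: "cas u p v \<Longrightarrow> insert u (head G ` set p) = insert v (tail G ` set p)"
  by (induction p arbitrary: u) (auto simp: insert_commute)

lemma path_vertex_take:
  "path_vertex G (path_take n \<gamma>) t = (if t \<le> n then path_vertex G \<gamma> t else None)"
  by (cases t) (auto simp: path_take_def)

lemma path_take_in_paths: "\<gamma> \<in> paths G \<Longrightarrow> path_take n \<gamma> \<in> paths G"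
  unfolding paths_def by (auto simp: path_vertex_take) (auto simp: path_take_def split: if_splits)

lemma loop_erasure_time_Suc_iff:
  "loop_erasure_time G \<gamma> (Suc i) = Some k \<longleftrightarrow>
     (\<exists>s m. loop_erasure_time G \<gamma> i = Some s \<and> k = Suc m \<and> s \<le> m \<and>
        path_vertex G \<gamma> m = path_vertex G \<gamma> s \<and> (\<forall>t>m. path_vertex G \<gamma> t \<noteq> path_vertex G \<gamma> s) \<and>
        snd \<gamma> m \<noteq> None)"
proof (cases "loop_erasure_time G \<gamma> i")
  case (Some s)
  define T where "T = {t. s \<le> t \<and> path_vertex G \<gamma> t = path_vertex G \<gamma> s}"
  have "s \<in> T" by (simp add: T_def)
  have max: "finite T \<and> Max T = m \<longleftrightarrow>
      s \<le> m \<and> path_vertex G \<gamma> m = path_vertex G \<gamma> s \<and> (\<forall>t>m. path_vertex G \<gamma> t \<noteq> path_vertex G \<gamma> s)" for m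
  proof
    assume m: "finite T \<and> Max T = m"
    then have mT: "m \<in> T" and ub: "\<And>t. t \<in> T \<Longrightarrow> t \<le> m"
      using \<open>s \<in> T\<close> Max_in[of T] Max_ge[of T] by auto
    have "path_vertex G \<gamma> t \<noteq> path_vertex G \<gamma> s" if "t > m" for t
      using ub[of t] that mT by (auto simp: T_def)
    then show "s \<le> m \<and> path_vertex G \<gamma> m = path_vertex G \<gamma> s \<and>
        (\<forall>t>m. path_vertex G \<gamma> t \<noteq> path_vertex G \<gamma> s)"
      using mT by (auto simp: T_def)
  next
    assume m: "s \<le> m \<and> path_vertex G \<gamma> m = path_vertex G \<gamma> s \<and>
        (\<forall>t>m. path_vertex G \<gamma> t \<noteq> path_vertex G \<gamma> s)"
    then have "T \<subseteq> {..m}" by (auto simp: T_def not_less[symmetric])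
    then show "finite T \<and> Max T = m"
      using m finite_subset by (auto intro!: Max_eqI simp: T_def)
  qed
  have eq: "loop_erasure_time G \<gamma> (Suc i) = (if finite T \<and> snd \<gamma> (Max T) \<noteq> None then Some (Suc (Max T)) else None)"
    using Some by (simp add: T_def Let_def)
  have "loop_erasure_time G \<gamma> (Suc i) = Some k \<longleftrightarrow>
      (\<exists>m. k = Suc m \<and> (finite T \<and> Max T = m) \<and> snd \<gamma> m \<noteq> None)"
    unfolding eq by auto
  then show ?thesis unfolding max using Some by auto
qed simp

lemma loop_erasure_arc_iff:
  "snd (loop_erasure G \<gamma>) i = Some e \<longleftrightarrow>
     (\<exists>s m. loop_erasure_time G \<gamma> i = Some s \<and> s \<le> m \<and> path_vertex G \<gamma> m = path_vertex G \<gamma> s \<and>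
        (\<forall>t>m. path_vertex G \<gamma> t \<noteq> path_vertex G \<gamma> s) \<and> snd \<gamma> m = Some e)"
proof -
  have "snd (loop_erasure G \<gamma>) i = Some e \<longleftrightarrow>
      (\<exists>k. loop_erasure_time G \<gamma> (Suc i) = Some k \<and> snd \<gamma> (k - 1) = Some e)"
    by (auto simp: loop_erasure_def simp del: loop_erasure_time.simps split: option.splits)
  also have "\<dots> \<longleftrightarrow> (\<exists>s m. loop_erasure_time G \<gamma> i = Some s \<and> s \<le> m \<and>
        path_vertex G \<gamma> m = path_vertex G \<gamma> s \<and>
        (\<forall>t>m. path_vertex G \<gamma> t \<noteq> path_vertex G \<gamma> s) \<and> snd \<gamma> m = Some e)"
    (is "?L \<longleftrightarrow> ?R")
  proof
    assume ?L then show ?R unfolding loop_erasure_time_Suc_iff by auto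
  next
    assume ?R
    then obtain s m where "loop_erasure_time G \<gamma> i = Some s" "s \<le> m" "path_vertex G \<gamma> m = path_vertex G \<gamma> s"
      "\<forall>t>m. path_vertex G \<gamma> t \<noteq> path_vertex G \<gamma> s" and e: "snd \<gamma> m = Some e" by blast
    then have "loop_erasure_time G \<gamma> (Suc i) = Some (Suc m)" unfolding loop_erasure_time_Suc_iff by blast
    with e show ?L by (intro exI[of _ "Suc m"]) (simp del: loop_erasure_time.simps)
  qed
  finally show ?thesis .
qed

lemma loop_erasure_time_mono:
  assumes "i \<le> j" "loop_erasure_time G \<gamma> j = Some k"
  shows "\<exists>s. loop_erasure_time G \<gamma> i = Some s \<and> s + (j - i) \<le> k"
  using assms
proof (induction j arbitrary: k rule: dec_induct)
  case (step n)
  then obtain s m where "loop_erasure_time G \<gamma> n = Some s" "k = Suc m" "s \<le> m"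
    unfolding loop_erasure_time_Suc_iff by blast
  with step.IH[of s] step.hyps show ?case by auto
qed auto

lemma loop_erasure_time_ge: "loop_erasure_time G \<gamma> i = Some s \<Longrightarrow> i \<le> s"
  using loop_erasure_time_mono[of 0 i \<gamma> s] by simp

lemma loop_erasure_vertex:
  "loop_erasure_time G \<gamma> i = Some s \<Longrightarrow> path_vertex G (loop_erasure G \<gamma>) i = path_vertex G \<gamma> s"
proof (cases i)
  case 0 then show "loop_erasure_time G \<gamma> i = Some s \<Longrightarrow> ?thesis" by (simp add: loop_erasure_def)
next
  case (Suc j)
  assume "loop_erasure_time G \<gamma> i = Some s"
  then obtain m where m: "s = Suc m" "loop_erasure_time G \<gamma> (Suc j) = Some s" "snd \<gamma> m \<noteq> None"
    unfolding Suc loop_erasure_time_Suc_iff by blast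
  have "snd (loop_erasure G \<gamma>) j = snd \<gamma> m" using m by (simp add: loop_erasure_def del: loop_erasure_time.simps)
  then show ?thesis by (simp add: Suc m(1))
qed

lemma fst_loop_erasure [simp]: "fst (loop_erasure G \<gamma>) = fst \<gamma>"
  by (simp add: loop_erasure_def)

lemma arcs_path_digraph: "arcs (path_digraph G \<gamma>) = {e. \<exists>i. snd \<gamma> i = Some e}"
  by (simp add: path_digraph_def)

lemma loop_erasure_arc_crossed: "e \<in> arcs (path_digraph G (loop_erasure G \<gamma>)) \<Longrightarrow> \<exists>m. snd \<gamma> m = Some e"
  unfolding arcs_path_digraph loop_erasure_arc_iff by blast

lemma loop_erasure_tail_in_verts:
  assumes "\<gamma> \<in> paths G" "e \<in> arcs (path_digraph G (loop_erasure G \<gamma>))"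
  shows "tail G e \<in> verts (path_digraph G (loop_erasure G \<gamma>))"
proof -
  obtain i where i: "snd (loop_erasure G \<gamma>) i = Some e" using assms(2) by (auto simp: arcs_path_digraph)
  then obtain s m where s: "loop_erasure_time G \<gamma> i = Some s" "path_vertex G \<gamma> m = path_vertex G \<gamma> s"
    "snd \<gamma> m = Some e" unfolding loop_erasure_arc_iff by blast
  have "path_vertex G (loop_erasure G \<gamma>) i = Some (tail G e)"
    using loop_erasure_vertex[OF s(1)] s(2) path_arc(2)[OF assms(1) s(3)] by simp
  then show ?thesis by (auto simp: path_digraph_def)
qed

text \<open>
  A time of the erasure comes after the last visit to each earlier vertex of the erasure.
\<close>

lemma loop_erasure_tails_distinct:
  assumes g: "\<gamma> \<in> paths G"
  shows "inj_on (tail G) (arcs (path_digraph G (loop_erasure G \<gamma>)))"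
proof -
  have ord: "tail G e \<noteq> tail G e'"
    if ei: "snd (loop_erasure G \<gamma>) i = Some e" and ej: "snd (loop_erasure G \<gamma>) j = Some e'" and ij: "i < j"
    for i j e e'
  proof -
    obtain s m where s: "loop_erasure_time G \<gamma> i = Some s" "s \<le> m" "path_vertex G \<gamma> m = path_vertex G \<gamma> s"
      "\<forall>t>m. path_vertex G \<gamma> t \<noteq> path_vertex G \<gamma> s" "snd \<gamma> m = Some e"
      using ei unfolding loop_erasure_arc_iff by blast
    obtain s' m' where s': "loop_erasure_time G \<gamma> j = Some s'" "s' \<le> m'"
      "path_vertex G \<gamma> m' = path_vertex G \<gamma> s'" "snd \<gamma> m' = Some e'"
      using ej unfolding loop_erasure_arc_iff by blast
    have "loop_erasure_time G \<gamma> (Suc i) = Some (Suc m)"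
      unfolding loop_erasure_time_Suc_iff using s by blast
    then have "Suc m \<le> s'"
      using loop_erasure_time_mono[of "Suc i" j \<gamma> s'] ij s'(1) by auto
    then have "path_vertex G \<gamma> s' \<noteq> path_vertex G \<gamma> s" using s(4) by auto
    then show ?thesis
      using path_arc(2)[OF g s(5)] path_arc(2)[OF g s'(4)] s(3) s'(3) by simp
  qed
  show ?thesis
  proof (rule inj_onI)
    fix e e' assume "e \<in> arcs (path_digraph G (loop_erasure G \<gamma>))" "e' \<in> arcs (path_digraph G (loop_erasure G \<gamma>))"
      and eq: "tail G e = tail G e'"
    then obtain i j where ij: "snd (loop_erasure G \<gamma>) i = Some e" "snd (loop_erasure G \<gamma>) j = Some e'"
      by (auto simp: arcs_path_digraph)
    consider "i < j" | "i = j" | "j < i" by linarith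
    then show "e = e'"
    proof cases
      case 1 then show ?thesis using ord[OF ij] eq by blast
    next
      case 2 then show ?thesis using ij by simp
    next
      case 3 then show ?thesis using ord[OF ij(2,1)] eq by metis
    qed
  qed
qed

lemma stop_on_hitting_cases:
  obtains (hit) \<tau> where "path_vertex G \<gamma> \<tau> \<in> Some ` S" "\<And>t. t < \<tau> \<Longrightarrow> path_vertex G \<gamma> t \<notin> Some ` S"
      "stop_on_hitting G S \<gamma> = path_take \<tau> \<gamma>"
  | (miss) "\<And>t. path_vertex G \<gamma> t \<notin> Some ` S" "stop_on_hitting G S \<gamma> = \<gamma>"
proof (cases "\<exists>t. path_vertex G \<gamma> t \<in> Some ` S")
  case True
  define \<tau> where "\<tau> = (LEAST t. path_vertex G \<gamma> t \<in> Some ` S)"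
  show thesis
  proof (rule hit[of \<tau>])
    show "path_vertex G \<gamma> \<tau> \<in> Some ` S" unfolding \<tau>_def by (rule LeastI_ex[OF True])
    show "\<And>t. t < \<tau> \<Longrightarrow> path_vertex G \<gamma> t \<notin> Some ` S" unfolding \<tau>_def by (rule not_less_Least)
    show "stop_on_hitting G S \<gamma> = path_take \<tau> \<gamma>" using True by (simp add: stop_on_hitting_def \<tau>_def)
  qed
next
  case False
  then show thesis by (intro miss) (auto simp: stop_on_hitting_def)
qed

lemma stop_on_hitting_in_paths: "\<gamma> \<in> paths G \<Longrightarrow> stop_on_hitting G S \<gamma> \<in> paths G"
  by (cases rule: stop_on_hitting_cases[of \<gamma> S]) (auto simp: path_take_in_paths)

lemma stop_on_hitting_arc:
  assumes "\<gamma> \<in> paths G" "snd (stop_on_hitting G S \<gamma>) m = Some e"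
  shows "e \<in> arcs G" "tail G e \<notin> S"
proof -
  show "e \<in> arcs G" using path_arc(1)[OF stop_on_hitting_in_paths[OF assms(1)] assms(2)] .
  show "tail G e \<notin> S"
  proof (cases rule: stop_on_hitting_cases[of \<gamma> S])
    case (hit \<tau>)
    then have "m < \<tau>" "snd \<gamma> m = Some e" using assms(2) by (auto simp: path_take_def split: if_splits)
    then show ?thesis using hit(2)[of m] path_arc(2)[OF assms(1), of m e] by auto
  next
    case miss
    then show ?thesis using miss(1)[of m] path_arc(2)[OF assms(1), of m e] assms(2) by auto
  qed
qed

lemma wilson_stage_out_arcs:
  assumes "\<And>j. w j \<in> paths G"
  shows "arcs (wilson_stage G w k) \<subseteq> arcs G" "inj_on (tail G) (arcs (wilson_stage G w k))"
    "tail G ` arcs (wilson_stage G w k) \<subseteq> verts (wilson_stage G w k)"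
proof (induction k)
  case 0
  { case 1 show ?case by simp next case 2 show ?case by simp next case 3 show ?case by simp }
next
  case (Suc k)
  let ?S = "verts (wilson_stage G w k)" and ?A = "arcs (wilson_stage G w k)"
  let ?\<gamma> = "stop_on_hitting G ?S (w k)"
  let ?L = "path_digraph G (loop_erasure G ?\<gamma>)"
  have g: "?\<gamma> \<in> paths G" by (rule stop_on_hitting_in_paths[OF assms])
  have new: "e \<in> arcs G" "tail G e \<notin> ?S" if "e \<in> arcs ?L" for e
    using loop_erasure_arc_crossed[OF that] stop_on_hitting_arc[OF assms] by blast+
  {
    case 1 show ?case using Suc(1) new(1) by (auto simp: Digraph_Component.union_def)
  next
    case 2
    have "tail G e \<noteq> tail G e'" if "e \<in> ?A" "e' \<in> arcs ?L" for e e'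
      using new(2)[OF that(2)] Suc(3) that(1) by auto
    then show ?case
      using Suc(2) loop_erasure_tails_distinct[OF g] by (fastforce simp: Digraph_Component.union_def inj_on_def)
  next
    case 3
    show ?case using Suc(3) loop_erasure_tail_in_verts[OF g] by (auto simp: Digraph_Component.union_def)
  }
qed

lemma wilson_stage_mono: "i \<le> j \<Longrightarrow> arcs (wilson_stage G w i) \<subseteq> arcs (wilson_stage G w j)"
  by (induction rule: dec_induct) (auto simp: Digraph_Component.union_def)

lemma arcs_wilson_arboretum: "arcs (wilson_arboretum G w) = (\<Union>k. arcs (wilson_stage G w k))"
  and verts_wilson_arboretum: "verts (wilson_arboretum G w) = (\<Union>k. verts (wilson_stage G w k))"
  and tail_wilson_arboretum: "tail (wilson_arboretum G w) = tail G"
  by (auto simp: wilson_arboretum_def Union_def)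

lemma wilson_arboretum_out_arcs:
  assumes "\<And>j. w j \<in> paths G"
  shows "arcs (wilson_arboretum G w) \<subseteq> arcs G" "inj_on (tail G) (arcs (wilson_arboretum G w))"
proof -
  show "arcs (wilson_arboretum G w) \<subseteq> arcs G"
    using wilson_stage_out_arcs(1)[of w, OF assms] by (auto simp: arcs_wilson_arboretum)
  show "inj_on (tail G) (arcs (wilson_arboretum G w))"
  proof (rule inj_onI)
    fix e e' assume "e \<in> arcs (wilson_arboretum G w)" "e' \<in> arcs (wilson_arboretum G w)"
      and eq: "tail G e = tail G e'"
    then obtain i j where "e \<in> arcs (wilson_stage G w i)" "e' \<in> arcs (wilson_stage G w j)"
      by (auto simp: arcs_wilson_arboretum)
    then have "e \<in> arcs (wilson_stage G w (max i j))" "e' \<in> arcs (wilson_stage G w (max i j))"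
      using wilson_stage_mono[of i "max i j" w] wilson_stage_mono[of j "max i j" w] by auto
    then show "e = e'" using wilson_stage_out_arcs(2)[of w, OF assms] eq by (meson inj_onD)
  qed
qed

text \<open>
  The invariant that relates the two descriptions of loop-erasure: up to the \<open>i\<close>-th erasure time the same
  arcs have been kept, and the rest of the list remains to be erased.
\<close>

lemma list_loop_erasure_follows_times:
  assumes g: "\<gamma> \<in> paths G" and n: "\<And>i. i < n \<Longrightarrow> snd \<gamma> i \<noteq> None"
  shows "loop_erasure_time G (path_take n \<gamma>) i = Some s \<Longrightarrow> s \<le> n \<and>
    (\<exists>q. length q = i \<and> list_loop_erasure (path_prefix n \<gamma>) = q @ list_loop_erasure (drop s (path_prefix n \<gamma>)) \<and>
      (\<forall>j<i. snd (loop_erasure G (path_take n \<gamma>)) j = Some (q ! j)))"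
proof (induction i arbitrary: s)
  case 0 then show ?case by simp
next
  case (Suc i)
  let ?\<gamma> = "path_take n \<gamma>" and ?p = "path_prefix n \<gamma>"
  obtain s0 m where s0: "loop_erasure_time G ?\<gamma> i = Some s0" and sm: "s = Suc m" "s0 \<le> m"
    and same: "path_vertex G ?\<gamma> m = path_vertex G ?\<gamma> s0"
    and later: "\<forall>t>m. path_vertex G ?\<gamma> t \<noteq> path_vertex G ?\<gamma> s0" and ne: "snd ?\<gamma> m \<noteq> None"
    using Suc.prems unfolding loop_erasure_time_Suc_iff by blast
  have mn: "m < n" using ne by (auto simp: path_take_def split: if_splits)
  obtain q where q: "length q = i" "list_loop_erasure ?p = q @ list_loop_erasure (drop s0 ?p)"
    "\<And>j. j < i \<Longrightarrow> snd (loop_erasure G ?\<gamma>) j = Some (q ! j)"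
    using Suc.IH[OF s0] by blast
  have vertex: "path_vertex G ?\<gamma> t = Some (tail G (?p ! t))" if "t < n" for t
  proof -
    have "snd \<gamma> t = Some (?p ! t)" using n[OF that] that by auto
    then show ?thesis using path_arc(2)[OF g] that by (simp add: path_vertex_take)
  qed
  define l where "l = take (m - s0) (drop s0 ?p)"
  have drop: "drop s0 ?p = l @ ?p ! m # drop s ?p"
    using id_take_nth_drop[of "m - s0" "drop s0 ?p"] mn sm by (simp add: l_def)
  have "tail G (hd (l @ [?p ! m])) = tail G (?p ! s0)"
  proof (cases "m = s0")
    case True then show ?thesis by (simp add: l_def)
  next
    case False
    then have "l \<noteq> []" "hd l = ?p ! s0" using sm(2) mn by (auto simp: l_def hd_conv_nth)
    then show ?thesis by simp
  qed
  also have "\<dots> = tail G (?p ! m)" using same vertex[OF mn] vertex[of s0] sm(2) mn by simp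
  finally have "tail G (hd (l @ [?p ! m])) = tail G (?p ! m)" .
  moreover have "\<forall>a\<in>set (drop s ?p). tail G a \<noteq> tail G (?p ! m)"
  proof
    fix a assume "a \<in> set (drop s ?p)"
    then obtain k where k: "k < n - s" "a = ?p ! (s + k)" by (auto simp: in_set_conv_nth)
    then have "path_vertex G ?\<gamma> (s + k) \<noteq> path_vertex G ?\<gamma> s0"
      by (intro later[rule_format]) (simp add: sm(1))
    then show "tail G a \<noteq> tail G (?p ! m)"
      using vertex[of "s + k"] vertex[OF mn] k same by simp
  qed
  ultimately have "list_loop_erasure (drop s0 ?p) = ?p ! m # list_loop_erasure (drop s ?p)"
    unfolding drop by (rule list_loop_erasure_last_exit)
  moreover have "snd (loop_erasure G ?\<gamma>) i = Some (?p ! m)"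
  proof -
    have "snd ?\<gamma> m = Some (?p ! m)" using n[OF mn] mn by (auto simp: path_take_def)
    then show ?thesis unfolding loop_erasure_arc_iff using s0 sm(2) same later by blast
  qed
  ultimately show ?case
    using q mn sm(1) by (intro conjI exI[of _ "q @ [?p ! m]"]) (auto simp: nth_append less_Suc_eq)
qed

text \<open>
  The final vertex is not visited before time \<open>n\<close>, so the erasure times do not stop before they reach
  \<open>n\<close>.
\<close>

lemma loop_erasure_of_finite_path:
  assumes g: "\<gamma> \<in> paths G" and n: "\<And>i. i < n \<Longrightarrow> snd \<gamma> i \<noteq> None"
    and new: "\<And>i. i < n \<Longrightarrow> path_vertex G \<gamma> i \<noteq> path_vertex G \<gamma> n"
  shows "arcs (path_digraph G (loop_erasure G (path_take n \<gamma>))) = set (list_loop_erasure (path_prefix n \<gamma>))"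
proof -
  let ?\<gamma> = "path_take n \<gamma>"
  note follow = list_loop_erasure_follows_times[OF g n]
  have "\<exists>i. loop_erasure_time G ?\<gamma> i = None"
  proof (rule ccontr)
    assume neg: "\<not> ?thesis"
    have "loop_erasure_time G ?\<gamma> (Suc n) \<noteq> None"
    proof
      assume "loop_erasure_time G ?\<gamma> (Suc n) = None"
      then have "\<exists>i. loop_erasure_time G ?\<gamma> i = None" by (rule exI)
      with neg show False by contradiction
    qed
    then obtain s where s: "loop_erasure_time G ?\<gamma> (Suc n) = Some s" by blast
    have "s \<le> n" using follow[OF _ s] by blast
    then show False using loop_erasure_time_ge[OF s] by simp
  qed
  define i where "i = (LEAST i. loop_erasure_time G ?\<gamma> i = None)"
  have iN: "loop_erasure_time G ?\<gamma> i = None" unfolding i_def by (rule LeastI_ex) fact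
  then obtain k where k: "i = Suc k" by (cases i) auto
  have "loop_erasure_time G ?\<gamma> k \<noteq> None" using not_less_Least[of k "\<lambda>i. loop_erasure_time G ?\<gamma> i = None"] k
    by (simp add: i_def)
  then obtain s where s: "loop_erasure_time G ?\<gamma> k = Some s" by blast
  have sn: "s \<le> n" using follow[OF _ s] by blast
  have "s = n"
  proof (rule ccontr)
    assume "s \<noteq> n"
    then have "s < n" using sn by simp
    define T where "T = {t. t \<le> n \<and> path_vertex G ?\<gamma> t = path_vertex G ?\<gamma> s}"
    have T: "finite T" "s \<in> T" using sn by (auto simp: T_def)
    define m where "m = Max T"
    have m: "m \<in> T" "\<And>t. t \<in> T \<Longrightarrow> t \<le> m"
    using T(2) Max_in[OF T(1)] Max_ge[OF T(1)] unfolding m_def by blast+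
    have "path_vertex G \<gamma> n \<noteq> path_vertex G \<gamma> s" using new[OF \<open>s < n\<close>] by simp
    then have "m \<noteq> n" using m(1) sn by (auto simp: T_def path_vertex_take)
    then have mn: "m < n" using m(1) by (simp add: T_def)
    have "snd \<gamma> s \<noteq> None" using n[OF \<open>s < n\<close>] .
    then have "path_vertex G ?\<gamma> s \<noteq> None"
      using path_arc(2)[OF g] sn by (auto simp: path_vertex_take)
    then have "path_vertex G ?\<gamma> t \<noteq> path_vertex G ?\<gamma> s" if "t > m" for t
      using m(2)[of t] that by (cases "t \<le> n") (auto simp: T_def path_vertex_take[of n \<gamma> t])
    moreover have "snd ?\<gamma> m \<noteq> None" using n[OF mn] mn by (simp add: path_take_def)
    ultimately have "loop_erasure_time G ?\<gamma> (Suc k) = Some (Suc m)"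
      unfolding loop_erasure_time_Suc_iff using s m(1) m(2)[OF T(2)] by (auto simp: T_def)
    then show False using iN k by simp
  qed
  then obtain q where q: "length q = k" "list_loop_erasure (path_prefix n \<gamma>) = q"
    "\<And>j. j < k \<Longrightarrow> snd (loop_erasure G ?\<gamma>) j = Some (q ! j)"
    using follow[OF _ s] by auto
  have "snd (loop_erasure G ?\<gamma>) j = None" if "j \<ge> k" for j
  proof (rule ccontr)
    assume "snd (loop_erasure G ?\<gamma>) j \<noteq> None"
    then obtain e where "snd (loop_erasure G ?\<gamma>) j = Some e" by blast
    then have "loop_erasure_time G ?\<gamma> (Suc j) \<noteq> None"
      by (auto simp: loop_erasure_def simp del: loop_erasure_time.simps split: option.splits)
    then have "loop_erasure_time G ?\<gamma> i \<noteq> None"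
      using loop_erasure_time_mono[of i "Suc j" ?\<gamma>] that k by (auto simp del: loop_erasure_time.simps)
    then show False using iN by simp
  qed
  then have "snd (loop_erasure G ?\<gamma>) j = Some e \<longleftrightarrow> j < k \<and> q ! j = e" for j e
    using q(3)[of j] by (cases "j < k") auto
  then show ?thesis unfolding arcs_path_digraph q(2) using q(1) by (auto simp: in_set_conv_nth)
qed

lemma loop_erasure_time_take:
  "\<gamma> \<in> paths G \<Longrightarrow> loop_erasure_time G \<gamma> i = Some s \<Longrightarrow> s \<le> n \<Longrightarrow>
     loop_erasure_time G (path_take n \<gamma>) i = Some s"
proof (induction i arbitrary: s)
  case (Suc i)
  obtain s0 m where s0: "loop_erasure_time G \<gamma> i = Some s0" and sm: "s = Suc m" "s0 \<le> m"
    and same: "path_vertex G \<gamma> m = path_vertex G \<gamma> s0"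
    and later: "\<forall>t>m. path_vertex G \<gamma> t \<noteq> path_vertex G \<gamma> s0" and ne: "snd \<gamma> m \<noteq> None"
    using Suc.prems(2) unfolding loop_erasure_time_Suc_iff by blast
  have take: "loop_erasure_time G (path_take n \<gamma>) i = Some s0"
    using Suc.IH[OF Suc.prems(1) s0] sm Suc.prems(3) by simp
  have "path_vertex G \<gamma> m \<noteq> None" using ne path_arc(2)[OF Suc.prems(1)] by auto
  then have "path_vertex G (path_take n \<gamma>) m = path_vertex G (path_take n \<gamma>) s0"
    "\<forall>t>m. path_vertex G (path_take n \<gamma>) t \<noteq> path_vertex G (path_take n \<gamma>) s0"
    "snd (path_take n \<gamma>) m \<noteq> None"
    using sm same later ne Suc.prems(3) by (auto simp: path_vertex_take) (auto simp: path_take_def)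
  then show ?case unfolding loop_erasure_time_Suc_iff using take sm by blast
qed simp

text \<open>
  The arcs that the erasure keeps before its time \<open>s\<close> depend on the path up to \<open>s\<close> only, and \<open>e\<close> is not
  crossed later. So every initial segment beyond \<open>s\<close> decides whether \<open>e\<close> is kept.
\<close>

lemma loop_erasure_arc_prefix:
  assumes g: "\<gamma> \<in> paths G" and inf: "infinite_path \<gamma>"
    and s: "loop_erasure_time G \<gamma> i = Some s" "s \<le> n"
    and e: "\<And>t. t \<ge> s \<Longrightarrow> snd \<gamma> t \<noteq> Some e"
  shows "e \<in> arcs (path_digraph G (loop_erasure G \<gamma>)) \<longleftrightarrow> e \<in> set (list_loop_erasure (path_prefix n \<gamma>))"
proof -
  have inf': "snd \<gamma> i \<noteq> None" for i using inf by (simp add: infinite_path_def)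
  obtain q where q: "length q = i"
    "list_loop_erasure (path_prefix n \<gamma>) = q @ list_loop_erasure (drop s (path_prefix n \<gamma>))"
    "\<And>j. j < i \<Longrightarrow> snd (loop_erasure G (path_take n \<gamma>)) j = Some (q ! j)"
    using list_loop_erasure_follows_times[OF g inf' loop_erasure_time_take[OF g s]] by blast
  have early: "snd (loop_erasure G \<gamma>) j = Some (q ! j)" if j: "j < i" for j
  proof -
    obtain k where k: "loop_erasure_time G \<gamma> (Suc j) = Some k" "k \<le> s"
      using loop_erasure_time_mono[of "Suc j" i \<gamma> s] j s(1) by auto
    then obtain m where m: "k = Suc m" unfolding loop_erasure_time_Suc_iff by blast
    have "loop_erasure_time G (path_take n \<gamma>) (Suc j) = Some k"
      using loop_erasure_time_take[OF g k(1)] k(2) s(2) by simp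
    then show ?thesis
      using q(3)[OF j] k m s(2)
      by (simp add: loop_erasure_def path_take_def del: loop_erasure_time.simps)
  qed
  have "e \<notin> set (list_loop_erasure (drop s (path_prefix n \<gamma>)))"
  proof
    assume "e \<in> set (list_loop_erasure (drop s (path_prefix n \<gamma>)))"
    then have "e \<in> set (drop s (path_prefix n \<gamma>))" using set_list_loop_erasure by blast
    then obtain t where "t < n - s" "e = the (snd \<gamma> (s + t))" by (auto simp: in_set_conv_nth)
    then show False using e[of "s + t"] inf'[of "s + t"] by auto
  qed
  then have "e \<in> set (list_loop_erasure (path_prefix n \<gamma>)) \<longleftrightarrow> (\<exists>j<i. q ! j = e)"
    unfolding q(2) using q(1) by (auto simp: in_set_conv_nth)
  also have "\<dots> \<longleftrightarrow> (\<exists>j. snd (loop_erasure G \<gamma>) j = Some e)"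
  proof
    assume "\<exists>j. snd (loop_erasure G \<gamma>) j = Some e"
    then obtain j where j: "snd (loop_erasure G \<gamma>) j = Some e" by blast
    then obtain k m where k: "loop_erasure_time G \<gamma> j = Some k" "k \<le> m" "snd \<gamma> m = Some e"
      unfolding loop_erasure_arc_iff by blast
    have "j < i"
    proof (rule ccontr)
      assume "\<not> j < i"
      then have "s \<le> k" using loop_erasure_time_mono[of i j \<gamma> k] k(1) s(1) by auto
      then show False using e[of m] k by auto
    qed
    then show "\<exists>j<i. q ! j = e" using early[of j] j by auto
  qed (use early in blast)
  finally show ?thesis by (simp add: arcs_path_digraph)
qed

end

context infinite_sourced_eulerian_digraph
begin

lemma loop_erasure_time_transient:
  assumes g: "transient_from u \<gamma>"
  shows "\<exists>s. loop_erasure_time G \<gamma> i = Some s"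
proof (induction i)
  case (Suc i)
  then obtain s where s: "loop_erasure_time G \<gamma> i = Some s" by blast
  have gp: "\<gamma> \<in> paths G" "infinite_path \<gamma>" using g by (auto simp: transient_from_def)
  obtain w where w: "w \<in> verts G" "path_vertex G \<gamma> s = Some w" using path_vertex_infinite[OF gp] by blast
  define T where "T = {n. path_vertex G \<gamma> n = Some w}"
  have T: "finite T" "s \<in> T" using g w by (auto simp: T_def transient_from_def)
  define m where "m = Max T"
  have m: "m \<in> T" "\<And>t. t \<in> T \<Longrightarrow> t \<le> m"
    using T(2) Max_in[OF T(1)] Max_ge[OF T(1)] unfolding m_def by blast+
  have "path_vertex G \<gamma> t \<noteq> path_vertex G \<gamma> s" if "t > m" for t
    using m(2)[of t] that w(2) by (auto simp: T_def)
  moreover have "path_vertex G \<gamma> m = path_vertex G \<gamma> s" "s \<le> m" "snd \<gamma> m \<noteq> None"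
    using m(1) m(2)[OF T(2)] w(2) gp(2) by (auto simp: T_def infinite_path_def)
  ultimately have "loop_erasure_time G \<gamma> (Suc i) = Some (Suc m)"
    unfolding loop_erasure_time_Suc_iff using s by blast
  then show ?case by blast
qed simp

lemma arc_crossed_finitely_often:
  assumes g: "transient_from u \<gamma>" and e: "e \<in> arcs G"
  shows "\<exists>N. \<forall>t\<ge>N. snd \<gamma> t \<noteq> Some e"
proof -
  have gp: "\<gamma> \<in> paths G" using g by (simp add: transient_from_def)
  have "finite {n. path_vertex G \<gamma> n = Some (tail G e)}" using g e by (auto simp: transient_from_def)
  then obtain N where "\<And>n. path_vertex G \<gamma> n = Some (tail G e) \<Longrightarrow> n < N"
    using finite_nat_set_iff_bounded by auto
  then show ?thesis using path_arc(2)[OF gp] by (metis not_less)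
qed

lemma verts_loop_erasure_transient:
  assumes g: "transient_from u \<gamma>"
  shows "verts (path_digraph G (loop_erasure G \<gamma>)) = tail G ` arcs (path_digraph G (loop_erasure G \<gamma>))"
proof
  have gp: "\<gamma> \<in> paths G" using g by (simp add: transient_from_def)
  show "verts (path_digraph G (loop_erasure G \<gamma>)) \<subseteq> tail G ` arcs (path_digraph G (loop_erasure G \<gamma>))"
  proof
    fix v assume "v \<in> verts (path_digraph G (loop_erasure G \<gamma>))"
    then obtain i where i: "path_vertex G (loop_erasure G \<gamma>) i = Some v" by (auto simp: path_digraph_def)
    obtain s where s: "loop_erasure_time G \<gamma> i = Some s" using loop_erasure_time_transient[OF g] by blast
    obtain k where "loop_erasure_time G \<gamma> (Suc i) = Some k" using loop_erasure_time_transient[OF g] by blast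
    then obtain m where m: "s \<le> m" "path_vertex G \<gamma> m = path_vertex G \<gamma> s"
      "\<forall>t>m. path_vertex G \<gamma> t \<noteq> path_vertex G \<gamma> s" "snd \<gamma> m \<noteq> None"
      unfolding loop_erasure_time_Suc_iff using s by auto
    then obtain e where e: "snd \<gamma> m = Some e" by blast
    have "snd (loop_erasure G \<gamma>) i = Some e" unfolding loop_erasure_arc_iff using s m e by blast
    moreover have "tail G e = v"
      using path_arc(2)[OF gp e] m(2) loop_erasure_vertex[OF s] i by simp
    ultimately show "v \<in> tail G ` arcs (path_digraph G (loop_erasure G \<gamma>))"
      by (auto simp: arcs_path_digraph)
  qed
  show "tail G ` arcs (path_digraph G (loop_erasure G \<gamma>)) \<subseteq> verts (path_digraph G (loop_erasure G \<gamma>))"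
    using loop_erasure_tail_in_verts[OF gp] by blast
qed

lemma finite_wilson_in_arcs:
  assumes w: "\<And>j. transient_from (vs j) (w j)" and B: "finite B"
  shows "finite_wilson w B k \<subseteq> arcs G"
proof (induction k)
  case (Suc k)
  let ?C = "B - tail G ` finite_wilson w B k"
  have "finite ?C" using B by simp
  then have "list_loop_erasure (exit_prefix ?C (w k)) \<in> simple_exits ?C (vs k)"
    using list_loop_erasure_simple_exit exit_prefix_walk(1)[OF w] by blast
  then have "set (list_loop_erasure (exit_prefix ?C (w k))) \<subseteq> arcs G"
    by (auto simp: simple_exits_def exit_walk_def)
  with Suc show ?case by simp
qed simp

text \<open>
  Induction on the number of walks. If the next walk hits the vertices reached so far, then for all large
  \<open>B\<close> it leaves the unreached part of \<open>B\<close> at exactly the hitting time, and the loop-erasures agree. If it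
  does not, the time at which it leaves the unreached part of \<open>B\<close> tends to infinity, and a transient walk
  decides the fate of any given arc within finite time.
\<close>

lemma finite_wilson_stabilises:
  assumes w: "\<And>j. transient_from (vs j) (w j)"
  shows "verts (wilson_stage G w k) = tail G ` arcs (wilson_stage G w k) \<and>
    (\<forall>e\<in>arcs G. \<forall>\<^sub>F B in finite_subsets_at_top (verts G).
       e \<in> finite_wilson w B k \<longleftrightarrow> e \<in> arcs (wilson_stage G w k))"
proof (induction k)
  case 0 then show ?case by simp
next
  case (Suc k)
  let ?F = "finite_subsets_at_top (verts G)"
  let ?S = "verts (wilson_stage G w k)" and ?A = "arcs (wilson_stage G w k)"
  let ?\<gamma> = "w k" and ?D = "\<lambda>B. tail G ` finite_wilson w B k"
  let ?L = "path_digraph G (loop_erasure G (stop_on_hitting G ?S ?\<gamma>))"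
  have S: "?S = tail G ` ?A" and IH: "\<And>e. e \<in> arcs G \<Longrightarrow> \<forall>\<^sub>F B in ?F. e \<in> finite_wilson w B k \<longleftrightarrow> e \<in> ?A"
    using Suc by auto
  have wp: "\<And>j. w j \<in> paths G" and inf: "infinite_path ?\<gamma>" and start: "fst ?\<gamma> = vs k"
    using w by (auto simp: transient_from_def)
  have inf': "snd ?\<gamma> i \<noteq> None" for i using inf by (simp add: infinite_path_def)
  have A_sub: "?A \<subseteq> arcs G" by (rule wilson_stage_out_arcs(1)[OF wp])
  have fin: "\<forall>\<^sub>F B in ?F. finite B" by (rule eventually_finite_subsets_at_top_weakI)
  have in_B: "\<forall>\<^sub>F B in ?F. v \<in> B" if "v \<in> verts G" for v
    unfolding eventually_finite_subsets_at_top using that by (intro exI[of _ "{v}"]) auto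
  have D: "\<forall>\<^sub>F B in ?F. v \<in> ?D B \<longleftrightarrow> v \<in> ?S" if v: "v \<in> verts G" for v
  proof -
    have "\<forall>\<^sub>F B in ?F. \<forall>e\<in>out_arcs G v. e \<in> finite_wilson w B k \<longleftrightarrow> e \<in> ?A"
      using finite_out[OF v] IH by (intro eventually_ball_finite) auto
    then show ?thesis using fin
    proof eventually_elim
      case (elim B)
      have "finite_wilson w B k \<subseteq> arcs G" by (rule finite_wilson_in_arcs[OF w elim(2)])
      then have "v \<in> ?D B \<longleftrightarrow> (\<exists>e\<in>out_arcs G v. e \<in> finite_wilson w B k)" by fastforce
      also have "\<dots> \<longleftrightarrow> (\<exists>e\<in>out_arcs G v. e \<in> ?A)" using elim(1) by blast
      also have "\<dots> \<longleftrightarrow> v \<in> ?S" unfolding S using A_sub by fastforce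
      finally show ?case .
    qed
  qed
  have inside: "\<forall>\<^sub>F B in ?F. path_vertex G ?\<gamma> t \<in> Some ` (B - ?D B) \<longleftrightarrow> path_vertex G ?\<gamma> t \<notin> Some ` ?S" for t
  proof -
    obtain x where x: "x \<in> verts G" "path_vertex G ?\<gamma> t = Some x"
      using path_vertex_infinite[OF wp inf] by blast
    from D[OF x(1)] in_B[OF x(1)] show ?thesis by eventually_elim (auto simp: x(2))
  qed
  have inside_upto: "\<forall>\<^sub>F B in ?F. \<forall>t\<in>{..N}. path_vertex G ?\<gamma> t \<in> Some ` (B - ?D B) \<longleftrightarrow>
      path_vertex G ?\<gamma> t \<notin> Some ` ?S" for N
    by (intro eventually_ball_finite) (auto simp: inside)
  have "verts ?L \<union> ?S = tail G ` arcs ?L \<union> ?S \<and>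
    (\<forall>e\<in>arcs G. \<forall>\<^sub>F B in ?F. e \<in> set (list_loop_erasure (exit_prefix (B - ?D B) ?\<gamma>)) \<longleftrightarrow> e \<in> arcs ?L)"
  proof (cases rule: stop_on_hitting_cases[of ?\<gamma> ?S])
    case (hit \<tau>)
    have "path_vertex G ?\<gamma> i \<noteq> path_vertex G ?\<gamma> \<tau>" if "i < \<tau>" for i
      using hit(1) hit(2)[OF that] by auto
    then have arcs: "arcs ?L = set (list_loop_erasure (path_prefix \<tau> ?\<gamma>))"
      unfolding hit(3) using inf' by (intro loop_erasure_of_finite_path[OF wp]) auto
    have "starts_with (path_prefix \<tau> ?\<gamma>) ?\<gamma>" using inf' by (simp add: starts_with_iff)
    then have "awalk (vs k) (path_prefix \<tau> ?\<gamma>) (the (path_vertex G ?\<gamma> \<tau>))"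
      using starts_with_awalk[OF wp] start by fastforce
    then have "cas (vs k) (list_loop_erasure (path_prefix \<tau> ?\<gamma>)) (the (path_vertex G ?\<gamma> \<tau>))"
      using list_loop_erasure_walk by (auto simp: awalk_def)
    from cas_vertex_sets[OF this]
    have "verts ?L = insert (the (path_vertex G ?\<gamma> \<tau>)) (tail G ` arcs ?L)"
      unfolding verts_path_digraph arcs using hit(3) start by (simp add: path_take_def)
    moreover have "the (path_vertex G ?\<gamma> \<tau>) \<in> ?S" using hit(1) by auto
    moreover have "\<forall>\<^sub>F B in ?F. exit_prefix (B - ?D B) ?\<gamma> = path_prefix \<tau> ?\<gamma>"
      using inside_upto[of \<tau>]
    proof eventually_elim
      case (elim B)
      have "(LEAST n. path_vertex G ?\<gamma> n \<notin> Some ` (B - ?D B)) = \<tau>"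
      proof (rule Least_equality)
        show "path_vertex G ?\<gamma> \<tau> \<notin> Some ` (B - ?D B)" using elim hit(1) by blast
        fix n assume n: "path_vertex G ?\<gamma> n \<notin> Some ` (B - ?D B)"
        show "\<tau> \<le> n"
        proof (rule ccontr)
          assume "\<not> \<tau> \<le> n"
          then show False using n elim hit(2)[of n] by auto
        qed
      qed
      then show ?case by (simp add: exit_prefix_def)
    qed
    then have "\<forall>\<^sub>F B in ?F. e \<in> set (list_loop_erasure (exit_prefix (B - ?D B) ?\<gamma>)) \<longleftrightarrow> e \<in> arcs ?L" for e
      by eventually_elim (simp add: arcs)
    ultimately show ?thesis by auto
  next
    case miss
    have "verts ?L = tail G ` arcs ?L" unfolding miss(2) by (rule verts_loop_erasure_transient[OF w])
    moreover have "\<forall>\<^sub>F B in ?F. e \<in> set (list_loop_erasure (exit_prefix (B - ?D B) ?\<gamma>)) \<longleftrightarrow> e \<in> arcs ?L"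
      if e: "e \<in> arcs G" for e
    proof -
      obtain N where N: "\<And>t. t \<ge> N \<Longrightarrow> snd ?\<gamma> t \<noteq> Some e" using arc_crossed_finitely_often[OF w e] by blast
      obtain s where s: "loop_erasure_time G ?\<gamma> N = Some s" using loop_erasure_time_transient[OF w] by blast
      have "N \<le> s" by (rule loop_erasure_time_ge[OF s])
      show ?thesis using inside_upto[of s] fin
      proof eventually_elim
        case (elim B)
        let ?n = "LEAST n. path_vertex G ?\<gamma> n \<notin> Some ` (B - ?D B)"
        have "\<exists>n. path_vertex G ?\<gamma> n \<notin> Some ` (B - ?D B)" using elim(2) by (intro transient_exits[OF w]) auto
        from LeastI_ex[OF this] have "\<not> ?n \<le> s" using elim(1) miss(1) by auto
        then show ?case
          unfolding exit_prefix_def miss(2) using N \<open>N \<le> s\<close>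
          by (intro loop_erasure_arc_prefix[OF wp inf s, symmetric]) auto
      qed
    qed
    ultimately show ?thesis by auto
  qed
  then have V: "verts ?L \<union> ?S = tail G ` arcs ?L \<union> ?S"
    and E: "\<And>e. e \<in> arcs G \<Longrightarrow> \<forall>\<^sub>F B in ?F.
      e \<in> set (list_loop_erasure (exit_prefix (B - ?D B) ?\<gamma>)) \<longleftrightarrow> e \<in> arcs ?L" by auto
  have "verts (wilson_stage G w (Suc k)) = tail G ` arcs (wilson_stage G w (Suc k))"
    using V S by (auto simp: Digraph_Component.union_def)
  moreover have "\<forall>\<^sub>F B in ?F. e \<in> finite_wilson w B (Suc k) \<longleftrightarrow> e \<in> arcs (wilson_stage G w (Suc k))"
    if "e \<in> arcs G" for e
    using IH[OF that] E[OF that] by eventually_elim (simp add: Digraph_Component.union_def)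
  ultimately show ?case by blast
qed

end

section \<open>The law of the stacks built on the arboretum\<close>

lemma eventually_finite_subsetsI:
  assumes "finite X" "X \<subseteq> A" "\<And>B. finite B \<Longrightarrow> X \<subseteq> B \<Longrightarrow> B \<subseteq> A \<Longrightarrow> P B"
  shows "eventually P (finite_subsets_at_top A)"
  unfolding eventually_finite_subsets_at_top using assms by (intro exI[of _ X]) auto

lemma eventually_finite_subsetsE:
  assumes "eventually P (finite_subsets_at_top A)"
  obtains X where "finite X" "X \<subseteq> A" "\<And>B. finite B \<Longrightarrow> X \<subseteq> B \<Longrightarrow> B \<subseteq> A \<Longrightarrow> P B"
  using assms unfolding eventually_finite_subsets_at_top by metis

context infinite_sourced_eulerian_digraph
begin

lemma measurable_path_vertex: "(\<lambda>\<gamma>. path_vertex G \<gamma> t) \<in> measurable (path_space G) (count_space UNIV)"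
proof (cases t)
  case 0
  then show ?thesis using measurable_compose[OF measurable_path_fst_UNIV, of Some "count_space UNIV"] by simp
next
  case (Suc i)
  then show ?thesis
    using measurable_compose[OF measurable_path_step_UNIV[of i], of "map_option (head G)" "count_space UNIV"] by simp
qed

lemma pred_path_vertex_eq: "Measurable.pred (path_space G) (\<lambda>\<gamma>. path_vertex G \<gamma> t = x)"
  by (rule measurable_compose[OF measurable_path_vertex[of t]]) simp

lemma pred_same_vertex: "Measurable.pred (path_space G) (\<lambda>\<gamma>. path_vertex G \<gamma> s = path_vertex G \<gamma> t)"
proof -
  have ev: "Measurable.pred (path_space G) (\<lambda>\<gamma>. \<exists>x\<in>insert None (Some ` verts G).
      path_vertex G \<gamma> s = x \<and> path_vertex G \<gamma> t = x)"
    using countable_verts by (intro pred_ball_countable pred_intros_logic pred_path_vertex_eq) auto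
  have iff: "(\<exists>x\<in>insert None (Some ` verts G). path_vertex G \<gamma> s = x \<and> path_vertex G \<gamma> t = x) \<longleftrightarrow>
      path_vertex G \<gamma> s = path_vertex G \<gamma> t" if "\<gamma> \<in> space (path_space G)" for \<gamma>
    using path_vertex_in_verts[of \<gamma> s] that
    by (cases "path_vertex G \<gamma> s") (auto simp: space_path_space)
  show ?thesis by (rule iffD1[OF measurable_cong[OF iff] ev])
qed

lemma pred_step_eq: "Measurable.pred (path_space G) (\<lambda>\<gamma>. snd \<gamma> i = x)"
  by (rule measurable_compose[OF measurable_path_step_UNIV[of i]]) simp

lemma measurable_loop_erasure_time:
  "(\<lambda>\<gamma>. loop_erasure_time G \<gamma> i) \<in> measurable (path_space G) (count_space UNIV)"
proof (induction i)
  case 0 then show ?case by simp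
next
  case (Suc i)
  have some: "Measurable.pred (path_space G) (\<lambda>\<gamma>. loop_erasure_time G \<gamma> (Suc i) = Some k)" for k
  proof -
    have iff: "loop_erasure_time G \<gamma> (Suc i) = Some k \<longleftrightarrow>
     (\<exists>s\<in>UNIV. \<exists>m\<in>UNIV. loop_erasure_time G \<gamma> i = Some s \<and> k = Suc m \<and> s \<le> m \<and>
        path_vertex G \<gamma> m = path_vertex G \<gamma> s \<and>
        (\<forall>t\<in>{m<..}. \<not> path_vertex G \<gamma> t = path_vertex G \<gamma> s) \<and> \<not> snd \<gamma> m = None)" for \<gamma>
      unfolding loop_erasure_time_Suc_iff by auto
    have eq: "Measurable.pred (path_space G) (\<lambda>\<gamma>. loop_erasure_time G \<gamma> i = Some s)" for s
      by (rule measurable_compose[OF Suc]) simp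
    show ?thesis
      unfolding iff
      by (intro pred_ball_countable pred_intros_logic eq pred_same_vertex pred_step_eq) auto
  qed
  have "Measurable.pred (path_space G) (\<lambda>\<gamma>. loop_erasure_time G \<gamma> (Suc i) = k)" for k
  proof (cases k)
    case None
    have "Measurable.pred (path_space G) (\<lambda>\<gamma>. \<forall>k\<in>UNIV. \<not> loop_erasure_time G \<gamma> (Suc i) = Some k)"
      by (intro pred_ball_countable pred_intros_logic some) auto
    moreover have "(\<forall>k\<in>UNIV. \<not> loop_erasure_time G \<gamma> (Suc i) = Some k) \<longleftrightarrow> loop_erasure_time G \<gamma> (Suc i) = None" for \<gamma>
      by (cases "loop_erasure_time G \<gamma> (Suc i)") (auto simp del: loop_erasure_time.simps)
    ultimately show ?thesis unfolding None by (simp only:)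
  next
    case (Some k') then show ?thesis using some by blast
  qed
  then have "{\<gamma> \<in> space (path_space G). loop_erasure_time G \<gamma> (Suc i) = k} \<in> sets (path_space G)" for k
    unfolding pred_def .
  then show ?case by (intro measurable_count_space_fibres[of UNIV]) auto
qed

lemma pred_loop_erasure_step: "Measurable.pred (path_space G) (\<lambda>\<gamma>. snd (loop_erasure G \<gamma>) i = Some e)"
proof -
  have iff: "snd (loop_erasure G \<gamma>) i = Some e \<longleftrightarrow>
     (\<exists>s\<in>UNIV. \<exists>m\<in>UNIV. loop_erasure_time G \<gamma> i = Some s \<and> s \<le> m \<and>
        path_vertex G \<gamma> m = path_vertex G \<gamma> s \<and>
        (\<forall>t\<in>{m<..}. \<not> path_vertex G \<gamma> t = path_vertex G \<gamma> s) \<and> snd \<gamma> m = Some e)" for \<gamma>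
    unfolding loop_erasure_arc_iff by auto
  have eq: "Measurable.pred (path_space G) (\<lambda>\<gamma>. loop_erasure_time G \<gamma> i = Some s)" for s
    by (rule measurable_compose[OF measurable_loop_erasure_time]) simp
  show ?thesis
    unfolding iff by (intro pred_ball_countable pred_intros_logic eq pred_same_vertex pred_step_eq) auto
qed

lemma pred_loop_erasure_arc:
  "Measurable.pred (path_space G) (\<lambda>\<gamma>. e \<in> arcs (path_digraph G (loop_erasure G \<gamma>)))"
proof -
  have "Measurable.pred (path_space G) (\<lambda>\<gamma>. \<exists>i\<in>UNIV. snd (loop_erasure G \<gamma>) i = Some e)"
    by (intro pred_ball_countable pred_loop_erasure_step) auto
  then show ?thesis by (simp add: arcs_path_digraph)
qed

lemma pred_loop_erasure_vertex:
  "Measurable.pred (path_space G) (\<lambda>\<gamma>. x \<in> verts (path_digraph G (loop_erasure G \<gamma>)))"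
proof -
  have "Measurable.pred (path_space G) (\<lambda>\<gamma>. fst \<gamma> = x)"
    by (rule measurable_compose[OF measurable_path_fst_UNIV]) simp
  then have P: "Measurable.pred (path_space G) (\<lambda>\<gamma>. fst \<gamma> = x \<or>
      (\<exists>e\<in>in_arcs G x. e \<in> arcs (path_digraph G (loop_erasure G \<gamma>))))"
    using countable_arcs
    by (intro pred_intros_logic pred_ball_countable pred_loop_erasure_arc) (auto intro: countable_subset[OF _ countable_arcs])
  have iff: "(fst \<gamma> = x \<or> (\<exists>e\<in>in_arcs G x. e \<in> arcs (path_digraph G (loop_erasure G \<gamma>)))) \<longleftrightarrow>
      x \<in> verts (path_digraph G (loop_erasure G \<gamma>))" if "\<gamma> \<in> space (path_space G)" for \<gamma>
  proof -
    have "e \<in> arcs G" if "e \<in> arcs (path_digraph G (loop_erasure G \<gamma>))" for e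
      using loop_erasure_arc_crossed[OF that] path_arc(1)[of \<gamma>] \<open>\<gamma> \<in> space (path_space G)\<close>
      by (auto simp: space_path_space)
    then show ?thesis unfolding verts_path_digraph by fastforce
  qed
  show ?thesis by (rule iffD1[OF measurable_cong[OF iff] P])
qed

lemma measurable_stop_on_hitting:
  assumes w: "w \<in> measurable M (path_space G)"
    and S: "\<And>x. x \<in> verts G \<Longrightarrow> Measurable.pred M (\<lambda>\<omega>. x \<in> S \<omega>)"
  shows "(\<lambda>\<omega>. stop_on_hitting G (S \<omega>) (w \<omega>)) \<in> measurable M (path_space G)"
proof (rule measurable_pathI)
  have wp: "w \<omega> \<in> paths G" if "\<omega> \<in> space M" for \<omega>
    using measurable_space[OF w that] by (simp add: space_path_space)
  show "stop_on_hitting G (S \<omega>) (w \<omega>) \<in> paths G" if "\<omega> \<in> space M" for \<omega>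
    by (rule stop_on_hitting_in_paths[OF wp[OF that]])
  have "fst (stop_on_hitting G (S \<omega>) (w \<omega>)) = fst (w \<omega>)" for \<omega>
    by (simp add: stop_on_hitting_def path_take_def)
  then show "(\<lambda>\<omega>. fst (stop_on_hitting G (S \<omega>) (w \<omega>))) \<in> measurable M (count_space UNIV)"
    using measurable_compose[OF w measurable_path_fst_UNIV] by simp
  fix i
  have step: "snd (stop_on_hitting G (S \<omega>) (w \<omega>)) i =
      (if \<exists>t\<in>{..i}. path_vertex G (w \<omega>) t \<in> Some ` S \<omega> then None else snd (w \<omega>) i)" for \<omega>
  proof (cases rule: stop_on_hitting_cases[of "w \<omega>" "S \<omega>"])
    case (hit \<tau>)
    then have "(\<exists>t\<in>{..i}. path_vertex G (w \<omega>) t \<in> Some ` S \<omega>) \<longleftrightarrow> \<tau> \<le> i"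
      by (meson atMost_iff leI le_trans)
    then show ?thesis using hit(3) by (auto simp: path_take_def)
  next
    case miss then show ?thesis by auto
  qed
  have hit: "Measurable.pred M (\<lambda>\<omega>. path_vertex G (w \<omega>) t \<in> Some ` S \<omega>)" for t
  proof -
    have "Measurable.pred M (\<lambda>\<omega>. path_vertex G (w \<omega>) t = x)" for x
      by (rule measurable_compose[OF w pred_path_vertex_eq])
    then have P: "Measurable.pred M (\<lambda>\<omega>. \<exists>x\<in>verts G. path_vertex G (w \<omega>) t = Some x \<and> x \<in> S \<omega>)"
      by (intro pred_ball_countable[OF countable_verts] pred_intros_logic S)
    have iff: "(\<exists>x\<in>verts G. path_vertex G (w \<omega>) t = Some x \<and> x \<in> S \<omega>) \<longleftrightarrow> path_vertex G (w \<omega>) t \<in> Some ` S \<omega>"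
      if "\<omega> \<in> space M" for \<omega>
      using path_vertex_in_verts[OF wp[OF that], of t] by auto
    show ?thesis by (rule iffD1[OF measurable_cong[OF iff] P])
  qed
  have "Measurable.pred M (\<lambda>\<omega>. \<exists>t\<in>{..i}. path_vertex G (w \<omega>) t \<in> Some ` S \<omega>)"
    by (intro pred_ball_countable hit) auto
  then show "(\<lambda>\<omega>. snd (stop_on_hitting G (S \<omega>) (w \<omega>)) i) \<in> measurable M (count_space UNIV)"
    unfolding step using measurable_compose[OF w measurable_path_step_UNIV]
    by (intro measurable_If) (auto simp: pred_def)
qed

lemma pred_wilson_stage:
  assumes w: "\<And>j. w j \<in> measurable M (path_space G)"
  shows "Measurable.pred M (\<lambda>\<omega>. e \<in> arcs (wilson_stage G (\<lambda>j. w j \<omega>) k))"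
    and "Measurable.pred M (\<lambda>\<omega>. x \<in> verts (wilson_stage G (\<lambda>j. w j \<omega>) k))"
proof (induction k arbitrary: e x)
  case 0
  { case 1 show ?case by simp next case 2 show ?case by simp }
next
  case (Suc k)
  note stop = measurable_stop_on_hitting[OF w Suc(2), of k]
  {
    case 1
    have "Measurable.pred M (\<lambda>\<omega>. e \<in> arcs (wilson_stage G (\<lambda>j. w j \<omega>) k) \<or>
        e \<in> arcs (path_digraph G (loop_erasure G
          (stop_on_hitting G (verts (wilson_stage G (\<lambda>j. w j \<omega>) k)) (w k \<omega>)))))"
      by (intro pred_intros_logic Suc(1) measurable_compose[OF stop pred_loop_erasure_arc])
    then show ?case by (simp add: Digraph_Component.union_def)
  next
    case 2
    have "Measurable.pred M (\<lambda>\<omega>. x \<in> verts (wilson_stage G (\<lambda>j. w j \<omega>) k) \<or>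
        x \<in> verts (path_digraph G (loop_erasure G
          (stop_on_hitting G (verts (wilson_stage G (\<lambda>j. w j \<omega>) k)) (w k \<omega>)))))"
      by (intro pred_intros_logic Suc(2) measurable_compose[OF stop pred_loop_erasure_vertex])
    then show ?case by (simp add: Digraph_Component.union_def)
  }
qed

lemma pred_wilson_arboretum:
  assumes w: "\<And>j. w j \<in> measurable M (path_space G)"
  shows "Measurable.pred M (\<lambda>\<omega>. e \<in> arcs (wilson_arboretum G (\<lambda>j. w j \<omega>)))"
proof -
  have "Measurable.pred M (\<lambda>\<omega>. \<exists>k\<in>UNIV. e \<in> arcs (wilson_stage G (\<lambda>j. w j \<omega>) k))"
    by (intro pred_ball_countable pred_wilson_stage[OF w]) auto
  then show ?thesis by (simp add: arcs_wilson_arboretum)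
qed

lemma wilson_stage_verts_mono: "i \<le> j \<Longrightarrow> verts (wilson_stage G w i) \<subseteq> verts (wilson_stage G w j)"
  by (induction rule: dec_induct) (auto simp: Digraph_Component.union_def)

lemma wilson_start_in_verts:
  assumes "fst (w j) = v" "j < k"
  shows "v \<in> verts (wilson_stage G w k)"
proof -
  have "v \<in> verts (wilson_stage G w (Suc j))"
    using assms(1) by (simp add: Digraph_Component.union_def verts_path_digraph stop_on_hitting_def path_take_def)
  then show ?thesis using wilson_stage_verts_mono[of "Suc j" k w] assms(2) by auto
qed

text \<open>
  The stage already has an arc out of \<open>vs j\<close>, and the arboretum has no other.
\<close>

lemma wilson_arboretum_arc_early:
  assumes w: "\<And>j. transient_from (vs j) (w j)" and e: "e \<in> arcs (wilson_arboretum G w)"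
    and j: "tail G e = vs j" "j < k"
  shows "e \<in> arcs (wilson_stage G w k)"
proof -
  have wp: "\<And>j. w j \<in> paths G" using w by (simp add: transient_from_def)
  have "vs j \<in> verts (wilson_stage G w k)"
    using w[of j] j(2) by (intro wilson_start_in_verts) (auto simp: transient_from_def)
  then obtain e' where e': "e' \<in> arcs (wilson_stage G w k)" "tail G e' = vs j"
    using finite_wilson_stabilises[of vs w k, OF w] by auto
  then have "e' \<in> arcs (wilson_arboretum G w)" by (auto simp: arcs_wilson_arboretum)
  then have "e' = e"
    using e e'(2) j(1) by (intro inj_onD[OF wilson_arboretum_out_arcs(2)[of w, OF wp]]) auto
  then show ?thesis using e'(1) by simp
qed

lemma wilson_arboretum_spanning:
  assumes w: "\<And>j. transient_from (vs j) (w j)" and vs: "range vs = verts G"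
  shows "verts (wilson_arboretum G w) = verts G" "tail G ` arcs (wilson_arboretum G w) = verts G"
proof -
  have wp: "\<And>j. w j \<in> paths G" using w by (simp add: transient_from_def)
  have eq: "verts (wilson_arboretum G w) = tail G ` arcs (wilson_arboretum G w)"
    using finite_wilson_stabilises[of vs w, OF w]
    by (simp add: verts_wilson_arboretum arcs_wilson_arboretum image_UN)
  have "vs j \<in> verts (wilson_arboretum G w)" for j
  proof -
    have "vs j \<in> verts (wilson_stage G w (Suc j))"
      using w[of j] by (intro wilson_start_in_verts[of w j]) (auto simp: transient_from_def)
    then show ?thesis unfolding verts_wilson_arboretum by blast
  qed
  then have "range vs \<subseteq> verts (wilson_arboretum G w)" by blast
  then have "verts G \<subseteq> verts (wilson_arboretum G w)" using vs by simp
  moreover have "tail G ` arcs (wilson_arboretum G w) \<subseteq> verts G"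
    using wilson_arboretum_out_arcs(1)[of w, OF wp] by auto
  ultimately show "verts (wilson_arboretum G w) = verts G" "tail G ` arcs (wilson_arboretum G w) = verts G"
    using eq by auto
qed

end

context wilson_walks
begin

abbreviation arboretum :: "'w \<Rightarrow> ('v, 'e) pre_digraph" where
  "arboretum \<omega> \<equiv> wilson_arboretum G (\<lambda>j. W j \<omega>)"

lemma arboretum_event: "finite I \<Longrightarrow> {\<omega> \<in> space M. I \<subseteq> arcs (arboretum \<omega>)} \<in> events"
proof -
  assume "finite I"
  then have "Measurable.pred M (\<lambda>\<omega>. \<forall>e\<in>I. e \<in> arcs (arboretum \<omega>))"
    by (intro pred_ball_countable pred_wilson_arboretum walk.W_measurable) (auto simp: countable_finite)
  then show ?thesis by (simp add: pred_def subset_eq)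
qed

text \<open>
  The proportions are the probabilities that the algorithm on \<open>B\<close> finds the arcs \<open>t v\<close>, and the algorithm
  on \<open>B\<close> stabilises to the one rooted at infinity. As the limit theorem for probabilities needs a sequence,
  a failure of convergence is first witnessed by an increasing sequence of sets \<open>B\<close> that exhausts the
  vertices.
\<close>

proposition uniform_forests_tendsto_wilson:
  assumes J: "finite J" "J \<subseteq> verts G" and t: "\<And>v. v \<in> J \<Longrightarrow> t v \<in> out_arcs G v"
  shows "((\<lambda>B. real (card {f \<in> forests B. \<forall>v\<in>J. f v = t v}) / real (card (forests B))) \<longlongrightarrow>
           prob {\<omega> \<in> space M. t ` J \<subseteq> arcs (arboretum \<omega>)}) (finite_subsets_at_top (verts G))"
    (is "(?U \<longlongrightarrow> ?L) ?F")
proof (rule tendstoI, rule ccontr)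
  fix e :: real assume e: "e > 0" and "\<not> (\<forall>\<^sub>F B in ?F. dist (?U B) ?L < e)"
  define P where "P B \<longleftrightarrow> dist (?U B) ?L < e" for B
  have notev: "\<not> eventually P ?F" using \<open>\<not> (\<forall>\<^sub>F B in ?F. dist (?U B) ?L < e)\<close> unfolding P_def .
  have bad: "\<exists>B. finite B \<and> X \<subseteq> B \<and> B \<subseteq> verts G \<and> \<not> P B"
    if X: "finite X" "X \<subseteq> verts G" for X
  proof (rule ccontr)
    assume "\<not> ?thesis"
    then have "P B" if "finite B" "X \<subseteq> B" "B \<subseteq> verts G" for B using that by metis
    then have "eventually P ?F" by (rule eventually_finite_subsetsI[OF X])
    then show False using notev by contradiction
  qed
  obtain I where I: "finite I" "J = vs ` I"
    using finite_subset_image[OF J(1), of vs UNIV] J(2) range_vs by auto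
  \<comment> \<open>After \<open>k\<close> walks the arcs out of \<open>J\<close> are decided, for all
    \<open>B\<close> at once.\<close>
  obtain k where "\<And>i. i \<in> I \<Longrightarrow> i < k" using finite_nat_set_iff_bounded I(1) by auto
  then have k: "J \<subseteq> vs ` {..<k}" using I(2) by auto
  have "\<forall>n. \<exists>B. finite B \<and> J \<union> vs ` {..<n} \<subseteq> B \<and> B \<subseteq> verts G \<and> \<not> P B"
    using J range_vs by (intro allI bad) auto
  then obtain B where B: "\<And>n. finite (B n)" "\<And>n. J \<union> vs ` {..<n} \<subseteq> B n" "\<And>n. B n \<subseteq> verts G"
    and far: "\<And>n. \<not> P (B n)" by metis
  have "\<forall>n. \<exists>E. E \<in> events \<and> prob E = ?U (B n) \<and>
      (AE \<omega> in M. \<omega> \<in> E \<longleftrightarrow> t ` J \<subseteq> finite_wilson (\<lambda>j. W j \<omega>) (B n) k)"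
  proof
    fix n
    have JB: "J \<subseteq> B n" using B(2)[of n] by blast
    show "\<exists>E. E \<in> events \<and> prob E = ?U (B n) \<and>
      (AE \<omega> in M. \<omega> \<in> E \<longleftrightarrow> t ` J \<subseteq> finite_wilson (\<lambda>j. W j \<omega>) (B n) k)"
      by (rule finite_wilson_law[OF B(1)[of n] B(3)[of n] JB k t]) blast+
  qed
  from choice[OF this] obtain E where "\<forall>n. E n \<in> events \<and> prob (E n) = ?U (B n) \<and>
      (AE \<omega> in M. \<omega> \<in> E n \<longleftrightarrow> t ` J \<subseteq> finite_wilson (\<lambda>j. W j \<omega>) (B n) k)" ..
  then have E: "\<And>n. E n \<in> events" "\<And>n. prob (E n) = ?U (B n)"
    "\<And>n. AE \<omega> in M. \<omega> \<in> E n \<longleftrightarrow> t ` J \<subseteq> finite_wilson (\<lambda>j. W j \<omega>) (B n) k" by simp_all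
  have AE_E: "AE \<omega> in M. \<forall>n. \<omega> \<in> E n \<longleftrightarrow> t ` J \<subseteq> finite_wilson (\<lambda>j. W j \<omega>) (B n) k"
    unfolding AE_all_countable using E(3) by blast
  have "(\<lambda>n. prob (E n)) \<longlonglongrightarrow> ?L"
  proof (rule measure_tendsto_of_eventually_iff[OF E(1)])
    show "{\<omega> \<in> space M. t ` J \<subseteq> arcs (arboretum \<omega>)} \<in> events" using J by (intro arboretum_event) auto
    show "AE \<omega> in M. \<forall>\<^sub>F n in sequentially. \<omega> \<in> E n \<longleftrightarrow> \<omega> \<in> {\<omega> \<in> space M. t ` J \<subseteq> arcs (arboretum \<omega>)}"
      using AE_E AE_all_transient AE_space
    proof eventually_elim
      case (elim \<omega>)
      let ?w = "\<lambda>j. W j \<omega>"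
      have tr: "\<And>j. transient_from (vs j) (W j \<omega>)" using elim(2) by blast
      define Q where "Q B \<longleftrightarrow>
        (\<forall>v\<in>J. t v \<in> finite_wilson ?w B k \<longleftrightarrow> t v \<in> arcs (wilson_stage G ?w k))" for B
      have "eventually Q ?F"
        unfolding Q_def
        using finite_wilson_stabilises[of vs ?w k, OF tr] t J(1) by (intro eventually_ball_finite) auto
      then obtain X where X: "finite X" "X \<subseteq> verts G" and
        XB: "\<And>B. finite B \<Longrightarrow> X \<subseteq> B \<Longrightarrow> B \<subseteq> verts G \<Longrightarrow> Q B"
        by (rule eventually_finite_subsetsE) blast
      obtain I' where I': "finite I'" "X = vs ` I'"
        using finite_subset_image[OF X(1), of vs UNIV] X(2) range_vs by auto
      obtain N where N: "\<And>i. i \<in> I' \<Longrightarrow> i < N" using finite_nat_set_iff_bounded I'(1) by auto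
      have same: "t v \<in> arcs (arboretum \<omega>) \<longleftrightarrow> t v \<in> arcs (wilson_stage G ?w k)" if v: "v \<in> J" for v
      proof
        assume "t v \<in> arcs (arboretum \<omega>)"
        moreover obtain j where "v = vs j" "j < k" using k v by auto
        ultimately show "t v \<in> arcs (wilson_stage G ?w k)"
          using t[OF v] by (intro wilson_arboretum_arc_early[of vs ?w, OF tr]) auto
      qed (auto simp: arcs_wilson_arboretum)
      show ?case
        unfolding eventually_sequentially
      proof (intro exI[of _ N] allI impI)
        fix n assume "N \<le> n"
        then have "X \<subseteq> B n" using B(2)[of n] N I'(2) by fastforce
        from XB[OF B(1) this B(3)] show "\<omega> \<in> E n \<longleftrightarrow> \<omega> \<in> {\<omega> \<in> space M. t ` J \<subseteq> arcs (arboretum \<omega>)}"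
          using elim(1,3) same unfolding Q_def image_subset_iff by simp
      qed
    qed
  qed
  then have "(\<lambda>n. ?U (B n)) \<longlonglongrightarrow> ?L" unfolding E(2) .
  from tendstoD[OF this e] have "\<forall>\<^sub>F n in sequentially. P (B n)" unfolding P_def .
  with far show False by simp
qed

lemma arboretum_out_arcs:
  assumes "\<omega> \<in> space M"
  shows "arcs (arboretum \<omega>) \<subseteq> arcs G" "inj_on (tail G) (arcs (arboretum \<omega>))"
proof -
  have "W j \<omega> \<in> paths G" for j by (rule walk.W_path[OF assms])
  then show "arcs (arboretum \<omega>) \<subseteq> arcs G" "inj_on (tail G) (arcs (arboretum \<omega>))"
    using wilson_arboretum_out_arcs[of "\<lambda>j. W j \<omega>"] by blast+
qed

lemma arboretum_arc_unique:
  "\<omega> \<in> space M \<Longrightarrow> e \<in> arcs (arboretum \<omega>) \<Longrightarrow> e' \<in> arcs (arboretum \<omega>) \<Longrightarrow> tail G e = tail G e' \<Longrightarrow> e = e'"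
  using inj_onD[OF arboretum_out_arcs(2)] by blast

lemma the_out_arc:
  assumes "\<omega> \<in> space M" "e \<in> arcs (arboretum \<omega>)" "tail G e = v"
  shows "(THE e. e \<in> out_arcs (arboretum \<omega>) v) = e"
  using assms(2,3) arboretum_arc_unique[OF assms(1)]
  by (intro the_equality) (auto simp: tail_wilson_arboretum)

lemma AE_arboretum_spanning:
  "AE \<omega> in M. verts (arboretum \<omega>) = verts G \<and> tail G ` arcs (arboretum \<omega>) = verts G"
  using AE_all_transient
proof eventually_elim
  case (elim \<omega>)
  then have tr: "\<And>j. transient_from (vs j) (W j \<omega>)" by blast
  show ?case using wilson_arboretum_spanning[of vs "\<lambda>j. W j \<omega>", OF tr range_vs] by simp
qed

lemma stack_config_eq_iff:
  assumes om: "\<omega> \<in> space M" and tails: "tail G ` arcs (arboretum \<omega>) = verts G" and v: "v \<in> verts G"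
    and l: "l \<noteq> []" "last l \<in> out_arcs G v"
  shows "stack_config (arboretum \<omega>) r v = l \<longleftrightarrow> last l \<in> arcs (arboretum \<omega>) \<and> r v = butlast l"
proof -
  obtain e where e: "e \<in> arcs (arboretum \<omega>)" "tail G e = v" using tails v by (metis imageE)
  then have "e \<in> out_arcs (arboretum \<omega>) v" by (simp add: tail_wilson_arboretum)
  then have "stack_config (arboretum \<omega>) r v = r v @ [e]"
    using the_out_arc[OF om e] by (auto simp: stack_config_def)
  moreover have "last l \<in> arcs (arboretum \<omega>) \<longleftrightarrow> last l = e"
    using e l(2) arboretum_arc_unique[OF om, of "last l" e] by auto
  ultimately show ?thesis using l(1)
    by (metis append_butlast_last_id butlast_snoc last_snoc)
qed

text \<open>
  A description in terms of events, which also covers the points where the arboretum has no arc out of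
  \<open>v\<close>.
\<close>

lemma stack_config_cases:
  assumes om: "\<omega> \<in> space M"
  shows "stack_config (arboretum \<omega>) r v = l \<longleftrightarrow>
    (\<exists>e\<in>out_arcs G v. e \<in> arcs (arboretum \<omega>) \<and> r v @ [e] = l) \<or>
    (\<forall>e\<in>out_arcs G v. \<not> e \<in> arcs (arboretum \<omega>)) \<and> r v = l"
proof (cases "\<exists>e\<in>arcs (arboretum \<omega>). tail G e = v")
  case True
  then obtain e where e: "e \<in> arcs (arboretum \<omega>)" "tail G e = v" by blast
  have "e \<in> out_arcs (arboretum \<omega>) v" using e by (simp add: tail_wilson_arboretum)
  then have st: "stack_config (arboretum \<omega>) r v = r v @ [e]"
    using the_out_arc[OF om e] by (auto simp: stack_config_def)
  have only: "e' \<in> out_arcs G v \<and> e' \<in> arcs (arboretum \<omega>) \<longleftrightarrow> e' = e" for e'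
    using e arboretum_out_arcs(1)[OF om] arboretum_arc_unique[OF om, of e' e] by auto
  have "(\<exists>e'\<in>out_arcs G v. e' \<in> arcs (arboretum \<omega>) \<and> r v @ [e'] = l) \<longleftrightarrow> r v @ [e] = l"
    using only by metis
  moreover have "\<not> (\<forall>e'\<in>out_arcs G v. \<not> e' \<in> arcs (arboretum \<omega>))" using only by metis
  ultimately show ?thesis unfolding st by blast
next
  case False
  then have "out_arcs (arboretum \<omega>) v = {}" by (auto simp: out_arcs_def tail_wilson_arboretum)
  then have "stack_config (arboretum \<omega>) r v = r v" by (simp add: stack_config_def)
  then show ?thesis using False by auto
qed

lemma pred_stack_config:
  assumes R: "uniform_orderings_given G M arboretum R" and v: "v \<in> verts G"
  shows "Measurable.pred M (\<lambda>\<omega>. stack_config (arboretum \<omega>) (\<lambda>v. R v \<omega>) v = l)"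
proof -
  have R_eq: "Measurable.pred M (\<lambda>\<omega>. P (R v \<omega>))" for P
  proof -
    have "R v \<in> measurable M (count_space (lists (out_arcs G v)))"
      using R v by (simp add: uniform_orderings_given_def)
    then show ?thesis by (rule measurable_compose) simp
  qed
  have "Measurable.pred M (\<lambda>\<omega>. (\<exists>e\<in>out_arcs G v. e \<in> arcs (arboretum \<omega>) \<and> R v \<omega> @ [e] = l) \<or>
    (\<forall>e\<in>out_arcs G v. \<not> e \<in> arcs (arboretum \<omega>)) \<and> R v \<omega> = l)"
    using finite_out[OF v]
    by (intro pred_intros_logic pred_ball_countable pred_wilson_arboretum walk.W_measurable R_eq)
       (auto simp: countable_finite)
  then show ?thesis by (subst measurable_cong[OF stack_config_cases]) auto
qed

text \<open>
  The stacks are the orderings \<open>s v\<close> iff the arboretum contains their last arcs, an event \<open>C\<close> in the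
  conditioning sigma-algebra, and the random orderings are the remaining entries. On \<open>C\<close> the latter has
  conditional probability \<open>1 / (d - 1)!\<close> at a vertex of out-degree \<open>d\<close>.
\<close>

proposition prob_stack_config:
  assumes R: "uniform_orderings_given G M arboretum R"
    and J: "finite J" "J \<subseteq> verts G"
    and s: "\<And>v. v \<in> J \<Longrightarrow> s v \<in> permutations_of_set (out_arcs G v)"
  shows "prob {\<omega> \<in> space M. \<forall>v\<in>J. stack_config (arboretum \<omega>) (\<lambda>v. R v \<omega>) v = s v} =
    prob {\<omega> \<in> space M. (\<lambda>v. last (s v)) ` J \<subseteq> arcs (arboretum \<omega>)} *
    (\<Prod>v\<in>J. 1 / fact (out_degree G v - 1))"
proof -
  have sv: "s v \<noteq> []" "set (s v) = out_arcs G v" "distinct (s v)" "last (s v) \<in> out_arcs G v" if v: "v \<in> J" for v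
  proof -
    show st: "set (s v) = out_arcs G v" "distinct (s v)" using s[OF v] by (auto simp: permutations_of_set_def)
    have "out_arcs G v \<noteq> {}" using out_arcs_nonempty v J(2) by blast
    then show ne: "s v \<noteq> []" using st(1) by auto
    show "last (s v) \<in> out_arcs G v" using last_in_set[OF ne] st(1) by simp
  qed
  have R_meas: "R v \<in> measurable M (count_space (lists (out_arcs G v)))" if "v \<in> verts G" for v
    using R that by (simp add: uniform_orderings_given_def)
  define C where "C = {\<omega> \<in> space M. (\<lambda>v. last (s v)) ` J \<subseteq> arcs (arboretum \<omega>)}"
  define D where "D = {\<omega> \<in> space M. \<forall>v\<in>J. R v \<omega> = butlast (s v)}"
  define F where "F = sigma (space M) ((\<lambda>e. {\<omega> \<in> space M. e \<in> arcs (arboretum \<omega>)}) ` arcs G)"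
  have gen: "(\<lambda>e. {\<omega> \<in> space M. e \<in> arcs (arboretum \<omega>)}) ` arcs G \<subseteq> events"
    using arboretum_event[of "{e}" for e] by auto
  have sets_F: "sets F = sigma_sets (space M) ((\<lambda>e. {\<omega> \<in> space M. e \<in> arcs (arboretum \<omega>)}) ` arcs G)"
    unfolding F_def by (intro sets_measure_of) auto
  have space_F: "space F = space M" unfolding F_def by (intro space_measure_of) auto
  have sub: "subalgebra M F"
    unfolding subalgebra_def space_F sets_F using gen by (auto intro: sets.sigma_sets_subset[THEN subsetD])
  interpret finite_measure_subalgebra M F
    using sub by (simp add: finite_measure_subalgebra_def finite_measure_subalgebra_axioms_def finite_measure_axioms)
  have C_F: "C \<in> sets F"
  proof -
    have "{\<omega> \<in> space F. \<forall>v\<in>J. last (s v) \<in> arcs (arboretum \<omega>)} \<in> sets F"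
      using J(1)
    proof (rule sets.sets_Collect_finite_All[rotated])
      fix v assume v: "v \<in> J"
      then show "{\<omega> \<in> space F. last (s v) \<in> arcs (arboretum \<omega>)} \<in> sets F"
        unfolding space_F sets_F using sv(4)[OF v] by (intro sigma_sets.Basic) auto
    qed
    then show ?thesis by (simp add: C_def space_F image_subset_iff)
  qed
  have D_ev: "D \<in> events"
  proof -
    have "Measurable.pred M (\<lambda>\<omega>. R v \<omega> = l)" if "v \<in> verts G" for v l
      by (rule measurable_compose[OF R_meas[OF that]]) simp
    then have "Measurable.pred M (\<lambda>\<omega>. \<forall>v\<in>J. R v \<omega> = butlast (s v))"
      using J by (intro pred_ball_countable) (auto simp: countable_finite)
    then show ?thesis by (simp add: D_def pred_def)
  qed
  have C_ev: "C \<in> events" using C_F sub by (auto simp: subalgebra_def)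
  have int_D: "integrable M (indicator D :: _ \<Rightarrow> real)"
    using D_ev by (intro integrable_real_indicator) (auto simp: emeasure_eq_measure)
  have rce: "AE \<omega> in M. real_cond_exp M F (indicator D) \<omega> =
      (\<Prod>v\<in>J. pmf (pmf_of_set (permutations_of_set (out_arcs G v - arcs (arboretum \<omega>)))) (butlast (s v)))"
    using R J unfolding uniform_orderings_given_def F_def D_def
    by (elim conjE allE[of _ J] allE[of _ "\<lambda>v. butlast (s v)"]) blast
  have on_C: "AE \<omega> in M. indicator C \<omega> * real_cond_exp M F (indicator D) \<omega> =
      indicator C \<omega> * (\<Prod>v\<in>J. 1 / fact (out_degree G v - 1))"
    using rce AE_space
  proof eventually_elim
    case (elim \<omega>)
    show ?case
    proof (cases "\<omega> \<in> C")
      case True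
      have "pmf (pmf_of_set (permutations_of_set (out_arcs G v - arcs (arboretum \<omega>)))) (butlast (s v)) =
          1 / fact (out_degree G v - 1)" if v: "v \<in> J" for v
      proof -
        let ?e = "last (s v)"
        have vv: "v \<in> verts G" using v J by blast
        have e: "?e \<in> arcs (arboretum \<omega>)" using True v by (auto simp: C_def)
        have "e' = ?e" if "e' \<in> out_arcs G v" "e' \<in> arcs (arboretum \<omega>)" for e'
          using arboretum_arc_unique[OF elim(2) that(2) e] that(1) sv(4)[OF v] by simp
        then have "out_arcs G v - arcs (arboretum \<omega>) = out_arcs G v - {?e}"
          using e by blast
        moreover have "butlast (s v) \<in> permutations_of_set (out_arcs G v - {?e})"
        proof -
          have "s v = butlast (s v) @ [?e]" using sv(1)[OF v] by simp
          then have "set (s v) = insert ?e (set (butlast (s v)))" "?e \<notin> set (butlast (s v))" "distinct (butlast (s v))"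
            using sv(3)[OF v] by (metis list.set(2) rotate1.simps(2) set_rotate1,
              metis distinct_append not_distinct_conv_prefix distinct_butlast, simp add: distinct_butlast)
          then show ?thesis using sv(2)[OF v] by (auto simp: permutations_of_set_def)
        qed
        moreover have "card (out_arcs G v - {?e}) = out_degree G v - 1"
          using sv(4)[OF v] by (simp add: out_degree_def)
        ultimately show ?thesis using finite_out[OF vv] by (subst pmf_of_set) auto
      qed
      then show ?thesis using elim by (simp cong: prod.cong)
    qed simp
  qed
  have "prob (C \<inter> D) = (\<integral>\<omega>\<in>C. indicator D \<omega> \<partial>M)"
    using C_ev D_ev sets.sets_into_space
    by (simp add: set_lebesgue_integral_def indicator_inter_arith[symmetric] Int_absorb2)
  also have "\<dots> = (\<integral>\<omega>\<in>C. real_cond_exp M F (indicator D) \<omega> \<partial>M)"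
    by (rule real_cond_exp_intA[OF int_D C_F])
  also have "\<dots> = (\<integral>\<omega>. indicator C \<omega> * (\<Prod>v\<in>J. 1 / fact (out_degree G v - 1)) \<partial>M)"
    unfolding set_lebesgue_integral_def real_scaleR_def
    using C_ev on_C by (intro integral_cong_AE) (auto intro: measurable_from_subalg[OF sub])
  also have "\<dots> = prob C * (\<Prod>v\<in>J. 1 / fact (out_degree G v - 1))"
    using C_ev sets.sets_into_space by (simp add: Int_absorb2)
  finally have CD: "prob (C \<inter> D) = prob C * (\<Prod>v\<in>J. 1 / fact (out_degree G v - 1))" .
  have "AE \<omega> in M. \<omega> \<in> {\<omega> \<in> space M. \<forall>v\<in>J. stack_config (arboretum \<omega>) (\<lambda>v. R v \<omega>) v = s v} \<longleftrightarrow> \<omega> \<in> C \<inter> D"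
    using AE_arboretum_spanning AE_space
  proof eventually_elim
    case (elim \<omega>)
    then have "stack_config (arboretum \<omega>) (\<lambda>v. R v \<omega>) v = s v \<longleftrightarrow>
        last (s v) \<in> arcs (arboretum \<omega>) \<and> R v \<omega> = butlast (s v)" if "v \<in> J" for v
      using J that sv by (intro stack_config_eq_iff) auto
    then show ?case using elim by (auto simp: C_def D_def)
  qed
  moreover have "{\<omega> \<in> space M. \<forall>v\<in>J. stack_config (arboretum \<omega>) (\<lambda>v. R v \<omega>) v = s v} \<in> events"
  proof -
    have "Measurable.pred M (\<lambda>\<omega>. \<forall>v\<in>J. stack_config (arboretum \<omega>) (\<lambda>v. R v \<omega>) v = s v)"
      using J by (intro pred_ball_countable pred_stack_config[OF R]) (auto simp: countable_finite)
    then show ?thesis by (simp add: pred_def)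
  qed
  ultimately have "prob {\<omega> \<in> space M. \<forall>v\<in>J. stack_config (arboretum \<omega>) (\<lambda>v. R v \<omega>) v = s v} = prob (C \<inter> D)"
    using C_ev D_ev by (intro finite_measure_eq_AE) auto
  then show ?thesis using CD by (simp add: C_def)
qed

end

section \<open>Recovering the path from its stacks\<close>

text \<open>
  Reduces finite-dimensional marginals to point masses.
\<close>

lemma (in prob_space) prob_all_in_eq_sum:
  assumes J: "finite J" and P: "\<And>i. i \<in> J \<Longrightarrow> finite (P i)"
    and AE_P: "AE \<omega> in M. \<forall>i\<in>J. Y \<omega> i \<in> P i"
    and ev: "\<And>i l. i \<in> J \<Longrightarrow> Measurable.pred M (\<lambda>\<omega>. Y \<omega> i = l)"
    and evA: "{\<omega> \<in> space M. \<forall>i\<in>J. Y \<omega> i \<in> A i} \<in> events"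
  shows "prob {\<omega> \<in> space M. \<forall>i\<in>J. Y \<omega> i \<in> A i} =
    (\<Sum>s\<in>PiE J (\<lambda>i. A i \<inter> P i). prob {\<omega> \<in> space M. \<forall>i\<in>J. Y \<omega> i = s i})"
proof -
  let ?S = "PiE J (\<lambda>i. A i \<inter> P i)" and ?E = "\<lambda>s. {\<omega> \<in> space M. \<forall>i\<in>J. Y \<omega> i = s i}"
  have fin: "finite ?S" using J P by (intro finite_PiE) auto
  have E: "?E s \<in> events" for s
  proof -
    have "Measurable.pred M (\<lambda>\<omega>. \<forall>i\<in>J. Y \<omega> i = s i)"
      using J ev by (intro pred_ball_countable) (auto simp: countable_finite)
    then show ?thesis by (simp add: pred_def)
  qed
  have "prob {\<omega> \<in> space M. \<forall>i\<in>J. Y \<omega> i \<in> A i} = prob (\<Union>s\<in>?S. ?E s)"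
  proof (rule finite_measure_eq_AE[OF _ evA])
    show "(\<Union>s\<in>?S. ?E s) \<in> events" using fin E by (intro sets.finite_UN) auto
    show "AE \<omega> in M. \<omega> \<in> {\<omega> \<in> space M. \<forall>i\<in>J. Y \<omega> i \<in> A i} \<longleftrightarrow> \<omega> \<in> (\<Union>s\<in>?S. ?E s)"
      using AE_P
    proof eventually_elim
      case (elim \<omega>)
      show ?case
      proof
        assume om: "\<omega> \<in> {\<omega> \<in> space M. \<forall>i\<in>J. Y \<omega> i \<in> A i}"
        then have "restrict (Y \<omega>) J \<in> ?S" "\<omega> \<in> ?E (restrict (Y \<omega>) J)" using elim by auto
        then show "\<omega> \<in> (\<Union>s\<in>?S. ?E s)" by blast
      next
        assume "\<omega> \<in> (\<Union>s\<in>?S. ?E s)"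
        then obtain s where "s \<in> ?S" "\<omega> \<in> ?E s" by blast
        then show "\<omega> \<in> {\<omega> \<in> space M. \<forall>i\<in>J. Y \<omega> i \<in> A i}" using PiE_mem by fastforce
      qed
    qed
  qed
  also have "\<dots> = (\<Sum>s\<in>?S. prob (?E s))"
  proof (rule finite_measure_finite_Union[OF fin])
    show "disjoint_family_on ?E ?S"
      unfolding disjoint_family_on_def
    proof (intro ballI impI equals0I)
      fix s s' \<omega> assume s: "s \<in> ?S" "s' \<in> ?S" "s \<noteq> s'" "\<omega> \<in> ?E s \<inter> ?E s'"
      have "s = s'" by (rule PiE_ext[OF s(1,2)]) (use s(4) in auto)
      then show False using s(3) by simp
    qed
  qed (use E in blast)
  finally show ?thesis .
qed

context infinite_sourced_eulerian_digraph
begin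

lemma maximal_path_initial:
  assumes "snd (maximal_path G a S) n \<noteq> None" "i \<le> n"
  shows "snd (maximal_path G a S) i \<noteq> None"
  using assms(2,1)
proof (induction rule: dec_induct)
  case (step n)
  have "snd (maximal_path G a S) n \<noteq> None"
  proof
    obtain u T where uT: "stack_state G a S n = (u, T)" by (cases "stack_state G a S n")
    assume "snd (maximal_path G a S) n = None"
    then have "T u = []" using uT by (auto simp: maximal_path_def split: list.splits)
    then have "snd (maximal_path G a S) (Suc n) = None" using uT by (simp add: maximal_path_def)
    then show False using step.prems by simp
  qed
  then show ?case by (rule step.IH)
qed simp

lemma maximal_path_starts:
  assumes "snd (maximal_path G a S) n = Some e"
  shows "starts_with (path_prefix n (maximal_path G a S) @ [e]) (maximal_path G a S)"
  using maximal_path_initial[of a S n] assms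
  by (auto simp: starts_with_append1 starts_with_iff less_imp_le path_prefix_Suc)

lemma starts_with_maximal_path_iff:
  assumes "a \<in> verts G" "\<And>v. v \<in> verts G \<Longrightarrow> set (S v) \<subseteq> out_arcs G v"
  shows "starts_with p (maximal_path G a S) \<longleftrightarrow>
    (\<exists>b. awalk a p b) \<and> (\<forall>v\<in>tail G ` set p. prefix (exit_list p v) (S v))"
proof -
  have "exit_list p v = []" if "v \<notin> tail G ` set p" for v
    using that by (auto simp: exit_list_def filter_empty_conv)
  then have "(\<forall>v. prefix (exit_list p v) (S v)) \<longleftrightarrow> (\<forall>v\<in>tail G ` set p. prefix (exit_list p v) (S v))"
    by (metis Nil_prefix)
  then show ?thesis using stack_state_follow(1)[OF assms, of p] by simp
qed

lemma maximal_path_in_paths: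
  assumes a: "a \<in> verts G" and S: "\<And>v. v \<in> verts G \<Longrightarrow> set (S v) \<subseteq> out_arcs G v"
  shows "maximal_path G a S \<in> paths G"
proof -
  let ?X = "maximal_path G a S"
  have fst: "fst ?X = a" by (simp add: maximal_path_def)
  have "e \<in> arcs G \<and> path_vertex G ?X i = Some (tail G e)" if e: "snd ?X i = Some e" for i e
  proof -
    obtain b where b: "awalk a (path_prefix i ?X @ [e]) b"
      using maximal_path_starts[OF e] starts_with_maximal_path_iff[OF a S] by blast
    then have "cas a (path_prefix i ?X) (tail G e)" "e \<in> arcs G"
      by (auto simp: awalk_def cas_snoc simp del: cas_append_iff)
    moreover have "path_vertex G ?X i = Some (tail G e)" if "cas a (path_prefix i ?X) (tail G e)"
    proof (cases i)
      case 0 then show ?thesis using that fst by (simp add: path_prefix_def)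
    next
      case (Suc j)
      then obtain e' where "snd ?X j = Some e'" using maximal_path_initial[of a S i j] e by auto
      then show ?thesis using that unfolding Suc path_prefix_Suc cas_snoc by simp
    qed
    ultimately show ?thesis by blast
  qed
  then show ?thesis using a fst by (auto simp: paths_def)
qed

lemma maximal_path_cong:
  assumes a: "a \<in> verts G" and S: "\<And>v. v \<in> verts G \<Longrightarrow> set (S v) \<subseteq> out_arcs G v"
    and eq: "\<And>v. v \<in> verts G \<Longrightarrow> S v = S' v"
  shows "maximal_path G a S = maximal_path G a S'"
proof -
  have S': "\<And>v. v \<in> verts G \<Longrightarrow> set (S' v) \<subseteq> out_arcs G v" using S eq by simp
  have starts: "starts_with p (maximal_path G a S) \<longleftrightarrow> starts_with p (maximal_path G a S')" for p
  proof (cases "\<exists>b. awalk a p b")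
    case True
    then have "v \<in> verts G" if "v \<in> tail G ` set p" for v using that by (auto simp: awalk_def)
    then show ?thesis
      using eq by (simp add: starts_with_maximal_path_iff[OF a S] starts_with_maximal_path_iff[OF a S'])
  qed (simp add: starts_with_maximal_path_iff[OF a S] starts_with_maximal_path_iff[OF a S'])
  have "snd (maximal_path G a S) n = snd (maximal_path G a S') n" for n
  proof (cases "snd (maximal_path G a S) n")
    case (Some e)
    then show ?thesis using maximal_path_starts[OF Some] unfolding starts by (simp add: starts_with_append1)
  next
    case None
    show ?thesis
    proof (cases "snd (maximal_path G a S') n")
      case (Some e)
      then show ?thesis
        using maximal_path_starts[OF Some] unfolding starts[symmetric] by (simp add: starts_with_append1)
    qed (simp add: None)
  qed
  then show ?thesis by (intro prod_eqI) (auto simp: maximal_path_def)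
qed

text \<open>
  Only stacks that consist of arcs out of their own vertex occur, so that maximal paths are paths in \<open>G\<close>
  without exceptional events.
\<close>

definition stack_space :: "('v \<Rightarrow> 'e list) measure" where
  "stack_space = PiM (verts G) (\<lambda>v. count_space (lists (out_arcs G v)))"

lemma stack_space_arcs: "S \<in> space stack_space \<Longrightarrow> v \<in> verts G \<Longrightarrow> set (S v) \<subseteq> out_arcs G v"
  by (auto simp: stack_space_def space_PiM PiE_iff)

lemma measurable_maximal_path: "maximal_path G source \<in> measurable stack_space (path_space G)"
proof (rule measurable_pathI)
  show in_paths: "maximal_path G source S \<in> paths G" if "S \<in> space stack_space" for S
    using stack_space_arcs[OF that] source_in_verts by (intro maximal_path_in_paths)
  show "(\<lambda>S. fst (maximal_path G source S)) \<in> measurable stack_space (count_space UNIV)"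
    by (simp add: maximal_path_def)
  fix i
  have starts: "Measurable.pred stack_space (\<lambda>S. starts_with p (maximal_path G source S))" for p
  proof -
    have "Measurable.pred stack_space (\<lambda>S. \<forall>v\<in>tail G ` set p. prefix (exit_list p v) (S v))"
      if "\<exists>b. awalk source p b"
    proof (rule pred_ball_countable)
      fix v assume "v \<in> tail G ` set p"
      then have "v \<in> verts G" using that by (auto simp: awalk_def)
      then have "(\<lambda>S. S v) \<in> measurable stack_space (count_space (lists (out_arcs G v)))"
        unfolding stack_space_def by (rule measurable_component_singleton)
      then show "Measurable.pred stack_space (\<lambda>S. prefix (exit_list p v) (S v))"
        by (rule measurable_compose) simp
    qed (auto simp: countable_finite)
    then have "Measurable.pred stack_space (\<lambda>S. (\<exists>b. awalk source p b) \<and>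
        (\<forall>v\<in>tail G ` set p. prefix (exit_list p v) (S v)))"
      by (cases "\<exists>b. awalk source p b") auto
    moreover have "starts_with p (maximal_path G source S) \<longleftrightarrow>
        (\<exists>b. awalk source p b) \<and> (\<forall>v\<in>tail G ` set p. prefix (exit_list p v) (S v))"
      if "S \<in> space stack_space" for S
      by (rule starts_with_maximal_path_iff[OF source_in_verts stack_space_arcs[OF that]])
    ultimately show ?thesis by (subst measurable_cong) auto
  qed
  have some: "Measurable.pred stack_space (\<lambda>S. snd (maximal_path G source S) i = Some e)" for e
  proof -
    have "Measurable.pred stack_space (\<lambda>S. \<exists>q\<in>{q \<in> lists (arcs G). length q = i}.
        starts_with (q @ [e]) (maximal_path G source S))"
      using countable_arc_lists by (intro pred_ball_countable starts) (auto intro: countable_subset)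
    moreover have "snd (maximal_path G source S) i = Some e \<longleftrightarrow>
        (\<exists>q\<in>{q \<in> lists (arcs G). length q = i}. starts_with (q @ [e]) (maximal_path G source S))"
      if S: "S \<in> space stack_space" for S
    proof
      assume e: "snd (maximal_path G source S) i = Some e"
      have "starts_with (path_prefix i (maximal_path G source S)) (maximal_path G source S)"
        using maximal_path_starts[OF e] by (simp add: starts_with_append1)
      from starts_with_awalk[OF in_paths[OF S] this]
      have "set (path_prefix i (maximal_path G source S)) \<subseteq> arcs G" by (simp add: awalk_def)
      then show "\<exists>q\<in>{q \<in> lists (arcs G). length q = i}. starts_with (q @ [e]) (maximal_path G source S)"
        using maximal_path_starts[OF e]
        by (intro bexI[of _ "path_prefix i (maximal_path G source S)"]) auto
    qed (auto simp: starts_with_append1)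
    ultimately show ?thesis by (subst measurable_cong) auto
  qed
  have none: "Measurable.pred stack_space (\<lambda>S. snd (maximal_path G source S) i = None)"
  proof -
    have "Measurable.pred stack_space (\<lambda>S. \<forall>e\<in>arcs G. \<not> snd (maximal_path G source S) i = Some e)"
      by (intro pred_ball_countable[OF countable_arcs] pred_intros_logic some)
    moreover have "snd (maximal_path G source S) i = None \<longleftrightarrow>
        (\<forall>e\<in>arcs G. \<not> snd (maximal_path G source S) i = Some e)" if "S \<in> space stack_space" for S
      using path_arc(1)[OF in_paths[OF that], of i] by (cases "snd (maximal_path G source S) i") auto
    ultimately show ?thesis by (subst measurable_cong) auto
  qed
  show "(\<lambda>S. snd (maximal_path G source S) i) \<in> measurable stack_space (count_space UNIV)"
  proof (rule measurable_count_space_fibres)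
    show "countable (insert None (Some ` arcs G))" using countable_arcs by simp
    fix S assume "S \<in> space stack_space"
    then show "snd (maximal_path G source S) i \<in> insert None (Some ` arcs G)"
      using path_arc(1)[OF in_paths, of S i] by (cases "snd (maximal_path G source S) i") auto
  next
    fix x
    have "Measurable.pred stack_space (\<lambda>S. snd (maximal_path G source S) i = x)"
      using some none by (cases x) auto
    then show "{S \<in> space stack_space. snd (maximal_path G source S) i = x} \<in> sets stack_space"
      by (simp add: pred_def)
  qed
qed

text \<open>
  At each vertex there are only finitely many orderings, so the point masses determine the marginals.
\<close>

lemma stack_space_eqI:
  assumes "prob_space M" "prob_space N"
    and S: "S \<in> measurable M stack_space" and T: "T \<in> measurable N stack_space"
    and perm: "AE x in M. \<forall>v\<in>verts G. S x v \<in> permutations_of_set (out_arcs G v)"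
      "AE x in N. \<forall>v\<in>verts G. T x v \<in> permutations_of_set (out_arcs G v)"
    and eq: "\<And>J s. finite J \<Longrightarrow> J \<subseteq> verts G \<Longrightarrow> (\<And>v. v \<in> J \<Longrightarrow> s v \<in> permutations_of_set (out_arcs G v)) \<Longrightarrow>
      measure M {x \<in> space M. \<forall>v\<in>J. S x v = s v} = measure N {x \<in> space N. \<forall>v\<in>J. T x v = s v}"
  shows "distr M stack_space S = distr N stack_space T"
proof -
  interpret M: prob_space M by fact
  interpret N: prob_space N by fact
  let ?L = "\<lambda>v. count_space (lists (out_arcs G v))"
  have coord: "Measurable.pred K (\<lambda>x. P (Y x v))" if "Y \<in> measurable K stack_space" "v \<in> verts G" for K Y v P
  proof -
    have "(\<lambda>x. Y x v) \<in> measurable K (?L v)"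
      using that unfolding stack_space_def by (rule measurable_compose[OF _ measurable_component_singleton])
    then show ?thesis by (rule measurable_compose) simp
  qed
  have emb: "Y -` prod_emb (verts G) ?L J (PiE J A) \<inter> space K = {x \<in> space K. \<forall>v\<in>J. Y x v \<in> A v}"
    if "Y \<in> measurable K stack_space" "J \<subseteq> verts G" for K :: "'k measure" and Y J A
    using measurable_space[OF that(1)] that(2)
    by (fastforce simp: prod_emb_iff stack_space_def space_PiM PiE_iff)
  show ?thesis
  proof (rule measure_eqI_PiM_infinite[where I = "verts G" and M = ?L])
    show "finite_measure (distr M stack_space S)"
      by (rule prob_space.finite_measure[OF M.prob_space_distr[OF S]])
    fix A J assume J: "finite J" "J \<subseteq> verts G" and "\<And>v. v \<in> J \<Longrightarrow> A v \<in> sets (?L v)"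
    then have X: "prod_emb (verts G) ?L J (PiE J A) \<in> sets stack_space"
      unfolding stack_space_def by (intro sets_PiM_I) auto
    have ev: "{x \<in> space K. \<forall>v\<in>J. Y x v \<in> A v} \<in> sets K"
      if "Y \<in> measurable K stack_space" for K :: "'k measure" and Y
      using measurable_sets[OF that X] emb[OF that J(2)] by simp
    have perms: "finite (permutations_of_set (out_arcs G v))" if "v \<in> J" for v by simp
    have "emeasure (distr M stack_space S) (prod_emb (verts G) ?L J (PiE J A)) =
        M.prob {x \<in> space M. \<forall>v\<in>J. S x v \<in> A v}"
      unfolding emeasure_distr[OF S X] emb[OF S J(2)] M.emeasure_eq_measure ..
    also have "M.prob {x \<in> space M. \<forall>v\<in>J. S x v \<in> A v} =
        (\<Sum>s\<in>PiE J (\<lambda>v. A v \<inter> permutations_of_set (out_arcs G v)). M.prob {x \<in> space M. \<forall>v\<in>J. S x v = s v})"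
      using perm(1) J(2) by (intro M.prob_all_in_eq_sum J(1) perms ev[OF S] coord[OF S]) (auto elim: eventually_mono)
    also have "\<dots> =
        (\<Sum>s\<in>PiE J (\<lambda>v. A v \<inter> permutations_of_set (out_arcs G v)). N.prob {x \<in> space N. \<forall>v\<in>J. T x v = s v})"
      using J by (intro sum.cong eq) auto
    also have "\<dots> = N.prob {x \<in> space N. \<forall>v\<in>J. T x v \<in> A v}"
      using perm(2) J(2)
      by (intro N.prob_all_in_eq_sum[symmetric] J(1) perms ev[OF T] coord[OF T]) (auto elim: eventually_mono)
    also have "ennreal (N.prob {x \<in> space N. \<forall>v\<in>J. T x v \<in> A v}) =
        emeasure (distr N stack_space T) (prod_emb (verts G) ?L J (PiE J A))"
      unfolding emeasure_distr[OF T X] emb[OF T J(2)] N.emeasure_eq_measure ..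
    finally show "emeasure (distr M stack_space S) (prod_emb (verts G) ?L J (PiE J A)) =
        emeasure (distr N stack_space T) (prod_emb (verts G) ?L J (PiE J A))" .
  qed (simp_all add: stack_space_def)
qed

end

context wilson_walks
begin

text \<open>
  The path crosses every arc, so it uses up every stack; its last exit from a vertex is then the bottom of
  the stack there, which is the arc of the arboretum.
\<close>

lemma last_exit_arboretum_eq:
  assumes om: "\<omega> \<in> space M" and span: "verts (arboretum \<omega>) = verts G" "tail G ` arcs (arboretum \<omega>) = verts G"
    and perm: "\<And>v. v \<in> verts G \<Longrightarrow> stack_config (arboretum \<omega>) r v \<in> permutations_of_set (out_arcs G v)"
    and ray: "eulerian_ray (maximal_path G source (stack_config (arboretum \<omega>) r))"
  shows "last_exit_arboretum G (maximal_path G source (stack_config (arboretum \<omega>) r)) = arboretum \<omega>"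
proof -
  let ?S = "stack_config (arboretum \<omega>) r"
  let ?X = "maximal_path G source ?S"
  interpret digraph_eulerian_ray G source ?X by unfold_locales (rule ray)
  have S: "set (?S v) \<subseteq> out_arcs G v" if "v \<in> verts G" for v
    using perm[OF that] by (simp add: permutations_of_set_def)
  have exits: "ray_exits ?X v = ?S v" if v: "v \<in> verts G" for v
  proof -
    obtain n where n: "out_arcs G v \<subseteq> set (path_prefix n ?X)" using obtain_covering_time[OF v] by metis
    have "prefix (exit_list (path_prefix n ?X) v) (?S v)"
      by (rule spec[OF conjunct2[OF iffD1[OF stack_state_follow(1)[OF source_in_verts S] starts_with_prefix[of n]]]])
    then obtain q where q: "?S v = ray_exits ?X v @ q" unfolding ray_exits_eq[OF n] by (auto simp: prefix_def)
    have "length (?S v) = length (ray_exits ?X v)"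
      using perm[OF v] ray_exits_permutation[OF v] by (metis length_finite_permutations_of_set)
    then show ?thesis using q by simp
  qed
  have last: "last (?S v) \<in> arcs (arboretum \<omega>) \<and> tail G (last (?S v)) = v" if v: "v \<in> verts G" for v
  proof -
    have "v \<in> tail G ` arcs (arboretum \<omega>)" using v by (simp only: span(2))
    then obtain e where e: "e \<in> arcs (arboretum \<omega>)" "tail G e = v" by (elim imageE) auto
    then have "e \<in> out_arcs (arboretum \<omega>) v" by (simp add: tail_wilson_arboretum)
    then have "?S v = r v @ [e]"
      using the_out_arc[OF om e] by (auto simp: stack_config_def)
    then show ?thesis using e by simp
  qed
  have "arcs (last_exit_arboretum G ?X) = (\<lambda>v. last (?S v)) ` verts G"
    unfolding arcs_last_exit_arboretum by (simp add: exits cong: image_cong)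
  also have "\<dots> = arcs (arboretum \<omega>)"
  proof
    show "arcs (arboretum \<omega>) \<subseteq> (\<lambda>v. last (?S v)) ` verts G"
    proof
      fix e assume e: "e \<in> arcs (arboretum \<omega>)"
      have v: "tail G e \<in> verts G" using e span(2) by blast
      then have "last (?S (tail G e)) = e"
        using last[OF v] e arboretum_arc_unique[OF om, of _ e] by blast
      then show "e \<in> (\<lambda>v. last (?S v)) ` verts G" using v by force
    qed
  qed (use last in blast)
  finally have "arcs (last_exit_arboretum G ?X) = arcs (arboretum \<omega>)" .
  moreover have "verts (last_exit_arboretum G ?X) = verts (arboretum \<omega>)"
    using verts_last_exit_arboretum span(1) by simp
  ultimately show ?thesis
    by (intro pre_digraph.equality)
       (auto simp: last_exit_arboretum_def wilson_arboretum_def Union_def)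
qed

end

theorem theorem3p4:
  fixes G :: "('v, 'e) pre_digraph" and source :: 'v
    and \<mu> :: "('v, 'e) dpath measure"
    and vs :: "nat \<Rightarrow> 'v"
    and M :: "'w measure"
    and W :: "nat \<Rightarrow> 'w \<Rightarrow> ('v, 'e) dpath"
    and A :: "'w \<Rightarrow> ('v, 'e) pre_digraph"
    and R :: "'v \<Rightarrow> 'w \<Rightarrow> 'e list"
    and X :: "'w \<Rightarrow> ('v, 'e) dpath"
  assumes "infinite_sourced_eulerian_digraph G source"
    and "proper_gibbs_measure G source \<mu>"
    and "prob_space M"
    and "bij_betw vs UNIV (verts G)"
    and "\<And>j. random_walk G (vs j) M (W j)"
    and "prob_space.indep_vars M (\<lambda>_. path_space G) W UNIV"
    and "\<And>\<omega>. A \<omega> = wilson_arboretum G (\<lambda>j. W j \<omega>)"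
    and "uniform_orderings_given G M A R"
    and "\<And>\<omega>. X \<omega> = maximal_path G source (stack_config (A \<omega>) (\<lambda>v. R v \<omega>))"
  shows "distr M (path_space G) X = \<mu> \<and> (AE \<omega> in M. last_exit_arboretum G (X \<omega>) = A \<omega>)"
proof -
  interpret infinite_sourced_eulerian_digraph G source by fact
  interpret mu: proper_gibbs G source \<mu>
    using assms(2) by (intro proper_gibbs.intro infinite_sourced_eulerian_digraph_axioms proper_gibbs_axioms.intro)
      (simp_all add: proper_gibbs_measure_def)
  interpret wil: wilson_walks G source M vs W
    using assms(3-6) mu.eulerian_ray_exists
    by (intro wilson_walks.intro infinite_sourced_eulerian_digraph_axioms wilson_walks_axioms.intro)
  have A: "A = wil.arboretum" using assms(7) by blast
  have R: "uniform_orderings_given G M wil.arboretum R" using assms(8) unfolding A .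
  let ?C = "\<lambda>\<omega>. stack_config (wil.arboretum \<omega>) (\<lambda>v. R v \<omega>)"
  define S where "S \<omega> = restrict (?C \<omega>) (verts G)" for \<omega>
  \<comment> \<open>The filter puts the stacks into \<open>stack_space\<close> everywhere; it does nothing on
    Eulerian rays.\<close>
  define T where "T Y = (\<lambda>v\<in>verts G. filter (\<lambda>e. e \<in> out_arcs G v) (ray_exits Y v))" for Y :: "('v, 'e) dpath"
  have C_lists: "?C \<omega> v \<in> lists (out_arcs G v)" if "\<omega> \<in> space M" "v \<in> verts G" for \<omega> v
  proof -
    have "R v \<omega> \<in> lists (out_arcs G v)"
      using R that measurable_space[of "R v" M "count_space (lists (out_arcs G v))" \<omega>]
      by (simp add: uniform_orderings_given_def)
    moreover have "?C \<omega> v = ?C \<omega> v" ..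
    ultimately show ?thesis
      unfolding wil.stack_config_cases[OF that(1), of "\<lambda>v. R v \<omega>" v "?C \<omega> v"]
      by (metis append_in_lists_conv lists.simps)
  qed
  have S_meas: "S \<in> measurable M stack_space"
    unfolding stack_space_def S_def
  proof (rule measurable_restrict)
    fix v assume v: "v \<in> verts G"
    have "(\<lambda>\<omega>. ?C \<omega> v) \<in> measurable M (count_space UNIV)"
    proof (rule measurable_count_space_fibres)
      show "countable (lists (out_arcs G v))" using finite_out[OF v] by (intro countable_lists countable_finite)
      show "{\<omega> \<in> space M. ?C \<omega> v = l} \<in> sets M" for l
        using wil.pred_stack_config[OF R v, of l] by (simp add: pred_def)
    qed (rule C_lists[OF _ v])
    then show "(\<lambda>\<omega>. ?C \<omega> v) \<in> measurable M (count_space (lists (out_arcs G v)))"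
    proof (rule measurable_count_space_restrict)
      fix \<omega> assume "\<omega> \<in> space M"
      then show "?C \<omega> v \<in> lists (out_arcs G v)" by (rule C_lists[OF _ v])
    qed
  qed
  have T_meas: "T \<in> measurable \<mu> stack_space"
    unfolding stack_space_def T_def
  proof (rule measurable_restrict)
    fix v
    have "(\<lambda>Y. filter (\<lambda>e. e \<in> out_arcs G v) (ray_exits Y v)) \<in> measurable \<mu> (count_space UNIV)"
      by (rule measurable_compose[OF mu.measurable_ray_exits_mu]) simp
    then show "(\<lambda>Y. filter (\<lambda>e. e \<in> out_arcs G v) (ray_exits Y v)) \<in>
        measurable \<mu> (count_space (lists (out_arcs G v)))"
      by (rule measurable_count_space_restrict) auto
  qed
  have T_ray: "AE Y in \<mu>. \<forall>v\<in>verts G. T Y v = ray_exits Y v \<and> ray_exits Y v \<in> permutations_of_set (out_arcs G v)"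
    using mu.AE_eulerian_ray
  proof eventually_elim
    case (elim Y)
    interpret digraph_eulerian_ray G source Y by unfold_locales (rule elim)
    show ?case
      using ray_exits_permutation by (auto simp: T_def permutations_of_set_def intro!: filter_True)
  qed
  have fin_dim: "wil.prob {\<omega> \<in> space M. \<forall>v\<in>J. S \<omega> v = s v} = mu.prob {Y \<in> space \<mu>. \<forall>v\<in>J. T Y v = s v}"
    if J: "finite J" "J \<subseteq> verts G" and s: "\<And>v. v \<in> J \<Longrightarrow> s v \<in> permutations_of_set (out_arcs G v)" for J s
  proof -
    have last: "last (s v) \<in> out_arcs G v" if v: "v \<in> J" for v
    proof -
      have "set (s v) = out_arcs G v" using s[OF v] by (simp add: permutations_of_set_def)
      moreover have "out_arcs G v \<noteq> {}" using out_arcs_nonempty v J(2) by blast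
      ultimately show ?thesis by (metis last_in_set list.set(1))
    qed
    have "{\<omega> \<in> space M. \<forall>v\<in>J. S \<omega> v = s v} = {\<omega> \<in> space M. \<forall>v\<in>J. ?C \<omega> v = s v}"
      using J(2) by (auto simp: S_def)
    then have "wil.prob {\<omega> \<in> space M. \<forall>v\<in>J. S \<omega> v = s v} =
        wil.prob {\<omega> \<in> space M. (\<lambda>v. last (s v)) ` J \<subseteq> arcs (wil.arboretum \<omega>)} *
        (\<Prod>v\<in>J. 1 / fact (out_degree G v - 1))"
      using wil.prob_stack_config[OF R J s] by simp
    also have "\<dots> = mu.prob {Y \<in> space \<mu>. \<forall>v\<in>J. ray_exits Y v = s v}"
      using mu.prob_ray_exits[OF J s wil.range_vs wil.uniform_forests_tendsto_wilson[OF J last]] by simp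
    also have "\<dots> = mu.prob {Y \<in> space \<mu>. \<forall>v\<in>J. T Y v = s v}"
    proof (rule mu.finite_measure_eq_AE)
      show "AE Y in \<mu>. Y \<in> {Y \<in> space \<mu>. \<forall>v\<in>J. ray_exits Y v = s v} \<longleftrightarrow> Y \<in> {Y \<in> space \<mu>. \<forall>v\<in>J. T Y v = s v}"
        using T_ray
      proof eventually_elim
        case (elim Y)
        then have "\<forall>v\<in>J. T Y v = ray_exits Y v" using J(2) by blast
        then show ?case by auto
      qed
      have "Measurable.pred \<mu> (\<lambda>Y. \<forall>v\<in>J. ray_exits Y v = s v)"
        using J by (intro pred_ball_countable mu.pred_ray_exits_eq) (auto simp: countable_finite)
      then show "{Y \<in> space \<mu>. \<forall>v\<in>J. ray_exits Y v = s v} \<in> mu.events" by (simp add: pred_def)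
      have "Measurable.pred \<mu> (\<lambda>Y. \<forall>v\<in>J. filter (\<lambda>e. e \<in> out_arcs G v) (ray_exits Y v) = s v)"
      proof (rule pred_ball_countable)
        fix v
        show "Measurable.pred \<mu> (\<lambda>Y. filter (\<lambda>e. e \<in> out_arcs G v) (ray_exits Y v) = s v)"
          by (rule measurable_compose[OF mu.measurable_ray_exits_mu]) simp
      qed (use J in \<open>simp add: countable_finite\<close>)
      then have "{Y \<in> space \<mu>. \<forall>v\<in>J. filter (\<lambda>e. e \<in> out_arcs G v) (ray_exits Y v) = s v} \<in> mu.events"
        by (simp add: pred_def)
      moreover have "{Y \<in> space \<mu>. \<forall>v\<in>J. T Y v = s v} =
          {Y \<in> space \<mu>. \<forall>v\<in>J. filter (\<lambda>e. e \<in> out_arcs G v) (ray_exits Y v) = s v}"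
        using J(2) by (auto simp: T_def)
      ultimately show "{Y \<in> space \<mu>. \<forall>v\<in>J. T Y v = s v} \<in> mu.events" by simp
    qed
    finally show ?thesis .
  qed
  have T_perm: "AE Y in \<mu>. \<forall>v\<in>verts G. T Y v \<in> permutations_of_set (out_arcs G v)"
    using T_ray by eventually_elim simp
  \<comment> \<open>That a stack almost surely contains all the arcs out of its vertex is inherited from
    \<open>\<mu>\<close>, by adding up the equal point masses.\<close>
  have S_perm: "AE \<omega> in M. \<forall>v\<in>verts G. S \<omega> v \<in> permutations_of_set (out_arcs G v)"
  proof (subst AE_ball_countable[OF countable_verts], intro ballI)
    fix v assume v: "v \<in> verts G"
    let ?P = "permutations_of_set (out_arcs G v)"
    have coord: "Measurable.pred K (\<lambda>x. Q (Y x v))" if "Y \<in> measurable K stack_space" for K Y Q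
    proof -
      have "(\<lambda>x. Y x v) \<in> measurable K (count_space (lists (out_arcs G v)))"
        using that v unfolding stack_space_def by (rule measurable_compose[OF _ measurable_component_singleton])
      then show ?thesis by (rule measurable_compose) simp
    qed
    have ev: "{x \<in> space K. Q (Y x v)} \<in> sets K" if "Y \<in> measurable K stack_space" for K Y Q
      using coord[OF that, of Q] by (simp add: pred_def)
    have un: "{x \<in> space K. Y x v \<in> ?P} = (\<Union>l\<in>?P. {x \<in> space K. Y x v = l})" for K :: "'k measure" and Y
      by auto
    have "wil.prob {\<omega> \<in> space M. S \<omega> v \<in> ?P} = (\<Sum>l\<in>?P. wil.prob {\<omega> \<in> space M. S \<omega> v = l})"
      unfolding un using ev[OF S_meas, of "\<lambda>x. x = l" for l]
      by (intro wil.finite_measure_finite_Union) (auto simp: disjoint_family_on_def)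
    also have "\<dots> = (\<Sum>l\<in>?P. mu.prob {Y \<in> space \<mu>. T Y v = l})"
      using fin_dim[of "{v}" "\<lambda>_. l" for l] v by (intro sum.cong) auto
    also have "\<dots> = mu.prob {Y \<in> space \<mu>. T Y v \<in> ?P}"
      unfolding un using ev[OF T_meas, of "\<lambda>x. x = l" for l]
      by (intro mu.finite_measure_finite_Union[symmetric]) (auto simp: disjoint_family_on_def)
    also have "\<dots> = 1"
      using T_perm v ev[OF T_meas, of "\<lambda>l. l \<in> ?P"] by (subst mu.prob_Collect_eq_1) (auto elim: eventually_mono)
    finally show "AE \<omega> in M. S \<omega> v \<in> ?P"
      using ev[OF S_meas, of "\<lambda>l. l \<in> ?P"] by (subst (asm) wil.prob_Collect_eq_1) auto
  qed
  have same: "distr M stack_space S = distr \<mu> stack_space T"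
    by (rule stack_space_eqI[OF assms(3) mu.prob_space_axioms S_meas T_meas S_perm T_perm fin_dim])
  have X: "X \<omega> = maximal_path G source (S \<omega>)" if "\<omega> \<in> space M" for \<omega>
    using C_lists[OF that] unfolding assms(9) A
    by (intro maximal_path_cong source_in_verts) (auto simp: S_def)
  have T_path: "AE Y in \<mu>. maximal_path G source (T Y) = Y"
    using mu.AE_eulerian_ray T_ray
  proof eventually_elim
    case (elim Y)
    interpret digraph_eulerian_ray G source Y by unfold_locales (rule elim(1))
    have "maximal_path G source (T Y) = maximal_path G source (ray_exits Y)"
      using elim(2) by (intro maximal_path_cong source_in_verts) (auto simp: permutations_of_set_def)
    then show ?case by (simp add: maximal_path_ray_exits)
  qed
  have "distr M (path_space G) X = distr M (path_space G) (maximal_path G source \<circ> S)"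
    using X by (intro distr_cong) auto
  also have "\<dots> = distr (distr M stack_space S) (path_space G) (maximal_path G source)"
    by (rule distr_distr[symmetric, OF measurable_maximal_path S_meas])
  also have "\<dots> = distr (distr \<mu> stack_space T) (path_space G) (maximal_path G source)"
    by (simp only: same)
  also have "\<dots> = distr \<mu> (path_space G) (maximal_path G source \<circ> T)"
    by (rule distr_distr[OF measurable_maximal_path T_meas])
  also have "\<dots> = distr \<mu> \<mu> (\<lambda>Y. Y)"
  proof (rule distr_cong_AE)
    show "AE Y in \<mu>. (maximal_path G source \<circ> T) Y = Y" using T_path by simp
    show "maximal_path G source \<circ> T \<in> measurable \<mu> (path_space G)"
      by (rule measurable_comp[OF T_meas measurable_maximal_path])
  qed (simp_all add: mu.sets_mu)
  also have "\<dots> = \<mu>" by (rule distr_id2) simp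
  finally have law: "distr M (path_space G) X = \<mu>" .
  have X_meas: "X \<in> measurable M (path_space G)"
    using measurable_comp[OF S_meas measurable_maximal_path] X by (subst measurable_cong) auto
  have "AE Y in distr M (path_space G) X. eulerian_ray Y" unfolding law by (rule mu.AE_eulerian_ray)
  then have "AE \<omega> in M. eulerian_ray (X \<omega>)" by (rule AE_distrD[OF X_meas])
  then have "AE \<omega> in M. last_exit_arboretum G (X \<omega>) = A \<omega>"
    using S_perm wil.AE_arboretum_spanning AE_space
  proof eventually_elim
    case (elim \<omega>)
    show ?case
      using elim unfolding assms(9) A
      by (intro wil.last_exit_arboretum_eq) (auto simp: S_def)
  qed
  with law show ?thesis by blast
qed

end
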